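(* Let $d\ge1$, and let $\alpha$ satisfy $\frac{d+2}{2}<\alpha<d+2$ if $d\ge2$, and $2\le\alpha<3$ if $d=1$. Let $c_W$ satisfy $c(d,\alpha)<c_W<C(d,\alpha)$, where $$c(d,\alpha)=\alpha^{-\alpha/2}e^{\alpha/2}(2\pi)^{-d/2},\qquad C(d,\alpha)=\Big(\frac{e}{d+2-\alpha}\Big)^{(d+2-\alpha)/2}c_{d,\alpha}(d-\alpha),\qquad c_{d,\alpha}=\frac{\Gamma((d-\alpha)/2)}{\pi^{d/2}2^\alpha\Gamma(\alpha/2)}.$$ Then, for all sufficiently small $\lambda\in(0,1)$, any compactly supported $d_\infty$-local minimizer $\rho$ of the interaction energy associated to the potential $$W(x)=c_{d,\alpha}|x|^{\alpha-d}+\frac{|x|^2}{2}-c_W\sum_{k=1}^\infty\lambda^{(\alpha-d)k}\exp\Big(-\frac{|x|^2}{2\lambda^{2k}}\Big)$$ is almost fractal.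
   Context: When $\alpha=d$, the convention is $c_{d,\alpha}|x|^{\alpha-d}:=-\frac{2}{\pi^{d/2}2^\alpha\Gamma(\alpha/2)}\ln|x|$, and $c_{d,\alpha}(d-\alpha)$ is understood as its limiting value $\frac{2}{\pi^{d/2}2^d\Gamma(d/2)}$. When $\alpha\le d$, $W(0)=+\infty$. $E[\rho]=\frac12\int\int W(x-y)\,d\rho(y)\,d\rho(x)$. $d_\infty(\mu,\nu)=\inf_{\pi\in\Pi(\mu,\nu)}\sup_{(x,y)\in\operatorname{supp}\pi}|x-y|$ for compactly supported probability measures ($\Pi(\mu,\nu)$: transport plans). $\rho$ is a $d_\infty$-local minimizer if there is $\epsilon>0$ with $E[\rho]\le E[\nu]$ for all compactly supported probability measures $\nu$ with $d_\infty(\rho,\nu)<\epsilon$. $\rho$ is almost fractal if $\operatorname{supp}\rho$ contains no isolated points and, for every $\epsilon_0>0$, the superlevel set $\{x:\rho(x)\ge\epsilon_0\}$ has empty interior. Here $\{\rho\ge\epsilon_0\}$ means $\{\rho_c\ge\epsilon_0\}$, where $\rho_c\in L^1$ is the absolutely continuous part of $\rho$ with respect to Lebesgue measure (for any representative of $\rho_c$). *)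

theory Defs
  imports "HOL-Probability.Probability"
begin

section \<open>Borel probability measures and the infinity-Wasserstein distance\<close>

definition msupport :: "'a::topological_space measure \<Rightarrow> 'a set" where
  "msupport \<mu> = {x. \<forall>U. open U \<longrightarrow> x \<in> U \<longrightarrow> emeasure \<mu> U > 0}"

definition compact_prob :: "'a::topological_space measure \<Rightarrow> bool" where
  "compact_prob \<mu> \<longleftrightarrow> prob_space \<mu> \<and> sets \<mu> = sets borel \<and> compact (msupport \<mu>)"

definition transport_plans ::
    "'a::topological_space measure \<Rightarrow> 'a measure \<Rightarrow> ('a \<times> 'a) measure set" where
  "transport_plans \<mu> \<nu> =
     {\<pi>. prob_space \<pi> \<and> sets \<pi> = sets borel \<and> distr \<pi> borel fst = \<mu> \<and> distr \<pi> borel snd = \<nu>}"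

definition d_infinity :: "'a::euclidean_space measure \<Rightarrow> 'a measure \<Rightarrow> ereal" where
  "d_infinity \<mu> \<nu> =
     (INF \<pi>\<in>transport_plans \<mu> \<nu>. SUP (x, y)\<in>msupport \<pi>. ereal (norm (x - y)))"


section \<open>Interaction energy and its local minimizers\<close>

text \<open>
  The potential is extended-real valued. Its double integral is the integral of the positive
  part minus that of the negative part (\<^const>\<open>e2ennreal\<close> truncates at 0). Whenever the potential
  is bounded below on compact sets, the subtrahend is finite for compactly supported
  probability measures.
\<close>

definition energy :: "('a::euclidean_space \<Rightarrow> ereal) \<Rightarrow> 'a measure \<Rightarrow> ereal" where
  "energy W \<rho> = ereal (1 / 2) *
     (enn2ereal (\<integral>\<^sup>+ x. (\<integral>\<^sup>+ y. e2ennreal (W (x - y)) \<partial>\<rho>) \<partial>\<rho>)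
      - enn2ereal (\<integral>\<^sup>+ x. (\<integral>\<^sup>+ y. e2ennreal (- W (x - y)) \<partial>\<rho>) \<partial>\<rho>))"

definition d_infinity_local_minimizer ::
    "('a::euclidean_space \<Rightarrow> ereal) \<Rightarrow> 'a measure \<Rightarrow> bool" where
  "d_infinity_local_minimizer W \<rho> \<longleftrightarrow>
     (\<exists>\<epsilon>>0. \<forall>\<nu>. compact_prob \<nu> \<longrightarrow> d_infinity \<rho> \<nu> < ereal \<epsilon> \<longrightarrow> energy W \<rho> \<le> energy W \<nu>)"


section \<open>Almost fractal measures\<close>

text \<open>
  \<open>ac_part_representative \<rho> f\<close>: the function \<open>f\<close> is a representative of the absolutely continuous
  part in the Lebesgue decomposition of \<open>\<rho>\<close>, with \<open>\<sigma>\<close> the singular part.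
\<close>

definition ac_part_representative :: "'a::euclidean_space measure \<Rightarrow> ('a \<Rightarrow> real) \<Rightarrow> bool" where
  "ac_part_representative \<rho> f \<longleftrightarrow>
     integrable lebesgue f \<and> (AE x in lebesgue. 0 \<le> f x) \<and>
     (\<exists>\<sigma>. sets \<sigma> = sets borel \<and> (\<exists>N\<in>null_sets lborel. emeasure \<sigma> (- N) = 0) \<and>
       (\<forall>A\<in>sets borel.
          emeasure \<rho> A = (\<integral>\<^sup>+ x\<in>A. ennreal (f x) \<partial>lebesgue) + emeasure \<sigma> A))"

text \<open>
  The superlevel condition is imposed on every representative: no ball is contained in
  \<open>{x. \<epsilon>\<^sub>0 \<le> f x}\<close>, even up to a null set.
\<close>

definition almost_fractal :: "'a::euclidean_space measure \<Rightarrow> bool" where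
  "almost_fractal \<rho> \<longleftrightarrow>
     (\<forall>x. \<not> x isolated_in msupport \<rho>) \<and>
     (\<forall>f. ac_part_representative \<rho> f \<longrightarrow> (\<forall>\<epsilon>\<^sub>0>0. interior {x. f x \<ge> \<epsilon>\<^sub>0} = {}))"


section \<open>The potential\<close>

text \<open>The constant \<open>c\<^bsub>d,\<alpha>\<^esub>\<close>, meaningful for \<open>\<alpha> \<noteq> d\<close> only.\<close>

definition riesz_const :: "nat \<Rightarrow> real \<Rightarrow> real" where
  "riesz_const d \<alpha> =
     Gamma ((real d - \<alpha>) / 2) / (pi powr (real d / 2) * 2 powr \<alpha> * Gamma (\<alpha> / 2))"

text \<open>\<open>c\<^bsub>d,\<alpha>\<^esub> (d - \<alpha>)\<close>, with its limiting value at \<open>\<alpha> = d\<close>.\<close>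

definition riesz_const_times_gap :: "nat \<Rightarrow> real \<Rightarrow> real" where
  "riesz_const_times_gap d \<alpha> =
     (if \<alpha> = real d then 2 / (pi powr (real d / 2) * 2 powr real d * Gamma (real d / 2))
      else riesz_const d \<alpha> * (real d - \<alpha>))"

text \<open>\<open>c\<^bsub>d,\<alpha>\<^esub> r\<^bsup>\<alpha>-d\<^esup>\<close>, read as a logarithmic kernel at \<open>\<alpha> = d\<close>.\<close>

definition riesz_kernel :: "nat \<Rightarrow> real \<Rightarrow> real \<Rightarrow> real" where
  "riesz_kernel d \<alpha> r =
     (if \<alpha> = real d then - (2 / (pi powr (real d / 2) * 2 powr \<alpha> * Gamma (\<alpha> / 2))) * ln r
      else riesz_const d \<alpha> * r powr (\<alpha> - real d))"

definition c_lower :: "nat \<Rightarrow> real \<Rightarrow> real" where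
  "c_lower d \<alpha> = \<alpha> powr (- \<alpha> / 2) * exp (\<alpha> / 2) * (2 * pi) powr (- real d / 2)"

definition c_upper :: "nat \<Rightarrow> real \<Rightarrow> real" where
  "c_upper d \<alpha> =
     (exp 1 / (real d + 2 - \<alpha>)) powr ((real d + 2 - \<alpha>) / 2) * riesz_const_times_gap d \<alpha>"

text \<open>
  The value at the origin is set explicitly for \<open>\<alpha> \<le> d\<close>. For \<open>\<alpha> > d\<close> the general formula applies
  there as well, because \<open>0 powr (\<alpha> - d) = 0\<close> and the series converges geometrically.
\<close>

definition W_pot :: "real \<Rightarrow> real \<Rightarrow> real \<Rightarrow> 'a::euclidean_space \<Rightarrow> ereal" where
  "W_pot \<alpha> c\<^sub>W lam x =
     (if \<alpha> \<le> real DIM('a) \<and> x = 0 then \<infinity>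
      else ereal (riesz_kernel DIM('a) \<alpha> (norm x) + (norm x)\<^sup>2 / 2
        - c\<^sub>W * (\<Sum>j. lam powr ((\<alpha> - real DIM('a)) * real (Suc j))
                   * exp (- ((norm x)\<^sup>2 / (2 * lam ^ (2 * Suc j)))))))"

end

theory Submission
  imports Defs "HOL-Real_Asymp.Real_Asymp"
begin

text \<open>
  Both halves of the statement come from perturbing the minimizer \<open>\<rho>\<close> inside a small ball.

  Superlevel sets. If \<open>\<rho>\<close> has density at least \<open>\<epsilon>\<^sub>0\<close> on a ball, then for every bounded
  \<open>\<mu>\<close> of mean zero supported in a small concentric ball both \<open>\<rho> + t \<mu>\<close> and \<open>\<rho> - t \<mu>\<close> are
  admissible competitors. Adding the two energy inequalities cancels the first variation, so the
  quadratic form \<open>\<integral>\<integral> W (x - y) \<mu> x \<mu> y\<close> is nonnegative (\<open>local_minimizer_pairing_nonneg\<close>).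
  The Fourier transform of \<open>W\<close> contradicts this. The Riesz kernel has transform \<open>|\<xi>|\<close> to the
  power \<open>- \<alpha>\<close>, every subtracted Gaussian has a positive transform, the quadratic part is
  nonpositive on functions of mean zero, and \<open>c_lower < c\<close> says exactly that at
  \<open>|\<xi>| = sqrt \<alpha> / lam ^ k\<close> the \<open>k\<close>-th Gaussian alone outweighs the Riesz kernel. These
  frequencies are arbitrarily high, so a wave packet built on them fits into an arbitrarily small
  ball. By the scaling of the Riesz kernel a single wave packet at unit scale serves all \<open>k\<close>
  (\<open>base_test_function\<close>, \<open>rescaled_pairing_negative\<close>). It is a product of a one-dimensional packet
  in one coordinate and long windows in the others. Writing the Riesz kernel as a superposition
  of heat kernels, which factor over the coordinates, reduces the required inequality to a
  one-dimensional one, where Fourier analysis on bounded functions of bounded support suffices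
  (\<open>one_dimensional_test_function\<close>).

  Isolated points. An isolated point of the support carries an atom. For \<open>\<alpha> \<le> d\<close> an atom has
  infinite energy, whereas mollifying \<open>\<rho>\<close> shows that a local minimizer has finite energy. For
  \<open>\<alpha> > d\<close> one splits the atom into two halves displaced by \<open>v\<close> and \<open>- v\<close>: this lowers the
  self-interaction by a multiple of \<open>|v|\<close> to the power \<open>\<alpha> - d < 2\<close> and raises the interaction
  with the rest, which stays at a positive distance, by at most \<open>O(|v|\<^sup>2)\<close>
  (\<open>local_minimizer_no_isolated_point\<close>). For this the cusp of the Riesz kernel at the origin has
  to survive the Gaussians. The condition \<open>c < c_upper\<close> says that the attractive force of one
  Gaussian is everywhere a fixed fraction below the repulsive Riesz force, and for small \<open>lam\<close> the scales are so
  far apart that at each distance only one Gaussian is felt (\<open>sum_bump_le\<close>). Hence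
  \<open>(1 - \<theta>)\<close> times the Riesz kernel minus all Gaussians is a decreasing function of the distance
  (\<open>profile_antimono\<close>). This monotonicity gives the cusp, the semiconcavity of \<open>W\<close> away from the origin
  and the local lower bounds that make all energies meaningful.
\<close>

section \<open>Supports, couplings and the energy as a double integral\<close>

text \<open>
  The complement of the support is the union of all open null sets; by Lindelof countably many
  of them suffice.
\<close>

lemma emeasure_compl_msupport:
  fixes \<rho> :: "'a::second_countable_topology measure"
  assumes "sets \<rho> = sets borel"
  shows "emeasure \<rho> (- msupport \<rho>) = 0"
proof -
  let ?F = "{U. open U \<and> emeasure \<rho> U = 0}"
  have eq: "- msupport \<rho> = \<Union> ?F"
    unfolding msupport_def by (auto simp: zero_less_iff_neq_zero)
  obtain F where F: "F \<subseteq> ?F" "countable F" "\<Union>F = \<Union>?F"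
    using Lindelof[of ?F] by blast
  have "(\<Union>U\<in>F. U) \<in> null_sets \<rho>"
  proof (rule null_sets_UN'[OF F(2)])
    fix U assume "U \<in> F"
    then show "U \<in> null_sets \<rho>" using F(1) assms by (auto intro!: null_setsI)
  qed
  then show ?thesis using eq F(3) by (auto simp: null_sets_def)
qed

lemma msupport_subset_closed:
  assumes "closed C" "emeasure \<rho> (- C) = 0"
  shows "msupport \<rho> \<subseteq> C"
  using assms unfolding msupport_def by (auto simp: open_Compl)

lemma closed_msupport: "closed (msupport \<rho>)"
proof -
  have "- msupport \<rho> = \<Union> {U. open U \<and> emeasure \<rho> U = 0}"
    unfolding msupport_def by (auto simp: zero_less_iff_neq_zero)
  then show ?thesis by (metis (no_types, lifting) closed_def mem_Collect_eq open_Union)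
qed

lemma compact_probI:
  fixes \<nu> :: "'a::euclidean_space measure"
  assumes "prob_space \<nu>" "sets \<nu> = sets borel" "AE x in \<nu>. norm x \<le> R"
  shows "compact_prob \<nu>"
proof -
  have "emeasure \<nu> (- cball 0 R) = 0"
  proof -
    have "{x. \<not> norm x \<le> R} = - cball 0 R" by (auto simp: dist_norm)
    then show ?thesis
      using assms(3) AE_iff_measurable[of "- cball 0 R" \<nu> "\<lambda>x. norm x \<le> R"] assms(2) sets_eq_imp_space_eq[OF assms(2)]
      by auto
  qed
  then have "msupport \<nu> \<subseteq> cball 0 R" by (intro msupport_subset_closed) auto
  then have "compact (msupport \<nu>)"
    by (meson bounded_cball bounded_subset closed_msupport compact_eq_bounded_closed)
  then show ?thesis using assms by (auto simp: compact_prob_def)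
qed

lemma compact_prob_AE_bounded:
  fixes \<rho> :: "'a::euclidean_space measure"
  assumes "compact_prob \<rho>"
  obtains R where "0 < R" "AE x in \<rho>. norm x \<le> R"
proof -
  have s: "sets \<rho> = sets borel" using assms by (auto simp: compact_prob_def)
  obtain R where R: "0 < R" "\<And>x. x \<in> msupport \<rho> \<Longrightarrow> norm x \<le> R"
    using assms unfolding compact_prob_def by (meson bounded_pos compact_imp_bounded)
  have "- msupport \<rho> \<in> null_sets \<rho>"
    using emeasure_compl_msupport[OF s] s closed_msupport[of \<rho>] by (intro null_setsI) auto
  then have "AE x in \<rho>. norm x \<le> R"
    by (rule AE_I') (use R(2) in auto)
  then show ?thesis using R(1) that by blast
qed

lemma d_infinity_le:
  fixes \<mu> \<nu> :: "'a::euclidean_space measure"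
  assumes "\<pi> \<in> transport_plans \<mu> \<nu>" "AE p in \<pi>. norm (fst p - snd p) \<le> \<delta>"
  shows "d_infinity \<mu> \<nu> \<le> ereal \<delta>"
proof -
  let ?C = "{p :: 'a \<times> 'a. norm (fst p - snd p) \<le> \<delta>}"
  have s: "sets \<pi> = sets borel" using assms(1) by (auto simp: transport_plans_def)
  have C: "closed ?C" by (intro closed_Collect_le continuous_intros)
  have "emeasure \<pi> (- ?C) = 0"
    using assms(2) AE_iff_measurable[of "- ?C" \<pi> "\<lambda>p. norm (fst p - snd p) \<le> \<delta>"] s sets_eq_imp_space_eq[OF s] C
    by (auto simp: open_Compl Collect_neg_eq)
  then have sub: "msupport \<pi> \<subseteq> ?C" using C by (intro msupport_subset_closed)
  have "(SUP (x, y)\<in>msupport \<pi>. ereal (norm (x - y))) \<le> ereal \<delta>"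
    using sub by (auto intro!: SUP_least)
  then show ?thesis unfolding d_infinity_def using assms(1) by (meson INF_lower order_trans)
qed

text \<open>
  All competitors below arise by moving each point \<open>x\<close> to \<open>T (x, s)\<close> with independent auxiliary
  randomness \<open>s\<close>: adding a small vector, resampling inside a ball, tossing a coin at an atom. The joint law
  of \<open>(x, T (x, s))\<close> is then a transport plan, so one displacement bound controls both the
  distance and the support of the new measure.
\<close>

lemma randomized_transport:
  fixes \<rho> :: "'a::euclidean_space measure"
  assumes \<rho>: "compact_prob \<rho>" and N: "prob_space N"
    and T[measurable]: "T \<in> borel_measurable (\<rho> \<Otimes>\<^sub>M N)"
    and close: "AE p in \<rho> \<Otimes>\<^sub>M N. norm (T p - fst p) \<le> \<delta>"
  shows "compact_prob (distr (\<rho> \<Otimes>\<^sub>M N) borel T)"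
    and "d_infinity \<rho> (distr (\<rho> \<Otimes>\<^sub>M N) borel T) \<le> ereal \<delta>"
proof -
  interpret \<rho>: prob_space \<rho> using \<rho> by (auto simp: compact_prob_def)
  interpret N: prob_space N by fact
  interpret P: pair_prob_space \<rho> N ..
  have s[measurable_cong]: "sets \<rho> = sets borel" using \<rho> by (auto simp: compact_prob_def)
  obtain R where R: "0 < R" "AE x in \<rho>. norm x \<le> R" using compact_prob_AE_bounded[OF \<rho>] .
  have fst: "distr (\<rho> \<Otimes>\<^sub>M N) \<rho> fst = \<rho>"
    using N.distr_pair_fst .
  have AEfst: "AE p in \<rho> \<Otimes>\<^sub>M N. norm (fst p) \<le> R"
    using R(2) by (subst (asm) fst[symmetric], subst (asm) AE_distr_iff) auto
  have AET: "AE p in \<rho> \<Otimes>\<^sub>M N. norm (T p) \<le> R + \<delta>"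
    using AEfst close
  proof eventually_elim
    case (elim p)
    have "norm (T p) \<le> norm (fst p) + norm (T p - fst p)" by norm
    then show ?case using elim by linarith
  qed
  show "compact_prob (distr (\<rho> \<Otimes>\<^sub>M N) borel T)"
  proof (rule compact_probI)
    show "prob_space (distr (\<rho> \<Otimes>\<^sub>M N) borel T)" by (intro P.prob_space_distr) measurable
    show "AE x in distr (\<rho> \<Otimes>\<^sub>M N) borel T. norm x \<le> R + \<delta>"
      using AET by (subst AE_distr_iff) auto
  qed simp
  let ?\<pi> = "distr (\<rho> \<Otimes>\<^sub>M N) borel (\<lambda>p. (fst p, T p))"
  have m[measurable]: "(\<lambda>p. (fst p, T p)) \<in> borel_measurable (\<rho> \<Otimes>\<^sub>M N)"
    by (simp add: borel_prod[symmetric])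
  have "?\<pi> \<in> transport_plans \<rho> (distr (\<rho> \<Otimes>\<^sub>M N) borel T)"
    unfolding transport_plans_def
  proof (intro CollectI conjI)
    show "prob_space ?\<pi>" by (intro P.prob_space_distr) measurable
    have "distr ?\<pi> borel fst = distr (\<rho> \<Otimes>\<^sub>M N) borel fst"
      by (subst distr_distr) (auto simp: comp_def intro!: borel_measurable_continuous_onI continuous_intros)
    also have "\<dots> = \<rho>" using fst s by (metis distr_cong)
    finally show "distr ?\<pi> borel fst = \<rho>" .

    show "distr ?\<pi> borel snd = distr (\<rho> \<Otimes>\<^sub>M N) borel T"
      by (subst distr_distr) (auto simp: comp_def intro!: borel_measurable_continuous_onI continuous_intros)
  qed simp
  moreover have "AE p in ?\<pi>. norm (fst p - snd p) \<le> \<delta>"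
    using close by (subst AE_distr_iff) (auto simp: norm_minus_commute intro!: borel_closed closed_Collect_le continuous_intros)
  ultimately show "d_infinity \<rho> (distr (\<rho> \<Otimes>\<^sub>M N) borel T) \<le> ereal \<delta>" by (rule d_infinity_le)
qed

lemma energy_as_pair_integrals:
  fixes \<nu> :: "'a::euclidean_space measure" and W :: "'a \<Rightarrow> ereal"
  assumes "prob_space \<nu>" and s[measurable_cong]: "sets \<nu> = sets borel" and W[measurable]: "W \<in> borel_measurable borel"
  shows "energy W \<nu> = ereal (1/2) *
     (enn2ereal (\<integral>\<^sup>+ p. e2ennreal (W (fst p - snd p)) \<partial>(\<nu> \<Otimes>\<^sub>M \<nu>))
      - enn2ereal (\<integral>\<^sup>+ p. e2ennreal (- W (fst p - snd p)) \<partial>(\<nu> \<Otimes>\<^sub>M \<nu>)))"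
proof -
  interpret prob_space \<nu> by fact
  show ?thesis unfolding energy_def
    by (subst (1 2) nn_integral_fst[symmetric]) (auto)
qed

lemma energy_eq_integral:
  fixes \<nu> :: "'a::euclidean_space measure" and W :: "'a \<Rightarrow> ereal"
  assumes \<nu>: "prob_space \<nu>" and s[measurable_cong]: "sets \<nu> = sets borel" and W[measurable]: "W \<in> borel_measurable borel"
    and int: "integrable (\<nu> \<Otimes>\<^sub>M \<nu>) (\<lambda>p. real_of_ereal (W (fst p - snd p)))"
    and fin: "AE p in \<nu> \<Otimes>\<^sub>M \<nu>. \<bar>W (fst p - snd p)\<bar> \<noteq> \<infinity>"
  shows "energy W \<nu> = ereal (1/2 * (\<integral>p. real_of_ereal (W (fst p - snd p)) \<partial>(\<nu> \<Otimes>\<^sub>M \<nu>)))"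
proof -
  let ?Z = "\<lambda>p. real_of_ereal (W (fst p - snd p))"
  have 1: "(\<integral>\<^sup>+ p. e2ennreal (W (fst p - snd p)) \<partial>(\<nu> \<Otimes>\<^sub>M \<nu>)) = (\<integral>\<^sup>+ p. ennreal (?Z p) \<partial>(\<nu> \<Otimes>\<^sub>M \<nu>))"
  proof (rule nn_integral_cong_AE)
    show "AE p in \<nu> \<Otimes>\<^sub>M \<nu>. e2ennreal (W (fst p - snd p)) = ennreal (?Z p)"
      using fin
    proof eventually_elim
      case (elim p) then show ?case by (cases "W (fst p - snd p)") auto
    qed
  qed
  have 2: "(\<integral>\<^sup>+ p. e2ennreal (- W (fst p - snd p)) \<partial>(\<nu> \<Otimes>\<^sub>M \<nu>)) = (\<integral>\<^sup>+ p. ennreal (- ?Z p) \<partial>(\<nu> \<Otimes>\<^sub>M \<nu>))"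
  proof (rule nn_integral_cong_AE)
    show "AE p in \<nu> \<Otimes>\<^sub>M \<nu>. e2ennreal (- W (fst p - snd p)) = ennreal (- ?Z p)"
      using fin
    proof eventually_elim
      case (elim p) then show ?case by (cases "W (fst p - snd p)") auto
    qed
  qed
  obtain a b where ab: "(\<integral>\<^sup>+ p. ennreal (?Z p) \<partial>(\<nu> \<Otimes>\<^sub>M \<nu>)) = ennreal a" "0 \<le> a"
     "(\<integral>\<^sup>+ p. ennreal (- ?Z p) \<partial>(\<nu> \<Otimes>\<^sub>M \<nu>)) = ennreal b" "0 \<le> b"
    using int that[of "enn2real (\<integral>\<^sup>+ p. ennreal (?Z p) \<partial>(\<nu> \<Otimes>\<^sub>M \<nu>))" "enn2real (\<integral>\<^sup>+ p. ennreal (- ?Z p) \<partial>(\<nu> \<Otimes>\<^sub>M \<nu>))"]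
    unfolding real_integrable_def by (simp add: ennreal_enn2real_if)
  show ?thesis
    unfolding energy_as_pair_integrals[OF \<nu> s W] 1 2
    by (subst real_lebesgue_integral_def[OF int]) (simp add: ab enn2ereal_ennreal)
qed

lemma energy_less_top:
  fixes \<nu> :: "'a::euclidean_space measure" and W :: "'a \<Rightarrow> ereal"
  assumes \<nu>: "prob_space \<nu>" and s[measurable_cong]: "sets \<nu> = sets borel" and W[measurable]: "W \<in> borel_measurable borel"
    and fin: "(\<integral>\<^sup>+ p. e2ennreal (W (fst p - snd p)) \<partial>(\<nu> \<Otimes>\<^sub>M \<nu>)) < \<infinity>"
  shows "energy W \<nu> < \<infinity>"
proof -
  obtain a where a: "(\<integral>\<^sup>+ p. e2ennreal (W (fst p - snd p)) \<partial>(\<nu> \<Otimes>\<^sub>M \<nu>)) = ennreal a" "0 \<le> a"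
    using fin that[of "enn2real (\<integral>\<^sup>+ p. e2ennreal (W (fst p - snd p)) \<partial>(\<nu> \<Otimes>\<^sub>M \<nu>))"]
    by (simp add: ennreal_enn2real_if less_top)
  define e where "e = enn2ereal (\<integral>\<^sup>+ p. e2ennreal (- W (fst p - snd p)) \<partial>(\<nu> \<Otimes>\<^sub>M \<nu>))"
  have "0 \<le> e" by (simp add: e_def)
  then show ?thesis
    unfolding energy_as_pair_integrals[OF \<nu> s W] a e_def[symmetric] using a(2)
    by (cases e) (auto simp: enn2ereal_ennreal)
qed

text \<open>
  Since the energy is a difference of extended reals with \<open>\<infinity> - \<infinity> = \<infinity>\<close>, finiteness from above already bounds
  the positive part; the lower bound on \<open>W\<close> takes care of the negative part.
\<close>

lemma energy_finite_imp_integrable: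
  fixes \<nu> :: "'a::euclidean_space measure" and W :: "'a \<Rightarrow> ereal"
  assumes \<nu>: "prob_space \<nu>" and s[measurable_cong]: "sets \<nu> = sets borel" and W[measurable]: "W \<in> borel_measurable borel"
    and fin: "energy W \<nu> < \<infinity>"
    and bd: "AE p in \<nu> \<Otimes>\<^sub>M \<nu>. ereal (- C) \<le> W (fst p - snd p)"
  shows "integrable (\<nu> \<Otimes>\<^sub>M \<nu>) (\<lambda>p. real_of_ereal (W (fst p - snd p)))"
    and "AE p in \<nu> \<Otimes>\<^sub>M \<nu>. \<bar>W (fst p - snd p)\<bar> \<noteq> \<infinity>"
proof -
  interpret prob_space \<nu> by fact
  interpret P: pair_prob_space \<nu> \<nu> ..
  let ?p = "\<integral>\<^sup>+ p. e2ennreal (W (fst p - snd p)) \<partial>(\<nu> \<Otimes>\<^sub>M \<nu>)"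
  have pos: "?p \<noteq> \<infinity>"
  proof
    assume "?p = \<infinity>"
    then have "energy W \<nu> = \<infinity>"
      unfolding energy_as_pair_integrals[OF \<nu> s W]
      by (cases "enn2ereal (\<integral>\<^sup>+ p. e2ennreal (- W (fst p - snd p)) \<partial>(\<nu> \<Otimes>\<^sub>M \<nu>))") auto
    then show False using fin by simp
  qed
  have "AE p in \<nu> \<Otimes>\<^sub>M \<nu>. e2ennreal (W (fst p - snd p)) \<noteq> \<infinity>"
    by (rule nn_integral_noteq_infinite[OF _ pos]) measurable
  then show 1: "AE p in \<nu> \<Otimes>\<^sub>M \<nu>. \<bar>W (fst p - snd p)\<bar> \<noteq> \<infinity>"
    using bd by eventually_elim auto
  let ?Z = "\<lambda>p. real_of_ereal (W (fst p - snd p))"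
  have "(\<integral>\<^sup>+ p. ennreal (?Z p) \<partial>(\<nu> \<Otimes>\<^sub>M \<nu>)) = ?p"
  proof (rule nn_integral_cong_AE)
    show "AE p in \<nu> \<Otimes>\<^sub>M \<nu>. ennreal (?Z p) = e2ennreal (W (fst p - snd p))"
      using 1
    proof eventually_elim
      case (elim p) then show ?case by (cases "W (fst p - snd p)") auto
    qed
  qed
  moreover have "(\<integral>\<^sup>+ p. ennreal (- ?Z p) \<partial>(\<nu> \<Otimes>\<^sub>M \<nu>)) \<le> (\<integral>\<^sup>+ p. ennreal C \<partial>(\<nu> \<Otimes>\<^sub>M \<nu>))"
  proof (rule nn_integral_mono_AE)
    show "AE p in \<nu> \<Otimes>\<^sub>M \<nu>. ennreal (- ?Z p) \<le> ennreal C"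
      using 1 bd
    proof eventually_elim
      case (elim p) then show ?case by (cases "W (fst p - snd p)") (auto intro!: ennreal_leI)
    qed
  qed
  moreover have "(\<integral>\<^sup>+ p. ennreal C \<partial>(\<nu> \<Otimes>\<^sub>M \<nu>)) < \<infinity>"
    by (simp add: P.P.emeasure_space_1 ennreal_mult_less_top)
  ultimately show "integrable (\<nu> \<Otimes>\<^sub>M \<nu>) ?Z"
    unfolding real_integrable_def using pos by auto
qed

section \<open>Mollification and perturbations of the density\<close>

lemma AE_fst_pair:
  assumes "sigma_finite_measure M" "prob_space N" "AE x in M. P x"
  shows "AE p in M \<Otimes>\<^sub>M N. P (fst p)"
proof -
  interpret N: prob_space N by fact
  interpret M: sigma_finite_measure M by fact
  obtain E where E: "E \<in> null_sets M" "{x \<in> space M. \<not> P x} \<subseteq> E"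
    using assms(3) by (auto elim!: AE_E)
  have "E \<times> space N \<in> null_sets (M \<Otimes>\<^sub>M N)" using E(1) by auto
  then show ?thesis by (rule AE_I') (use E(2) in \<open>auto simp: space_pair_measure\<close>)
qed

lemma AE_snd_pair:
  assumes "prob_space M" "sigma_finite_measure N" "AE x in N. P x"
  shows "AE p in M \<Otimes>\<^sub>M N. P (snd p)"
proof -
  interpret M: prob_space M by fact
  interpret N: sigma_finite_measure N by fact
  obtain E where E: "E \<in> null_sets N" "{x \<in> space N. \<not> P x} \<subseteq> E"
    using assms(3) by (auto elim!: AE_E)
  have "space M \<times> E \<in> null_sets (M \<Otimes>\<^sub>M N)" using E(1) by auto
  then show ?thesis by (rule AE_I') (use E(2) in \<open>auto simp: space_pair_measure\<close>)
qed

text \<open>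
  Convolving with the uniform distribution on a small ball replaces the inner integral of the
  positive part of \<open>W\<close> against the measure by an average of \<open>W\<close> over balls, which is bounded
  as soon as the positive part is locally integrable.
\<close>

lemma exists_nearby_finite_energy:
  fixes \<rho> :: "'a::euclidean_space measure" and W :: "'a \<Rightarrow> ereal"
  assumes \<rho>: "compact_prob \<rho>" and W[measurable]: "W \<in> borel_measurable borel" and "0 < \<delta>"
    and loc: "\<And>R. (\<integral>\<^sup>+ z \<in> ball 0 R. e2ennreal (W z) \<partial>lborel) < \<infinity>"
  obtains \<nu> where "compact_prob \<nu>" "d_infinity \<rho> \<nu> \<le> ereal \<delta>" "energy W \<nu> < \<infinity>"
proof -
  interpret \<rho>: prob_space \<rho> using \<rho> by (auto simp: compact_prob_def)
  have s[measurable_cong]: "sets \<rho> = sets borel" using \<rho> by (auto simp: compact_prob_def)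
  define b where "b = emeasure lborel (ball (0::'a) \<delta>)"
  have b: "0 < b" "b < \<infinity>"
    using \<open>0 < \<delta>\<close> emeasure_lborel_ball_finite[of 0 \<delta>] by (auto simp: b_def emeasure_ball)
  have [measurable]: "ball (0::'a) \<delta> \<in> sets borel" by simp
  define U where "U = uniform_measure lborel (ball (0::'a) \<delta>)"
  have sU[measurable_cong]: "sets U = sets borel" by (simp add: U_def)
  interpret U: prob_space U unfolding U_def using b by (intro prob_space_uniform_measure) (auto simp: b_def)
  interpret P: pair_prob_space \<rho> U ..
  let ?T = "\<lambda>p. fst p + snd p"
  define \<nu> where "\<nu> = distr (\<rho> \<Otimes>\<^sub>M U) borel ?T"
  have T[measurable]: "?T \<in> borel_measurable (\<rho> \<Otimes>\<^sub>M U)" by measurable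
  have "AE u in U. norm u \<le> \<delta>"
    unfolding U_def using b by (intro AE_uniform_measureI) (auto simp: b_def)
  then have close: "AE p in \<rho> \<Otimes>\<^sub>M U. norm (?T p - fst p) \<le> \<delta>"
    using AE_snd_pair[OF \<rho>.prob_space_axioms U.sigma_finite_measure_axioms, of "\<lambda>u. norm u \<le> \<delta>"] by simp
  have \<nu>: "compact_prob \<nu>" "d_infinity \<rho> \<nu> \<le> ereal \<delta>"
    unfolding \<nu>_def by (rule randomized_transport[OF \<rho> U.prob_space_axioms T close])+
  obtain R where R: "0 < R" "AE x in \<nu>. norm x \<le> R" using compact_prob_AE_bounded[OF \<nu>(1)] .
  obtain R' where R': "0 < R'" "AE x in \<rho>. norm x \<le> R'" using compact_prob_AE_bounded[OF \<rho>] .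
  have pn: "prob_space \<nu>" and sn[measurable_cong]: "sets \<nu> = sets borel" using \<nu>(1) by (auto simp: compact_prob_def)
  interpret \<nu>: prob_space \<nu> by fact
  let ?w = "\<lambda>z. e2ennreal (W z)"
  have [measurable]: "?w \<in> borel_measurable borel" by measurable
  define K where "K = (\<integral>\<^sup>+ z \<in> ball 0 (R + R' + \<delta>). ?w z \<partial>lborel) / b"
  have K: "K < \<infinity>" using loc[of "R + R' + \<delta>"] b by (auto simp: K_def less_top[symmetric] ennreal_divide_eq_top_iff)
  have inner: "(\<integral>\<^sup>+ u. ?w (z - u) \<partial>U) \<le> K" if z: "norm z \<le> R + R'" for z
  proof -
    have "(\<integral>\<^sup>+ u. ?w (z - u) \<partial>U) = (\<integral>\<^sup>+ u. ?w (z - u) * indicator (ball 0 \<delta>) u \<partial>lborel) / b"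
      unfolding U_def b_def by (subst nn_integral_uniform_measure) auto
    also have "(\<integral>\<^sup>+ u. ?w (z - u) * indicator (ball 0 \<delta>) u \<partial>lborel)
        = (\<integral>\<^sup>+ u. ?w u * indicator (ball 0 \<delta>) (z - u) \<partial>lborel)"
    proof -
      have eq: "(lborel :: 'a measure) = distr lborel borel (\<lambda>x. z - x)"
        using lborel_affine[of "-1" z] by (simp add: density_1)
      show ?thesis
        by (subst (2) eq, subst nn_integral_distr) auto
    qed
    also have "\<dots> \<le> (\<integral>\<^sup>+ z \<in> ball 0 (R + R' + \<delta>). ?w z \<partial>lborel)"
    proof (rule nn_integral_mono)
      fix u :: 'a
      have "norm u \<le> norm z + norm (z - u)" by norm
      then show "?w u * indicator (ball 0 \<delta>) (z - u) \<le> ?w u * indicator (ball 0 (R + R' + \<delta>)) u"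
        using z by (auto split: split_indicator)
    qed
    finally show ?thesis by (simp add: K_def divide_right_mono_ennreal)
  qed
  have "(\<integral>\<^sup>+ p. ?w (fst p - snd p) \<partial>(\<nu> \<Otimes>\<^sub>M \<nu>)) = (\<integral>\<^sup>+ x. (\<integral>\<^sup>+ y. ?w (x - y) \<partial>\<nu>) \<partial>\<nu>)"
    by (subst \<nu>.nn_integral_fst[symmetric]) auto
  also have "\<dots> \<le> (\<integral>\<^sup>+ x. K \<partial>\<nu>)"
  proof (rule nn_integral_mono_AE, use R(2) in eventually_elim)
    case (elim x)
    have "(\<integral>\<^sup>+ y. ?w (x - y) \<partial>\<nu>) = (\<integral>\<^sup>+ q. ?w (x - (fst q + snd q)) \<partial>(\<rho> \<Otimes>\<^sub>M U))"
      unfolding \<nu>_def by (subst nn_integral_distr) auto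
    also have "\<dots> = (\<integral>\<^sup>+ y. (\<integral>\<^sup>+ u. ?w (x - (y + u)) \<partial>U) \<partial>\<rho>)"
      by (subst U.nn_integral_fst[symmetric]) auto
    also have "\<dots> \<le> (\<integral>\<^sup>+ y. K \<partial>\<rho>)"
    proof (rule nn_integral_mono_AE, use R'(2) in eventually_elim)
      case (elim y)
      have "norm (x - y) \<le> norm x + norm y" by norm
      then show ?case using inner[of "x - y"] elim \<open>norm x \<le> R\<close> by (simp add: algebra_simps)
    qed
    also have "\<dots> = K" by (simp add: \<rho>.emeasure_space_1)
    finally show ?case .
  qed
  also have "\<dots> = K" by (simp add: \<nu>.emeasure_space_1)
  finally have "energy W \<nu> < \<infinity>" using K by (intro energy_less_top[OF pn sn W]) auto
  then show ?thesis using \<nu> that by blast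
qed

lemma local_minimizer_energy_finite:
  fixes \<rho> :: "'a::euclidean_space measure" and W :: "'a \<Rightarrow> ereal"
  assumes \<rho>: "compact_prob \<rho>" and W[measurable]: "W \<in> borel_measurable borel"
    and loc: "\<And>R. (\<integral>\<^sup>+ z \<in> ball 0 R. e2ennreal (W z) \<partial>lborel) < \<infinity>"
    and "d_infinity_local_minimizer W \<rho>"
  shows "energy W \<rho> < \<infinity>"
proof -
  obtain \<epsilon> where \<epsilon>: "\<epsilon> > 0" "\<And>\<nu>. compact_prob \<nu> \<Longrightarrow> d_infinity \<rho> \<nu> < ereal \<epsilon> \<Longrightarrow> energy W \<rho> \<le> energy W \<nu>"
    using assms(4) by (auto simp: d_infinity_local_minimizer_def)
  obtain \<nu> where "compact_prob \<nu>" "d_infinity \<rho> \<nu> \<le> ereal (\<epsilon>/2)" "energy W \<nu> < \<infinity>"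
    using exists_nearby_finite_energy[OF \<rho> W _ loc, of "\<epsilon>/2"] \<epsilon>(1) by auto
  moreover have "ereal (\<epsilon>/2) < ereal \<epsilon>" using \<epsilon>(1) by simp
  ultimately show ?thesis using \<epsilon>(2)[of \<nu>] by (meson le_less_trans)
qed

text \<open>
  The coupling resamples: a point outside \<open>B\<close> stays, a point inside \<open>B\<close> is replaced by an
  independent draw from the normalized new measure on \<open>B\<close>. As \<open>g\<close> has integral zero, \<open>B\<close> has the
  same mass before and after, so this has the right second marginal, and no point moves
  further than the diameter of \<open>B\<close>.
\<close>

lemma density_perturbation:
  fixes \<rho> :: "'a::euclidean_space measure"
  assumes \<rho>: "compact_prob \<rho>" and [measurable]: "g \<in> borel_measurable borel" "B \<in> sets borel"
    and g1: "AE x in \<rho>. \<bar>g x\<bar> \<le> 1" and gB: "\<And>x. x \<notin> B \<Longrightarrow> g x = 0" and g0: "(\<integral>x. g x \<partial>\<rho>) = 0"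
    and B: "0 < emeasure \<rho> B" and diam: "\<And>x y. x \<in> B \<Longrightarrow> y \<in> B \<Longrightarrow> norm (x - y) \<le> \<delta>" and \<delta>: "0 \<le> \<delta>"
  shows "compact_prob (density \<rho> (\<lambda>x. ennreal (1 + g x)))"
    and "d_infinity \<rho> (density \<rho> (\<lambda>x. ennreal (1 + g x))) \<le> ereal \<delta>"
proof -
  interpret \<rho>: prob_space \<rho> using \<rho> by (auto simp: compact_prob_def)
  have s[measurable_cong]: "sets \<rho> = sets borel" using \<rho> by (auto simp: compact_prob_def)
  define \<nu> where "\<nu> = density \<rho> (\<lambda>x. ennreal (1 + g x))"
  have sn[measurable_cong]: "sets \<nu> = sets borel" by (simp add: \<nu>_def s)
  have gi: "integrable \<rho> g" by (rule \<rho>.integrable_const_bound[of _ 1]) (use g1 in auto)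
  have pos: "AE x in \<rho>. 0 \<le> 1 + g x" using g1 by eventually_elim auto
  have em: "emeasure \<nu> A = ennreal (\<integral>x. (1 + g x) * indicator A x \<partial>\<rho>)" if [measurable]: "A \<in> sets borel" for A
  proof -
    have ii: "integrable \<rho> (\<lambda>x. (1 + g x) * indicator A x)"
      by (rule integrable_mult_indicator[of A \<rho> "\<lambda>x. 1 + g x", simplified mult.commute[of "indicator A _"] real_scaleR_def])
         (use gi in auto)
    have "emeasure \<nu> A = (\<integral>\<^sup>+ x. ennreal (1 + g x) * indicator A x \<partial>\<rho>)"
      unfolding \<nu>_def by (subst emeasure_density) auto
    also have "\<dots> = (\<integral>\<^sup>+ x. ennreal ((1 + g x) * indicator A x) \<partial>\<rho>)"
      by (intro nn_integral_cong) (auto split: split_indicator)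
    also have "\<dots> = ennreal (\<integral>x. (1 + g x) * indicator A x \<partial>\<rho>)"
      by (rule nn_integral_eq_integral[OF ii]) (use pos in eventually_elim, auto)
    finally show ?thesis .
  qed
  have BB: "emeasure \<nu> B = emeasure \<rho> B"
  proof -
    have "(\<integral>x. (1 + g x) * indicator B x \<partial>\<rho>) = (\<integral>x. indicator B x + g x \<partial>\<rho>)"
      by (rule Bochner_Integration.integral_cong) (auto split: split_indicator simp: gB)
    also have "\<dots> = measure \<rho> B" using gi g0 by (subst Bochner_Integration.integral_add) (auto simp: \<rho>.emeasure_eq_measure)
    finally show ?thesis by (simp add: em \<rho>.emeasure_eq_measure)
  qed
  have out: "emeasure \<nu> A = emeasure \<rho> A" if [measurable]: "A \<in> sets borel" and "A \<inter> B = {}" for A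
  proof -
    have "(\<integral>x. (1 + g x) * indicator A x \<partial>\<rho>) = (\<integral>x. indicator A x \<partial>\<rho>)"
      by (rule Bochner_Integration.integral_cong) (use that in \<open>auto split: split_indicator intro!: gB\<close>)
    then show ?thesis by (simp add: em \<rho>.emeasure_eq_measure)
  qed
  have Bfin: "emeasure \<nu> B \<noteq> \<infinity>" using BB by simp
  define N where "N = uniform_measure \<nu> B"
  have sN[measurable_cong]: "sets N = sets borel" by (simp add: N_def sn)
  interpret N: prob_space N unfolding N_def using B Bfin BB by (intro prob_space_uniform_measure) auto
  have N1: "emeasure N UNIV = 1"
    using N.emeasure_space_1 sets_eq_imp_space_eq[OF sN] by simp
  interpret P: pair_prob_space \<rho> N ..
  let ?T = "\<lambda>p. if fst p \<in> B then snd p else fst p"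
  have T[measurable]: "?T \<in> borel_measurable (\<rho> \<Otimes>\<^sub>M N)" by measurable
  have "AE y in N. y \<in> B"
    unfolding N_def using B Bfin BB by (intro AE_uniform_measureI) auto
  then have "AE p in \<rho> \<Otimes>\<^sub>M N. snd p \<in> B"
    by (rule AE_snd_pair[OF \<rho>.prob_space_axioms N.sigma_finite_measure_axioms])
  then have close: "AE p in \<rho> \<Otimes>\<^sub>M N. norm (?T p - fst p) \<le> \<delta>"
    by eventually_elim (use diam \<delta> in auto)
  have "distr (\<rho> \<Otimes>\<^sub>M N) borel ?T = \<nu>"
  proof (rule measure_eqI)
    fix A assume "A \<in> sets (distr (\<rho> \<Otimes>\<^sub>M N) borel ?T)"
    then have A[measurable]: "A \<in> sets borel" by simp
    have "emeasure (distr (\<rho> \<Otimes>\<^sub>M N) borel ?T) A = (\<integral>\<^sup>+ p. indicator A (?T p) \<partial>(\<rho> \<Otimes>\<^sub>M N))"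
      by (subst nn_integral_indicator[symmetric], simp, subst nn_integral_distr) auto
    also have "\<dots> = (\<integral>\<^sup>+ x. (\<integral>\<^sup>+ y. indicator A (if x \<in> B then y else x) \<partial>N) \<partial>\<rho>)"
      by (subst N.nn_integral_fst[symmetric]) (auto cong: if_cong)
    also have "\<dots> = (\<integral>\<^sup>+ x. emeasure N A * indicator B x + indicator (A - B) x \<partial>\<rho>)"
      by (intro nn_integral_cong) (auto split: split_indicator simp: N1 N.emeasure_space_1)
    also have "\<dots> = emeasure N A * emeasure \<rho> B + emeasure \<rho> (A - B)"
      by (subst nn_integral_add) (auto simp: nn_integral_cmult)
    also have "emeasure N A * emeasure \<rho> B = emeasure \<nu> (B \<inter> A)"
      unfolding N_def BB[symmetric]
    proof (subst emeasure_uniform_measure)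
      show "emeasure \<nu> (B \<inter> A) / emeasure \<nu> B * emeasure \<nu> B = emeasure \<nu> (B \<inter> A)"
      proof -
        have "emeasure \<rho> B / emeasure \<rho> B = 1" by (rule ennreal_divide_self) (use B in \<open>auto simp: less_top[symmetric]\<close>)
        then show ?thesis using BB by (simp add: ennreal_divide_times)
      qed
    qed auto
    also have "emeasure \<rho> (A - B) = emeasure \<nu> (A - B)" by (rule out[symmetric]) auto
    also have "emeasure \<nu> (B \<inter> A) + emeasure \<nu> (A - B) = emeasure \<nu> A"
      by (subst plus_emeasure) (auto intro!: arg_cong2[where f=emeasure])
    finally show "emeasure (distr (\<rho> \<Otimes>\<^sub>M N) borel ?T) A = emeasure \<nu> A" .
  qed (simp add: sn)
  with randomized_transport[OF \<rho> N.prob_space_axioms T close]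
  show "compact_prob (density \<rho> (\<lambda>x. ennreal (1 + g x)))"
    and "d_infinity \<rho> (density \<rho> (\<lambda>x. ennreal (1 + g x))) \<le> ereal \<delta>"
    by (simp_all add: \<nu>_def)
qed

lemma density_perturbation_energy:
  fixes \<rho> :: "'a::euclidean_space measure" and W :: "'a \<Rightarrow> ereal"
  defines "Z \<equiv> \<lambda>p. real_of_ereal (W (fst p - snd p))"
  assumes p: "prob_space \<rho>" and s[measurable_cong]: "sets \<rho> = sets borel" and W[measurable]: "W \<in> borel_measurable borel"
    and int: "integrable (\<rho> \<Otimes>\<^sub>M \<rho>) Z"
    and fin: "AE p in \<rho> \<Otimes>\<^sub>M \<rho>. \<bar>W (fst p - snd p)\<bar> \<noteq> \<infinity>"
    and g[measurable]: "g \<in> borel_measurable borel" and g1: "AE x in \<rho>. \<bar>g x\<bar> \<le> 1"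
    and \<nu>: "prob_space (density \<rho> (\<lambda>x. ennreal (1 + g x)))"
  shows "energy W (density \<rho> (\<lambda>x. ennreal (1 + g x)))
      = ereal (1/2 * (\<integral>p. Z p * ((1 + g (fst p)) * (1 + g (snd p))) \<partial>(\<rho> \<Otimes>\<^sub>M \<rho>)))"
    and "integrable (\<rho> \<Otimes>\<^sub>M \<rho>) (\<lambda>p. Z p * ((1 + g (fst p)) * (1 + g (snd p))))"
proof -
  interpret \<rho>: prob_space \<rho> by fact
  interpret P: pair_prob_space \<rho> \<rho> ..
  let ?\<nu> = "density \<rho> (\<lambda>x. ennreal (1 + g x))"
  let ?k = "\<lambda>p. (1 + g (fst p)) * (1 + g (snd p))"
  interpret \<nu>: prob_space ?\<nu> by fact
  have [measurable]: "Z \<in> borel_measurable (\<rho> \<Otimes>\<^sub>M \<rho>)" unfolding Z_def by measurable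
  have g2: "AE p in \<rho> \<Otimes>\<^sub>M \<rho>. \<bar>g (fst p)\<bar> \<le> 1" "AE p in \<rho> \<Otimes>\<^sub>M \<rho>. \<bar>g (snd p)\<bar> \<le> 1"
    using AE_fst_pair[OF \<rho>.sigma_finite_measure_axioms p g1] AE_snd_pair[OF p \<rho>.sigma_finite_measure_axioms g1] by auto
  have k0: "AE p in \<rho> \<Otimes>\<^sub>M \<rho>. 0 \<le> ?k p"
    using g2 by eventually_elim auto
  have k4: "AE p in \<rho> \<Otimes>\<^sub>M \<rho>. \<bar>?k p\<bar> \<le> 4"
  proof (use g2 in eventually_elim)
    case (elim p)
    have "\<bar>1 + g (fst p)\<bar> * \<bar>1 + g (snd p)\<bar> \<le> 2 * 2" by (rule mult_mono) (use elim in auto)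
    then show ?case by (simp add: abs_mult)
  qed
  have dens: "?\<nu> \<Otimes>\<^sub>M ?\<nu> = density (\<rho> \<Otimes>\<^sub>M \<rho>) (\<lambda>p. ennreal (?k p))"
  proof -
    have "?\<nu> \<Otimes>\<^sub>M ?\<nu> = density (\<rho> \<Otimes>\<^sub>M \<rho>) (\<lambda>(x,y). ennreal (1 + g x) * ennreal (1 + g y))"
      by (rule pair_measure_density) (auto intro: \<rho>.sigma_finite_measure_axioms \<nu>.sigma_finite_measure_axioms)
    also have "\<dots> = density (\<rho> \<Otimes>\<^sub>M \<rho>) (\<lambda>p. ennreal (?k p))"
      by (rule density_cong) (use g2 in \<open>auto simp: ennreal_mult' split_beta\<close>)
    finally show ?thesis .
  qed
  show i: "integrable (\<rho> \<Otimes>\<^sub>M \<rho>) (\<lambda>p. Z p * ?k p)"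
  proof (rule Bochner_Integration.integrable_bound[of _ "\<lambda>p. 4 * Z p"])
    show "AE p in \<rho> \<Otimes>\<^sub>M \<rho>. norm (Z p * ?k p) \<le> norm (4 * Z p)"
    proof (use k4 in eventually_elim)
      case (elim p)
      then have "\<bar>Z p\<bar> * \<bar>?k p\<bar> \<le> \<bar>Z p\<bar> * 4" by (intro mult_left_mono) auto
      then show ?case by (simp add: abs_mult)
    qed
  qed (use int in auto)
  have "integrable (?\<nu> \<Otimes>\<^sub>M ?\<nu>) Z"
    unfolding dens by (subst integrable_density) (use i k0 in \<open>auto simp: mult.commute\<close>)
  moreover have "AE p in ?\<nu> \<Otimes>\<^sub>M ?\<nu>. \<bar>W (fst p - snd p)\<bar> \<noteq> \<infinity>"
    unfolding dens by (subst AE_density) (use fin in auto)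
  ultimately have "energy W ?\<nu> = ereal (1/2 * (\<integral>p. Z p \<partial>(?\<nu> \<Otimes>\<^sub>M ?\<nu>)))"
    unfolding Z_def by (intro energy_eq_integral) (auto simp: s intro: \<nu>.prob_space_axioms)
  also have "(\<integral>p. Z p \<partial>(?\<nu> \<Otimes>\<^sub>M ?\<nu>)) = (\<integral>p. Z p * ?k p \<partial>(\<rho> \<Otimes>\<^sub>M \<rho>))"
    unfolding dens by (subst integral_density) (use k0 in \<open>auto simp: mult.commute\<close>)
  finally show "energy W ?\<nu> = ereal (1/2 * (\<integral>p. Z p * ?k p \<partial>(\<rho> \<Otimes>\<^sub>M \<rho>)))" .
qed

text \<open>
  On the set where \<open>h > 1\<close> the integral of \<open>h - 1\<close> would have to be at most zero.
\<close>

lemma dominated_density: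
  fixes \<rho> :: "'a measure"
  assumes "finite_measure \<rho>" and f[measurable]: "h \<in> borel_measurable \<rho>" 
    and le: "\<And>A. A \<in> sets \<rho> \<Longrightarrow> emeasure (density \<rho> h) A \<le> emeasure \<rho> A"
  shows "AE x in \<rho>. h x \<le> 1"
proof -
  interpret finite_measure \<rho> by fact
  let ?A = "{x \<in> space \<rho>. 1 < h x}"
  have A[measurable]: "?A \<in> sets \<rho>" by measurable
  have fin: "(\<integral>\<^sup>+ x. indicator ?A x \<partial>\<rho>) \<noteq> \<infinity>" using emeasure_finite by simp
  have le': "(\<integral>\<^sup>+ x. h x * indicator ?A x \<partial>\<rho>) \<le> (\<integral>\<^sup>+ x. indicator ?A x \<partial>\<rho>)"
    using le[OF A] by (simp add: emeasure_density)
  have "(\<integral>\<^sup>+ x. h x * indicator ?A x - indicator ?A x \<partial>\<rho>) =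
     (\<integral>\<^sup>+ x. h x * indicator ?A x \<partial>\<rho>) - (\<integral>\<^sup>+ x. indicator ?A x \<partial>\<rho>)"
    by (rule nn_integral_diff) (use fin in \<open>auto split: split_indicator intro!: AE_I2\<close>)
  also have "\<dots> = 0"
    using le' fin by (subst diff_eq_0_iff_ennreal) (metis infinity_ennreal_def le_less_trans less_top)+
  finally have "AE x in \<rho>. h x * indicator ?A x - indicator ?A x = 0"
    by (subst (asm) nn_integral_0_iff_AE) auto
  then show ?thesis
    by (rule AE_mp, intro AE_I2) (auto split: split_indicator_asm simp: diff_eq_0_iff_ennreal not_less)
qed

text \<open>
  A signed density \<open>\<mu>\<close> on the ball has the form \<open>g\<close> times \<open>\<rho>\<close> with \<open>g\<close> bounded, by
  Radon-Nikodym for the part of Lebesgue measure dominated by \<open>\<rho>\<close>. So \<open>\<rho> + t \<mu>\<close> and \<open>\<rho> - t \<mu>\<close> are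
  both reweightings of \<open>\<rho>\<close>, and the sum of their energies minus twice the energy of \<open>\<rho>\<close> is \<open>t\<^sup>2\<close>
  times the quadratic form of \<open>\<mu>\<close>. The radius \<open>r0\<close> depends only on how local the minimizer is, not
  on \<open>\<mu>\<close>.
\<close>

lemma local_minimizer_pairing_nonneg:
  fixes \<rho> :: "'a::euclidean_space measure" and W :: "'a \<Rightarrow> ereal"
  defines "Z \<equiv> \<lambda>z. real_of_ereal (W z)"
  assumes \<rho>: "compact_prob \<rho>" and W[measurable]: "W \<in> borel_measurable borel"
    and int: "integrable (\<rho> \<Otimes>\<^sub>M \<rho>) (\<lambda>p. Z (fst p - snd p))"
    and fin: "AE p in \<rho> \<Otimes>\<^sub>M \<rho>. \<bar>W (fst p - snd p)\<bar> \<noteq> \<infinity>"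
    and min: "d_infinity_local_minimizer W \<rho>"
    and "0 < r" "0 < \<epsilon>0" and lower: "\<And>A. A \<in> sets borel \<Longrightarrow> A \<subseteq> ball x0 r \<Longrightarrow> ennreal \<epsilon>0 * emeasure lborel A \<le> emeasure \<rho> A"
  obtains r0 where "0 < r0"
    "\<And>\<mu>. \<mu> \<in> borel_measurable borel \<Longrightarrow> (\<And>x. \<bar>\<mu> x\<bar> \<le> C \<and> (x \<notin> ball x0 r0 \<longrightarrow> \<mu> x = 0)) \<Longrightarrow> (\<integral>x. \<mu> x \<partial>lborel) = 0
      \<Longrightarrow> 0 \<le> (\<integral>p. Z (fst p - snd p) * (\<mu> (fst p) * \<mu> (snd p)) \<partial>(lborel \<Otimes>\<^sub>M lborel))"
proof -
  interpret \<rho>: prob_space \<rho> using \<rho> by (auto simp: compact_prob_def)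
  interpret P: pair_prob_space \<rho> \<rho> ..
  have s[measurable_cong]: "sets \<rho> = sets borel" using \<rho> by (auto simp: compact_prob_def)
  have [measurable]: "Z \<in> borel_measurable borel" unfolding Z_def by measurable
  obtain \<epsilon> where \<epsilon>: "\<epsilon> > 0" "\<And>\<nu>. compact_prob \<nu> \<Longrightarrow> d_infinity \<rho> \<nu> < ereal \<epsilon> \<Longrightarrow> energy W \<rho> \<le> energy W \<nu>"
    using min by (auto simp: d_infinity_local_minimizer_def)
  define r0 where "r0 = min r (\<epsilon>/4)"
  have r0: "0 < r0" "r0 \<le> r" "2 * r0 < \<epsilon>" using \<open>0 < r\<close> \<epsilon>(1) by (auto simp: r0_def)
  let ?B = "ball x0 r0"
  have [measurable]: "?B \<in> sets borel" by simp
  have Bpos: "0 < emeasure \<rho> ?B"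
  proof -
    have "0 < ennreal \<epsilon>0 * emeasure lborel ?B"
      using r0 \<open>0 < \<epsilon>0\<close> by (auto simp: emeasure_ball ennreal_zero_less_mult_iff)
    also have "\<dots> \<le> emeasure \<rho> ?B" using r0(2) by (intro lower) auto
    finally show ?thesis .
  qed
  have diam: "norm (x - y) \<le> 2 * r0" if "x \<in> ?B" "y \<in> ?B" for x y
    using that dist_triangle[of x y x0] by (auto simp: dist_norm dist_commute norm_minus_commute)
  define N where "N = density lborel (\<lambda>x. ennreal (\<epsilon>0 * indicator ?B x))"
  have sN[measurable_cong]: "sets N = sets borel" by (simp add: N_def)
  have N_le: "emeasure N A \<le> emeasure \<rho> A" if [measurable]: "A \<in> sets borel" for A
  proof -
    have "emeasure N A = (\<integral>\<^sup>+x. ennreal \<epsilon>0 * indicator (A \<inter> ?B) x \<partial>lborel)"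
      unfolding N_def by (subst emeasure_density, measurable) (auto intro!: nn_integral_cong split: split_indicator)
    also have "\<dots> = ennreal \<epsilon>0 * emeasure lborel (A \<inter> ?B)" by (subst nn_integral_cmult) auto
    also have "\<dots> \<le> emeasure \<rho> (A \<inter> ?B)" using r0(2) by (intro lower) auto
    also have "\<dots> \<le> emeasure \<rho> A" by (intro emeasure_mono) auto
    finally show ?thesis .
  qed
  have "absolutely_continuous \<rho> N"
    unfolding absolutely_continuous_def using N_le s sN
    by (auto intro!: null_setsI simp: null_sets_def) (metis le_zero_eq)
  then obtain h where h[measurable]: "h \<in> borel_measurable \<rho>" and hN: "density \<rho> h = N"
    using \<rho>.Radon_Nikodym[of N] s sN by auto
  have h1: "AE x in \<rho>. h x \<le> 1"
    by (rule dominated_density) (use N_le s hN in \<open>auto intro: \<rho>.finite_measure_axioms\<close>)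
  define k where "k x = enn2real (h x)" for x
  have k[measurable]: "k \<in> borel_measurable borel" using h unfolding k_def by measurable
  have k1: "AE x in \<rho>. h x = ennreal (k x)" "AE x in \<rho>. k x \<le> 1"
    using h1 by (eventually_elim, auto simp: k_def ennreal_enn2real_if top_unique enn2real_leI)+
  have kN: "density \<rho> (\<lambda>x. ennreal (k x)) = N"
    unfolding hN[symmetric] by (rule density_cong) (use k1 in auto)
  have k0: "0 \<le> k x" for x by (simp add: k_def)
  show ?thesis
  proof (rule that[OF r0(1)])
    fix \<mu> :: "'a \<Rightarrow> real"
    assume [measurable]: "\<mu> \<in> borel_measurable borel" and \<mu>: "\<And>x. \<bar>\<mu> x\<bar> \<le> C \<and> (x \<notin> ?B \<longrightarrow> \<mu> x = 0)"
      and \<mu>0: "(\<integral>x. \<mu> x \<partial>lborel) = 0"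
    have C: "0 \<le> C" using \<mu>[of x0] by (meson abs_ge_zero order_trans)
    \<comment> \<open>keeps the relative density \<open>t * k x * \<mu> x\<close> within \<open>[-1, 1]\<close>\<close>
  define t where "t = 1 / (C + 1)"
    have t: "0 < t" "t * C \<le> 1" using C by (auto simp: t_def field_simps)
    define g where "g x = t * k x * \<mu> x" for x
    have g[measurable]: "g \<in> borel_measurable borel" unfolding g_def by measurable
    have g1: "AE x in \<rho>. \<bar>g x\<bar> \<le> 1"
      using k1(2)
    proof eventually_elim
      case (elim x)
      have "\<bar>g x\<bar> = t * (k x * \<bar>\<mu> x\<bar>)" using t k0[of x] by (simp add: g_def abs_mult)
      also have "\<dots> \<le> t * (1 * C)" using t k0[of x] elim \<mu>[of x] C by (intro mult_left_mono mult_mono) auto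
      finally show ?case using t by simp
    qed
    have gB: "g x = 0" if "x \<notin> ?B" for x using \<mu>[of x] that by (simp add: g_def)
    have g0: "(\<integral>x. g x \<partial>\<rho>) = 0"
    proof -
      have "(\<integral>x. g x \<partial>\<rho>) = (\<integral>x. k x *\<^sub>R (t * \<mu> x) \<partial>\<rho>)" by (simp add: g_def mult_ac)
      also have "\<dots> = (\<integral>x. t * \<mu> x \<partial>N)" unfolding kN[symmetric] by (subst integral_density) (auto simp: k0)
      also have "\<dots> = (\<integral>x. (\<epsilon>0 * indicator ?B x) *\<^sub>R (t * \<mu> x) \<partial>lborel)"
        unfolding N_def by (subst integral_density) (use \<open>0 < \<epsilon>0\<close> in \<open>auto split: split_indicator\<close>)
      also have "\<dots> = (\<integral>x. (\<epsilon>0 * t) * \<mu> x \<partial>lborel)"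
        by (rule Bochner_Integration.integral_cong) (use \<mu> in \<open>auto split: split_indicator\<close>)
      finally show ?thesis using \<mu>0 by simp
    qed
    let ?Z = "\<lambda>p. Z (fst p - snd p)"
    let ?nu = "\<lambda>g. density \<rho> (\<lambda>x. ennreal (1 + g x))"
    have E: "(\<integral>p. ?Z p \<partial>(\<rho> \<Otimes>\<^sub>M \<rho>)) \<le> (\<integral>p. ?Z p * ((1 + g (fst p)) * (1 + g (snd p))) \<partial>(\<rho> \<Otimes>\<^sub>M \<rho>)) \<and>
        integrable (\<rho> \<Otimes>\<^sub>M \<rho>) (\<lambda>p. ?Z p * ((1 + g (fst p)) * (1 + g (snd p))))"
      if [measurable]: "g \<in> borel_measurable borel" and g1: "AE x in \<rho>. \<bar>g x\<bar> \<le> 1"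
      and gB: "\<And>x. x \<notin> ?B \<Longrightarrow> g x = 0" and g0: "(\<integral>x. g x \<partial>\<rho>) = 0" for g
    proof -
      have d: "compact_prob (?nu g)" "d_infinity \<rho> (?nu g) \<le> ereal (2 * r0)"
        using density_perturbation[OF \<rho> _ _ g1 gB g0 Bpos diam] r0(1) by auto
      then have p: "prob_space (?nu g)" by (simp add: compact_prob_def)
      have "d_infinity \<rho> (?nu g) < ereal \<epsilon>" using d(2) r0(3) by (meson ereal_less(1) le_less_trans less_ereal.simps(1))
      then have "energy W \<rho> \<le> energy W (?nu g)" using \<epsilon>(2) d(1) by blast
      moreover have "energy W \<rho> = ereal (1/2 * (\<integral>p. ?Z p \<partial>(\<rho> \<Otimes>\<^sub>M \<rho>)))"
        unfolding Z_def by (rule energy_eq_integral) (use int fin s in \<open>auto simp: Z_def intro: \<rho>.prob_space_axioms\<close>)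
      ultimately show ?thesis
        using density_perturbation_energy[OF \<rho>.prob_space_axioms s W int[unfolded Z_def] fin that(1) g1 p]
        by (simp add: Z_def)
    qed
    have E1: "(\<integral>p. ?Z p \<partial>(\<rho> \<Otimes>\<^sub>M \<rho>)) \<le> (\<integral>p. ?Z p * ((1 + g (fst p)) * (1 + g (snd p))) \<partial>(\<rho> \<Otimes>\<^sub>M \<rho>))"
         and I1: "integrable (\<rho> \<Otimes>\<^sub>M \<rho>) (\<lambda>p. ?Z p * ((1 + g (fst p)) * (1 + g (snd p))))"
      using E[OF g g1 gB g0] by auto
    have E2: "(\<integral>p. ?Z p \<partial>(\<rho> \<Otimes>\<^sub>M \<rho>)) \<le> (\<integral>p. ?Z p * ((1 + - g (fst p)) * (1 + - g (snd p))) \<partial>(\<rho> \<Otimes>\<^sub>M \<rho>))"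
         and I2: "integrable (\<rho> \<Otimes>\<^sub>M \<rho>) (\<lambda>p. ?Z p * ((1 + - g (fst p)) * (1 + - g (snd p))))"
      using E[of "\<lambda>x. - g x"] g1 gB g0 by auto
    have "0 \<le> (\<integral>p. ?Z p * ((1 + g (fst p)) * (1 + g (snd p))) \<partial>(\<rho> \<Otimes>\<^sub>M \<rho>))
       + (\<integral>p. ?Z p * ((1 + - g (fst p)) * (1 + - g (snd p))) \<partial>(\<rho> \<Otimes>\<^sub>M \<rho>)) - 2 * (\<integral>p. ?Z p \<partial>(\<rho> \<Otimes>\<^sub>M \<rho>))"
      using E1 E2 by linarith
    also have "\<dots> = (\<integral>p. ?Z p * ((1 + g (fst p)) * (1 + g (snd p)))
       + ?Z p * ((1 + - g (fst p)) * (1 + - g (snd p))) - 2 * ?Z p \<partial>(\<rho> \<Otimes>\<^sub>M \<rho>))"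
      using I1 I2 int by simp
    also have "\<dots> = (\<integral>p. 2 * t\<^sup>2 * ((k (fst p) * k (snd p)) *\<^sub>R (?Z p * (\<mu> (fst p) * \<mu> (snd p)))) \<partial>(\<rho> \<Otimes>\<^sub>M \<rho>))"
      by (rule Bochner_Integration.integral_cong) (auto simp: g_def algebra_simps power2_eq_square)
    also have "\<dots> = 2 * t\<^sup>2 * (\<integral>p. (k (fst p) * k (snd p)) *\<^sub>R (?Z p * (\<mu> (fst p) * \<mu> (snd p))) \<partial>(\<rho> \<Otimes>\<^sub>M \<rho>))"
      by simp
    also have "(\<integral>p. (k (fst p) * k (snd p)) *\<^sub>R (?Z p * (\<mu> (fst p) * \<mu> (snd p))) \<partial>(\<rho> \<Otimes>\<^sub>M \<rho>))
        = (\<integral>p. ?Z p * (\<mu> (fst p) * \<mu> (snd p)) \<partial>(N \<Otimes>\<^sub>M N))"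
    proof -
      have "N \<Otimes>\<^sub>M N = density (\<rho> \<Otimes>\<^sub>M \<rho>) (\<lambda>(x,y). ennreal (k x) * ennreal (k y))"
        unfolding kN[symmetric]
        by (rule pair_measure_density)
           (auto simp: kN intro!: \<rho>.sigma_finite_measure_axioms finite_measure.sigma_finite_measure finite_measureI,
             use N_le[of UNIV] \<rho>.emeasure_finite[of UNIV] in \<open>auto simp: top_unique N_def\<close>)
      also have "\<dots> = density (\<rho> \<Otimes>\<^sub>M \<rho>) (\<lambda>p. ennreal (k (fst p) * k (snd p)))"
        by (rule density_cong) (auto simp: ennreal_mult k0 split_beta)
      finally show ?thesis by (simp only:) (subst integral_density, auto simp: k0)
    qed
    also have "\<dots> = (\<integral>p. (\<epsilon>0 * indicator ?B (fst p) * (\<epsilon>0 * indicator ?B (snd p))) *\<^sub>R (?Z p * (\<mu> (fst p) * \<mu> (snd p))) \<partial>(lborel \<Otimes>\<^sub>M lborel))"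
    proof -
      have "N \<Otimes>\<^sub>M N = density (lborel \<Otimes>\<^sub>M lborel) (\<lambda>(x,y). ennreal (\<epsilon>0 * indicator ?B x) * ennreal (\<epsilon>0 * indicator ?B y))"
        unfolding N_def
        by (rule pair_measure_density)
           (auto simp: N_def[symmetric] intro!: sigma_finite_lborel finite_measure.sigma_finite_measure finite_measureI,
             use N_le[of UNIV] \<rho>.emeasure_finite[of UNIV] in \<open>auto simp: top_unique N_def\<close>)
      also have "\<dots> = density (lborel \<Otimes>\<^sub>M lborel) (\<lambda>p. ennreal (\<epsilon>0 * indicator ?B (fst p) * (\<epsilon>0 * indicator ?B (snd p))))"
        by (rule density_cong) (use \<open>0 < \<epsilon>0\<close> in \<open>auto simp: ennreal_mult'[symmetric] split_beta\<close>)
      finally show ?thesis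
        by (simp only:) (subst integral_density, use \<open>0 < \<epsilon>0\<close> in auto)
    qed
    also have "\<dots> = (\<integral>p. \<epsilon>0\<^sup>2 * (?Z p * (\<mu> (fst p) * \<mu> (snd p))) \<partial>(lborel \<Otimes>\<^sub>M lborel))"
      by (rule Bochner_Integration.integral_cong) (use \<mu> in \<open>auto split: split_indicator simp: power2_eq_square\<close>)
    also have "\<dots> = \<epsilon>0\<^sup>2 * (\<integral>p. ?Z p * (\<mu> (fst p) * \<mu> (snd p)) \<partial>(lborel \<Otimes>\<^sub>M lborel))"
      by simp
    finally show "0 \<le> (\<integral>p. ?Z p * (\<mu> (fst p) * \<mu> (snd p)) \<partial>(lborel \<Otimes>\<^sub>M lborel))"
      using t \<open>0 < \<epsilon>0\<close> by (simp add: zero_le_mult_iff)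
  qed
qed

section \<open>Splitting an atom\<close>

lemma isolated_atom:
  fixes \<rho> :: "'a::euclidean_space measure"
  assumes \<rho>: "compact_prob \<rho>" and iso: "x0 isolated_in msupport \<rho>"
  obtains r where "0 < r" "0 < measure \<rho> {x0}" "AE x in \<rho>. x = x0 \<or> r \<le> norm (x - x0)"
proof -
  interpret \<rho>: prob_space \<rho> using \<rho> by (auto simp: compact_prob_def)
  have s[measurable_cong]: "sets \<rho> = sets borel" using \<rho> by (auto simp: compact_prob_def)
  obtain r where r: "0 < r" "ball x0 r \<inter> msupport \<rho> = {x0}"
  proof -
    obtain T where T: "open T" "T \<inter> msupport \<rho> = {x0}" using iso by (auto simp: isolated_in_def)
    then obtain r where "0 < r" "ball x0 r \<subseteq> T" by (metis Int_iff insertI1 open_contains_ball)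
    moreover have "ball x0 r \<inter> msupport \<rho> = {x0}" using calculation T(2) by auto
    ultimately show ?thesis using that by blast
  qed
  have null: "- msupport \<rho> \<in> null_sets \<rho>"
    using emeasure_compl_msupport[OF s] s closed_msupport[of \<rho>] by (intro null_setsI) auto
  then have AE: "AE x in \<rho>. x \<in> msupport \<rho>" by (rule AE_I') auto
  have 1: "AE x in \<rho>. x = x0 \<or> r \<le> norm (x - x0)"
    using AE
  proof eventually_elim
    case (elim x)
    have "x \<in> {x0}" if "norm (x - x0) < r"
    proof -
      have "x \<in> ball x0 r" using that by (simp add: dist_norm norm_minus_commute)
      then have "x \<in> ball x0 r \<inter> msupport \<rho>" using elim by (rule IntI)
      then show ?thesis by (simp only: r(2))
    qed
    then show ?case by (meson not_less singletonD)
  qed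
  have "x0 \<in> msupport \<rho>" using r(2) by blast
  then have "0 < emeasure \<rho> (ball x0 r)"
    using r(1) unfolding msupport_def by simp
  also have "emeasure \<rho> (ball x0 r) \<le> emeasure \<rho> {x0}"
  proof (rule emeasure_mono_AE)
    show "AE x in \<rho>. x \<in> ball x0 r \<longrightarrow> x \<in> {x0}"
      using 1 by eventually_elim (auto simp: dist_norm norm_minus_commute)
  qed (simp add: s)
  finally have "0 < measure \<rho> {x0}" by (simp add: \<rho>.emeasure_eq_measure)
  then show ?thesis using that r(1) 1 by blast
qed

lemma atom_infinite_energy:
  fixes \<rho> :: "'a::euclidean_space measure"
  assumes \<rho>: "compact_prob \<rho>" and W[measurable]: "W \<in> borel_measurable borel"
    and "W 0 = \<infinity>" and m: "0 < measure \<rho> {x0}"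
  shows "energy W \<rho> = \<infinity>"
proof -
  interpret \<rho>: prob_space \<rho> using \<rho> by (auto simp: compact_prob_def)
  have s[measurable_cong]: "sets \<rho> = sets borel" using \<rho> by (auto simp: compact_prob_def)
  have m': "0 < emeasure \<rho> {x0}" using m by (simp add: \<rho>.emeasure_eq_measure)
  have "(\<integral>\<^sup>+ p. e2ennreal (W (fst p - snd p)) \<partial>(\<rho> \<Otimes>\<^sub>M \<rho>)) \<ge> (\<integral>\<^sup>+ p. \<infinity> * indicator ({x0} \<times> {x0}) p \<partial>(\<rho> \<Otimes>\<^sub>M \<rho>))"
    by (rule nn_integral_mono) (auto split: split_indicator simp: \<open>W 0 = \<infinity>\<close>)
  moreover have "(\<integral>\<^sup>+ p. \<infinity> * indicator ({x0} \<times> {x0}) p \<partial>(\<rho> \<Otimes>\<^sub>M \<rho>)) = \<infinity> * (emeasure \<rho> {x0} * emeasure \<rho> {x0})"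
  proof -
    have x0: "{x0} \<in> sets \<rho>" by (simp add: s)
    then have "{x0} \<times> {x0} \<in> sets (\<rho> \<Otimes>\<^sub>M \<rho>)" by (rule pair_measureI) (rule x0)
    then show ?thesis
      by (simp only: nn_integral_cmult_indicator \<rho>.emeasure_pair_measure_Times[OF x0 x0])
  qed
  moreover have "\<dots> = \<infinity>" using m' by (simp add: ennreal_top_mult ennreal_mult_eq_top_iff)
  ultimately have p: "(\<integral>\<^sup>+ p. e2ennreal (W (fst p - snd p)) \<partial>(\<rho> \<Otimes>\<^sub>M \<rho>)) = \<infinity>" by (simp add: top_unique)
  show ?thesis
    unfolding energy_as_pair_integrals[OF \<rho>.prob_space_axioms s W] p
    by (cases "enn2ereal (\<integral>\<^sup>+ p. e2ennreal (- W (fst p - snd p)) \<partial>(\<rho> \<Otimes>\<^sub>M \<rho>))") auto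
qed

lemma small_power_exists:
  fixes a c q :: real
  assumes "0 < a" "0 < c" "0 < q"
  obtains t where "0 < t" "t < a" "t powr q < c"
proof -
  define t where "t = min (a/2) ((c/2) powr (1/q))"
  have t: "0 < t" "t < a" using assms by (auto simp: t_def)
  have "t powr q \<le> ((c/2) powr (1/q)) powr q" using assms t by (intro powr_mono2) (auto simp: t_def)
  also have "\<dots> = c/2" using assms by (simp add: powr_powr)
  also have "\<dots> < c" using assms by simp
  finally show ?thesis using that t by blast
qed

text \<open>
  The competitor moves the atom at \<open>x0\<close> to \<open>x0 + v\<close> or \<open>x0 - v\<close> with probability one half each,
  independently of everything else. Its energy is the energy of \<open>\<rho>\<close> for the averaged potential
  \<open>Zb\<close>, and \<open>Zb\<close> can be compared with \<open>Z\<close> pointwise. Between the atom and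
  another point of the support a symmetric second difference appears, at distance at least \<open>r\<close>
  from the cusp, costing at most \<open>C t\<^sup>2\<close>; between the atom and itself half of the pairs separate by \<open>2 t\<close> and gain a
  multiple of \<open>t powr p\<close>, which wins because \<open>p < 2\<close>.
\<close>

lemma local_minimizer_no_isolated_point:
  fixes \<rho> :: "'a::euclidean_space measure" and Z :: "'a \<Rightarrow> real"
  assumes \<rho>: "compact_prob \<rho>" and min: "d_infinity_local_minimizer W \<rho>"
    and W: "\<And>z. W z = ereal (Z z)" and Z[measurable]: "Z \<in> borel_measurable borel"
    and bdd: "\<And>R. \<exists>B. \<forall>z. norm z \<le> R \<longrightarrow> \<bar>Z z\<bar> \<le> B"
    and semiconcave: "\<And>r R. 0 < r \<Longrightarrow> \<exists>C. \<forall>z v. r \<le> norm z \<and> norm z \<le> R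
        \<longrightarrow> Z (z + v) + Z (z - v) - 2 * Z z \<le> C * (norm v)\<^sup>2"
    and cusp: "\<And>v. Z v - Z 0 \<le> (norm v)\<^sup>2 / 2 - \<kappa> * norm v powr p" and \<kappa>: "0 < \<kappa>" and p: "p < 2"
  shows "\<not> x0 isolated_in msupport \<rho>"
proof
  assume iso: "x0 isolated_in msupport \<rho>"
  interpret \<rho>: prob_space \<rho> using \<rho> by (auto simp: compact_prob_def)
  interpret \<rho>2: pair_prob_space \<rho> \<rho> ..
  have s[measurable_cong]: "sets \<rho> = sets borel" using \<rho> by (auto simp: compact_prob_def)
  have [measurable]: "W \<in> borel_measurable borel" unfolding W[abs_def] by measurable
  obtain r where r: "0 < r" "0 < measure \<rho> {x0}" "AE x in \<rho>. x = x0 \<or> r \<le> norm (x - x0)"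
    using isolated_atom[OF \<rho> iso] .
  obtain R where R: "0 < R" "AE x in \<rho>. norm x \<le> R" using compact_prob_AE_bounded[OF \<rho>] .
  obtain \<epsilon> where \<epsilon>: "\<epsilon> > 0" "\<And>\<nu>. compact_prob \<nu> \<Longrightarrow> d_infinity \<rho> \<nu> < ereal \<epsilon> \<Longrightarrow> energy W \<rho> \<le> energy W \<nu>"
    using min by (auto simp: d_infinity_local_minimizer_def)
  define m where "m = measure \<rho> {x0}"
  have m: "0 < m" using r(2) by (simp add: m_def)
  obtain C0 where C0: "\<And>z v. r \<le> norm z \<and> norm z \<le> 2 * R
        \<Longrightarrow> Z (z + v) + Z (z - v) - 2 * Z z \<le> C0 * (norm v)\<^sup>2"
    using semiconcave[OF r(1), of "2 * R"] by blast
  \<comment> \<open>the lower bound 1 absorbs the quadratic confinement in the cusp estimate\<close>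
  define C where "C = max C0 1"
  have C: "1 \<le> C" and C0C: "C0 \<le> C" by (auto simp: C_def)
  define c where "c = \<kappa> * 2 powr p * m\<^sup>2 / (2 * C)"
  have c: "0 < c" using \<kappa> m C by (auto simp: c_def)
  obtain t where t: "0 < t" "t < min \<epsilon> 1" "t powr (2 - p) < c"
    using small_power_exists[of "min \<epsilon> 1" c "2 - p"] \<epsilon>(1) r(1) c p by auto
  obtain b :: 'a where b: "b \<in> Basis" using nonempty_Basis by blast
  define v where "v = t *\<^sub>R b"
  have v: "norm v = t" using b t(1) by (simp add: v_def)
  define T where "T s x = (if x = x0 then x0 + (if s then v else - v) else x)" for s x
  have [measurable]: "T s \<in> borel_measurable borel" for s
  proof -
    have "{x0} \<in> sets borel" by simp
    then have [measurable]: "Measurable.pred borel (\<lambda>x. x = x0)" by (simp add: pred_def)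
    show ?thesis unfolding T_def by measurable
  qed
  define coin where "coin = measure_pmf (bernoulli_pmf (1/2))"
  interpret coin: prob_space coin unfolding coin_def by (rule measure_pmf.prob_space_axioms)
  have sc[measurable_cong]: "sets coin = sets (count_space UNIV)" by (simp add: coin_def)
  interpret P: pair_prob_space \<rho> coin ..
  let ?T = "\<lambda>p. T (snd p) (fst p)"
  have eqT: "?T = (\<lambda>p. if snd p then T True (fst p) else T False (fst p))"
    by (auto simp: T_def)
  have [measurable]: "?T \<in> borel_measurable (\<rho> \<Otimes>\<^sub>M coin)"
    unfolding eqT by measurable
  define \<nu> where "\<nu> = distr (\<rho> \<Otimes>\<^sub>M coin) borel ?T"
  have close: "norm (T s x - x) \<le> t" for s x using v t(1) by (auto simp: T_def)
  have \<nu>: "compact_prob \<nu>" "d_infinity \<rho> \<nu> \<le> ereal t"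
    unfolding \<nu>_def using close
    by (auto intro!: randomized_transport[OF \<rho> coin.prob_space_axioms])
  have sn[measurable_cong]: "sets \<nu> = sets borel" by (simp add: \<nu>_def)
  interpret \<nu>: prob_space \<nu> using \<nu>(1) by (auto simp: compact_prob_def)
  interpret \<nu>2: pair_prob_space \<nu> \<nu> ..
  have AE\<nu>: "AE x in \<nu>. norm x \<le> R + 1"
  proof -
    have "AE p in \<rho> \<Otimes>\<^sub>M coin. norm (fst p) \<le> R"
      by (rule AE_fst_pair[OF \<rho>.sigma_finite_measure_axioms coin.prob_space_axioms R(2)])
    then have "AE p in \<rho> \<Otimes>\<^sub>M coin. norm (?T p) \<le> R + 1"
    proof eventually_elim
      case (elim p)
      have "norm (?T p) \<le> norm (fst p) + norm (?T p - fst p)" by norm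
      then show ?case using elim close[of "snd p" "fst p"] t by simp
    qed
    then show ?thesis unfolding \<nu>_def by (subst AE_distr_iff) auto
  qed
  define R2 where "R2 = 2 * R + 2"
  obtain B where B: "\<And>z. norm z \<le> R2 \<Longrightarrow> \<bar>Z z\<bar> \<le> B" using bdd[of R2] by blast
  \<comment> \<open>truncating beyond the diameter of both supports makes every integral below one of a bounded function\<close>
  define Zt where "Zt z = (if norm z \<le> R2 then Z z else 0)" for z
  have [measurable]: "Zt \<in> borel_measurable borel" unfolding Zt_def by measurable
  have B0: "0 \<le> B" using B[of 0] R(1) abs_ge_zero[of "Z 0"] by (simp add: R2_def)
  have Ztb: "\<bar>Zt z\<bar> \<le> B" for z using B B0 by (auto simp: Zt_def)
  have energy_eq: "energy W \<mu> = ereal (1/2 * (\<integral>p. Zt (fst p - snd p) \<partial>(\<mu> \<Otimes>\<^sub>M \<mu>)))"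
    if "prob_space \<mu>" and [measurable_cong]: "sets \<mu> = sets borel" and bd: "AE x in \<mu>. norm x \<le> R + 1" for \<mu> :: "'a measure"
  proof -
    interpret \<mu>: prob_space \<mu> by fact
    interpret pair_prob_space \<mu> \<mu> ..
    have i: "integrable (\<mu> \<Otimes>\<^sub>M \<mu>) (\<lambda>p. Zt (fst p - snd p))"
      by (rule P.integrable_const_bound[of _ B]) (auto simp: Ztb)
    have ae: "AE p in \<mu> \<Otimes>\<^sub>M \<mu>. Zt (fst p - snd p) = Z (fst p - snd p)"
      using AE_fst_pair[OF \<mu>.sigma_finite_measure_axioms that(1) bd] AE_snd_pair[OF that(1) \<mu>.sigma_finite_measure_axioms bd]
    proof eventually_elim
      case (elim p)
      have "norm (fst p - snd p) \<le> norm (fst p) + norm (snd p)" by norm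
      then show ?case using elim by (simp add: Zt_def R2_def)
    qed
    have i2: "integrable (\<mu> \<Otimes>\<^sub>M \<mu>) (\<lambda>p. Z (fst p - snd p))"
      by (rule integrable_cong_AE_imp[OF i]) (use ae in auto)
    have "energy W \<mu> = ereal (1/2 * (\<integral>p. Z (fst p - snd p) \<partial>(\<mu> \<Otimes>\<^sub>M \<mu>)))"
      using i2 by (subst energy_eq_integral[OF that(1,2)]) (auto simp: W)
    also have "(\<integral>p. Z (fst p - snd p) \<partial>(\<mu> \<Otimes>\<^sub>M \<mu>)) = (\<integral>p. Zt (fst p - snd p) \<partial>(\<mu> \<Otimes>\<^sub>M \<mu>))"
      by (rule integral_cong_AE) (use ae in auto)
    finally show ?thesis .
  qed
  have int\<nu>: "(\<integral>x. f x \<partial>\<nu>) = (\<integral>x. (f (T True x) + f (T False x)) / 2 \<partial>\<rho>)"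
    if [measurable]: "f \<in> borel_measurable borel" and fb: "\<And>x. \<bar>f x\<bar> \<le> B" for f :: "'a \<Rightarrow> real"
  proof -
    have "(\<integral>x. f x \<partial>\<nu>) = (\<integral>p. f (?T p) \<partial>(\<rho> \<Otimes>\<^sub>M coin))" unfolding \<nu>_def by (subst integral_distr) auto
    also have "\<dots> = (\<integral>x. (\<integral>s. f (T s x) \<partial>coin) \<partial>\<rho>)"
    proof -
      have "integrable (\<rho> \<Otimes>\<^sub>M coin) (\<lambda>p. f (?T p))"
        by (rule P.P.integrable_const_bound[of _ B]) (auto simp: fb)
      from P.integral_fst'[OF this] show ?thesis by simp
    qed
    also have "(\<lambda>x. \<integral>s. f (T s x) \<partial>coin) = (\<lambda>x. (f (T True x) + f (T False x)) / 2)"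
      unfolding coin_def by (auto simp: integral_bernoulli_pmf)
    finally show ?thesis .
  qed
  define Zb where "Zb p = (Zt (T True (fst p) - T True (snd p)) + Zt (T True (fst p) - T False (snd p))
      + Zt (T False (fst p) - T True (snd p)) + Zt (T False (fst p) - T False (snd p))) / 4" for p
  have [measurable]: "Zb \<in> borel_measurable (\<rho> \<Otimes>\<^sub>M \<rho>)" unfolding Zb_def by measurable
  have avg4: "\<bar>(a + b + c + d) / 4\<bar> \<le> B" if "\<bar>a\<bar> \<le> B" "\<bar>b\<bar> \<le> B" "\<bar>c\<bar> \<le> B" "\<bar>d\<bar> \<le> B" for a b c d
    using that by (simp add: abs_le_iff)
  have Zbb: "\<bar>Zb p\<bar> \<le> B" for p
    unfolding Zb_def by (rule avg4; rule Ztb)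
  have iZb: "integrable (\<rho> \<Otimes>\<^sub>M \<rho>) Zb" by (rule \<rho>2.P.integrable_const_bound[of _ B]) (auto simp: Zbb)
  have iZt: "integrable (\<rho> \<Otimes>\<^sub>M \<rho>) (\<lambda>p. Zt (fst p - snd p))"
    by (rule \<rho>2.P.integrable_const_bound[of _ B]) (auto simp: Ztb)
  have avg: "(\<integral>p. Zt (fst p - snd p) \<partial>(\<nu> \<Otimes>\<^sub>M \<nu>)) = (\<integral>p. Zb p \<partial>(\<rho> \<Otimes>\<^sub>M \<rho>))"
  proof -
    have "integrable (\<nu> \<Otimes>\<^sub>M \<nu>) (\<lambda>p. Zt (fst p - snd p))"
      by (rule \<nu>2.P.integrable_const_bound[of _ B]) (auto simp: Ztb)
    from \<nu>2.integral_fst'[OF this]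
    have "(\<integral>p. Zt (fst p - snd p) \<partial>(\<nu> \<Otimes>\<^sub>M \<nu>)) = (\<integral>x. (\<integral>y. Zt (x - y) \<partial>\<nu>) \<partial>\<nu>)" by simp
    also have "\<dots> = (\<integral>x. ((\<integral>y. Zt (T True x - y) \<partial>\<nu>) + (\<integral>y. Zt (T False x - y) \<partial>\<nu>)) / 2 \<partial>\<rho>)"
    proof (rule int\<nu>)
      fix x
      have "integrable \<nu> (\<lambda>y. Zt (x - y))" by (rule \<nu>.integrable_const_bound[of _ B]) (auto simp: Ztb)
      then have "\<bar>\<integral>y. Zt (x - y) \<partial>\<nu>\<bar> \<le> (\<integral>y. \<bar>Zt (x - y)\<bar> \<partial>\<nu>)" by (intro integral_abs_bound)
      also have "\<dots> \<le> B" by (rule \<nu>.integral_le_const) (auto intro!: \<nu>.integrable_const_bound[of _ B] simp: Ztb)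
      finally show "\<bar>\<integral>y. Zt (x - y) \<partial>\<nu>\<bar> \<le> B" .
    qed measurable
    also have "\<dots> = (\<integral>x. (\<integral>y. Zb (x, y) \<partial>\<rho>) \<partial>\<rho>)"
    proof (rule Bochner_Integration.integral_cong[OF refl])
      fix x
      have ii: "integrable \<rho> (\<lambda>y. Zt (a - T s y))" for a s
        by (rule \<rho>.integrable_const_bound[of _ B]) (auto simp: Ztb)
      have 1: "(\<integral>y. Zt (a - y) \<partial>\<nu>) = (\<integral>y. (Zt (a - T True y) + Zt (a - T False y)) / 2 \<partial>\<rho>)" for a
        by (rule int\<nu>) (auto simp: Ztb)
      show "((\<integral>y. Zt (T True x - y) \<partial>\<nu>) + (\<integral>y. Zt (T False x - y) \<partial>\<nu>)) / 2 = (\<integral>y. Zb (x, y) \<partial>\<rho>)"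
        unfolding 1 Zb_def using ii by (simp add: field_simps)
    qed
    also have "\<dots> = (\<integral>p. Zb p \<partial>(\<rho> \<Otimes>\<^sub>M \<rho>))" using \<rho>2.integral_fst'[OF iZb] by simp
    finally show ?thesis .
  qed
  define kp where "kp = \<kappa> * (2 * t) powr p"
  define Q where "Q = {x0} \<times> {x0}"
  have x0: "{x0} \<in> sets \<rho>" by (simp add: s)
  have Q: "Q \<in> sets (\<rho> \<Otimes>\<^sub>M \<rho>)" unfolding Q_def by (rule pair_measureI[OF x0 x0])
  have Qm: "measure (\<rho> \<Otimes>\<^sub>M \<rho>) Q = m\<^sup>2"
    unfolding Q_def by (simp only: measure_def \<rho>.emeasure_pair_measure_Times[OF x0 x0] enn2real_mult m_def power2_eq_square)
  let ?D = "\<lambda>q. C * t\<^sup>2 - kp / 2 * indicator Q q"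
  have iQ: "integrable (\<rho> \<Otimes>\<^sub>M \<rho>) (indicator Q :: _ \<Rightarrow> real)"
    using Q by (auto intro!: integrable_real_indicator simp: \<rho>2.P.emeasure_eq_measure)
  have iD: "integrable (\<rho> \<Otimes>\<^sub>M \<rho>) ?D"
    using iQ by auto
  have pw: "AE q in \<rho> \<Otimes>\<^sub>M \<rho>. Zb q - Zt (fst q - snd q) \<le> ?D q"
  proof -
    have good: "AE x in \<rho>. norm x \<le> R \<and> (x = x0 \<or> r \<le> norm (x - x0))" using R(2) r(3) by eventually_elim auto
    have sd: "Zt (z + v) + Zt (z - v) - 2 * Zt z \<le> C * t\<^sup>2" if "r \<le> norm z" "norm z \<le> 2 * R" for z
    proof -
      have "norm (z + v) \<le> norm z + norm v" "norm (z - v) \<le> norm z + norm v" by norm+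
      then have "norm z \<le> R2" "norm (z + v) \<le> R2" "norm (z - v) \<le> R2" using that t v by (auto simp: R2_def)
      then have "Zt (z + v) + Zt (z - v) - 2 * Zt z = Z (z + v) + Z (z - v) - 2 * Z z" by (simp add: Zt_def)
      also have "\<dots> \<le> C0 * t\<^sup>2" using C0[of z v] that t v by simp
      also have "\<dots> \<le> C * t\<^sup>2" using C0C by (intro mult_right_mono) auto
      finally show ?thesis .
    qed
    have self: "Zt z - Zt 0 \<le> 2 * t\<^sup>2 - kp" if "norm z = 2 * t" for z
      using cusp[of z] that t R(1) by (simp add: kp_def Zt_def R2_def power2_eq_square)
    have t2: "0 \<le> t\<^sup>2" by simp
    show ?thesis
      using AE_fst_pair[OF \<rho>.sigma_finite_measure_axioms \<rho>.prob_space_axioms good] AE_snd_pair[OF \<rho>.prob_space_axioms \<rho>.sigma_finite_measure_axioms good]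
    proof eventually_elim
      case (elim q)
      obtain x y where q: "q = (x, y)" by (cases q)
      have xy: "norm x \<le> R" "norm y \<le> R" "x = x0 \<or> r \<le> norm (x - x0)" "y = x0 \<or> r \<le> norm (y - x0)"
        using elim q by auto
      have nxy: "norm (x - y) \<le> 2 * R" using norm_triangle_ineq4[of x y] xy by linarith
      consider "x = x0" "y = x0" | "x = x0" "y \<noteq> x0" | "x \<noteq> x0" "y = x0" | "x \<noteq> x0" "y \<noteq> x0" by blast
      then show ?case
      proof cases
        case 1
        have nv: "norm (v + v) = 2 * t" "norm (- v - v) = 2 * t"
        proof -
          have "v + v = 2 *\<^sub>R v" "- v - v = (- 2) *\<^sub>R v" by (simp_all add: scaleR_2)
          then show "norm (v + v) = 2 * t" "norm (- v - v) = 2 * t" using v by (simp_all only: norm_scaleR)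
        qed
        have "Zt (v + v) - Zt 0 \<le> 2 * t\<^sup>2 - kp" "Zt (- v - v) - Zt 0 \<le> 2 * t\<^sup>2 - kp"
          by (rule self[OF nv(1)], rule self[OF nv(2)])
        moreover have "t\<^sup>2 \<le> C * t\<^sup>2" using C t2 by (simp add: mult_le_cancel_right1)
        moreover have "4 * Zb q = Zt 0 + Zt (v + v) + Zt (- v - v) + Zt 0"
        proof -
          have "x0 + v - (x0 + - v) = v + v" "x0 + - v - (x0 + v) = - v - v" by simp_all
          then show ?thesis unfolding q Zb_def T_def using 1 by (simp only: fst_conv snd_conv if_True if_False simp_thms diff_self) simp
        qed
        moreover have "Zt (fst q - snd q) = Zt 0" "?D q = C * t\<^sup>2 - kp / 2" using 1 by (simp_all add: q Q_def)
        ultimately show ?thesis by linarith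
      next
        case 2
        have "Zt (x0 - y + v) + Zt (x0 - y - v) - 2 * Zt (x0 - y) \<le> C * t\<^sup>2"
          by (rule sd) (use 2 xy nxy in \<open>auto simp: norm_minus_commute\<close>)
        moreover have "0 \<le> C * t\<^sup>2" using C by simp
        moreover have "2 * Zb q = Zt (x0 - y + v) + Zt (x0 - y - v)"
        proof -
          have "x0 + v - y = x0 - y + v" "x0 + - v - y = x0 - y - v" by simp_all
          then show ?thesis unfolding q Zb_def T_def using 2 by (simp only: fst_conv snd_conv if_True if_False simp_thms) simp
        qed
        moreover have "Zt (fst q - snd q) = Zt (x0 - y)" "?D q = C * t\<^sup>2" using 2 by (simp_all add: q Q_def)
        ultimately show ?thesis by linarith
      next
        case 3
        have "Zt (x - x0 + v) + Zt (x - x0 - v) - 2 * Zt (x - x0) \<le> C * t\<^sup>2"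
          by (rule sd) (use 3 xy nxy in \<open>auto simp: norm_minus_commute\<close>)
        moreover have "0 \<le> C * t\<^sup>2" using C by simp
        moreover have "2 * Zb q = Zt (x - x0 + v) + Zt (x - x0 - v)"
        proof -
          have "x - (x0 + v) = x - x0 - v" "x - (x0 + - v) = x - x0 + v" by simp_all
          then show ?thesis unfolding q Zb_def T_def using 3 by (simp only: fst_conv snd_conv if_True if_False simp_thms) simp
        qed
        moreover have "Zt (fst q - snd q) = Zt (x - x0)" "?D q = C * t\<^sup>2" using 3 by (simp_all add: q Q_def)
        ultimately show ?thesis by linarith
      next
        case 4
        have "0 \<le> C * t\<^sup>2" using C by simp
        then show ?thesis using 4 by (simp add: q Q_def Zb_def T_def)
      qed
    qed
  qed
  have "(\<integral>p. Zb p \<partial>(\<rho> \<Otimes>\<^sub>M \<rho>)) - (\<integral>p. Zt (fst p - snd p) \<partial>(\<rho> \<Otimes>\<^sub>M \<rho>)) = (\<integral>p. Zb p - Zt (fst p - snd p) \<partial>(\<rho> \<Otimes>\<^sub>M \<rho>))"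
    using iZb iZt by simp
  also have "\<dots> \<le> (\<integral>p. ?D p \<partial>(\<rho> \<Otimes>\<^sub>M \<rho>))"
    by (rule integral_mono_AE) (use iZb iZt iD pw in auto)
  also have "\<dots> = C * t\<^sup>2 - kp / 2 * m\<^sup>2"
  proof -
    have "(\<integral>q. ?D q \<partial>(\<rho> \<Otimes>\<^sub>M \<rho>)) = (\<integral>q. C * t\<^sup>2 \<partial>(\<rho> \<Otimes>\<^sub>M \<rho>)) - (\<integral>q. kp / 2 * indicator Q q \<partial>(\<rho> \<Otimes>\<^sub>M \<rho>))"
      by (rule Bochner_Integration.integral_diff) (use iQ in auto)
    also have "(\<integral>q. kp / 2 * indicator Q q \<partial>(\<rho> \<Otimes>\<^sub>M \<rho>)) = kp / 2 * measure (\<rho> \<Otimes>\<^sub>M \<rho>) Q"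
      using Q by (subst integral_mult_right_zero) (auto simp: sets.sets_into_space Int_absorb2)
    also have "(\<integral>q. C * t\<^sup>2 \<partial>(\<rho> \<Otimes>\<^sub>M \<rho>)) = C * t\<^sup>2" using \<rho>2.P.prob_space by simp
    finally show ?thesis by (simp only: Qm)
  qed
  also have "\<dots> < 0"
  proof -
    have "t\<^sup>2 = t powr (2 - p) * t powr p" using t(1) by (simp flip: powr_add)
    also have "\<dots> < c * t powr p" using t by (intro mult_strict_right_mono) auto
    finally have "C * t\<^sup>2 < C * (c * t powr p)" using C by simp
    also have "\<dots> = kp / 2 * m\<^sup>2" using C t(1) by (simp add: c_def kp_def powr_mult)
    finally show ?thesis by simp
  qed
  finally have lt: "(\<integral>p. Zb p \<partial>(\<rho> \<Otimes>\<^sub>M \<rho>)) < (\<integral>p. Zt (fst p - snd p) \<partial>(\<rho> \<Otimes>\<^sub>M \<rho>))" by simp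
  have "AE x in \<rho>. norm x \<le> R + 1" using R(2) by eventually_elim simp
  then have "energy W \<nu> < energy W \<rho>"
    using energy_eq[OF \<rho>.prob_space_axioms s] energy_eq[OF \<nu>.prob_space_axioms sn AE\<nu>] avg lt by simp
  moreover have "d_infinity \<rho> \<nu> < ereal \<epsilon>" using \<nu>(2) t(2) by (meson le_less_trans less_ereal.simps(1) min_less_iff_conj)
  ultimately show False using \<epsilon>(2)[OF \<nu>(1)] by (simp add: not_less[symmetric])
qed

section \<open>The total force of widely spaced Gaussians\<close>

text \<open>
  The functional equation of the Gamma function removes the apparent singularity at \<open>\<alpha> = d\<close>, so
  that one formula covers the power and the logarithmic case.
\<close>

lemma riesz_const_times_gap_eq:
  assumes "0 < \<alpha>" "\<alpha> < real d + 2"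
  shows "riesz_const_times_gap d \<alpha> = 2 * Gamma ((real d + 2 - \<alpha>) / 2) / (pi powr (real d / 2) * 2 powr \<alpha> * Gamma (\<alpha> / 2))"
proof (cases "\<alpha> = real d")
  case True
  then show ?thesis by (simp add: riesz_const_times_gap_def Gamma_eq_zero_iff)
next
  case False
  let ?z = "(real d - \<alpha>) / 2"
  have "?z \<notin> \<int>\<^sub>\<le>\<^sub>0"
  proof
    assume "?z \<in> \<int>\<^sub>\<le>\<^sub>0"
    then obtain n where n: "?z = of_int n" "n \<le> 0" by (auto elim!: nonpos_Ints_cases)
    have "n \<noteq> 0" using n False by auto
    then have "of_int n \<le> (-1 :: real)" using n(2) by linarith
    then show False using n(1) assms by simp
  qed
  then have "Gamma (?z + 1) = ?z * Gamma ?z" by (rule Gamma_plus1)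
  moreover have "(real d + 2 - \<alpha>) / 2 = ?z + 1" by (simp add: field_simps)
  ultimately have "Gamma ((real d + 2 - \<alpha>) / 2) = ?z * Gamma ?z" by (simp only:)
  then have "Gamma ((real d - \<alpha>) / 2) * (real d - \<alpha>) = 2 * Gamma ((real d + 2 - \<alpha>) / 2)"
    by (simp add: mult.commute)
  then show ?thesis using False by (simp add: riesz_const_times_gap_def riesz_const_def)
qed

lemma riesz_const_times_gap_pos:
  assumes "0 < \<alpha>" "\<alpha> < real d + 2"
  shows "0 < riesz_const_times_gap d \<alpha>"
  unfolding riesz_const_times_gap_eq[OF assms] using assms by (auto intro!: divide_pos_pos mult_pos_pos Gamma_real_pos)

lemma powr_less_one_base:
  fixes x b :: real
  assumes "0 < x" "x < 1" "0 < b"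
  shows "x powr b < 1"
  using powr_less_mono2[of b x 1] assms by simp

lemma riesz_kernel_has_derivative:
  assumes "0 < \<alpha>" "0 < r"
  shows "(riesz_kernel d \<alpha> has_real_derivative - riesz_const_times_gap d \<alpha> * r powr (\<alpha> - real d - 1)) (at r)"
proof (cases "\<alpha> = real d")
  case True
  have "((\<lambda>r. - (2 / (pi powr (real d / 2) * 2 powr \<alpha> * Gamma (\<alpha> / 2))) * ln r) has_real_derivative
      - (2 / (pi powr (real d / 2) * 2 powr \<alpha> * Gamma (\<alpha> / 2))) * (1 / r)) (at r)"
    using assms by (intro DERIV_cmult DERIV_ln_divide)
  moreover have "Gamma (\<alpha> / 2) \<noteq> 0"
    using Gamma_real_pos[of "\<alpha> / 2"] assms(1) by (metis half_gt_zero less_irrefl)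
  ultimately show ?thesis using assms unfolding True
    by (simp add: riesz_kernel_def[abs_def] riesz_const_times_gap_def powr_minus_divide)
next
  case False
  have "((\<lambda>r. riesz_const d \<alpha> * r powr (\<alpha> - real d)) has_real_derivative
      riesz_const d \<alpha> * ((\<alpha> - real d) * r powr (\<alpha> - real d - 1))) (at r)"
    using assms by (auto intro!: derivative_eq_intros)
  then show ?thesis using False
    by (simp add: riesz_kernel_def[abs_def] riesz_const_times_gap_def algebra_simps)
qed

lemma riesz_kernel_antimono:
  assumes "0 < \<alpha>" "\<alpha> < real d + 2" "0 < r" "r \<le> s"
  shows "riesz_kernel d \<alpha> s \<le> riesz_kernel d \<alpha> r"
proof (rule DERIV_nonpos_imp_nonincreasing[OF assms(4)])
  fix x assume "r \<le> x" "x \<le> s"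
  then show "\<exists>y. (riesz_kernel d \<alpha> has_real_derivative y) (at x) \<and> y \<le> 0"
    using riesz_kernel_has_derivative[of \<alpha> x d] riesz_const_times_gap_pos[OF assms(1,2)] assms(1,3)
    by (intro exI[of _ "- riesz_const_times_gap d \<alpha> * x powr (\<alpha> - real d - 1)"]) auto
qed

text \<open>
  With \<open>s = r / lam ^ k\<close> and \<open>b = d + 2 - \<alpha>\<close> this is the force of the \<open>k\<close>-th Gaussian at
  distance \<open>r\<close>, relative to the force \<open>r powr (\<alpha> - d - 1)\<close> of the Riesz kernel.
\<close>

definition bump :: "real \<Rightarrow> real \<Rightarrow> real" where
  "bump b s = s powr b * exp (- (s\<^sup>2 / 2))"

text \<open>
  The maximum of \<open>bump b\<close>, attained at \<open>s = sqrt b\<close>.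
\<close>

definition bump_max :: "real \<Rightarrow> real" where
  "bump_max b = b powr (b / 2) * exp (- (b / 2))"

text \<open>
  After taking logarithms this is \<open>ln y \<le> y - 1\<close> for \<open>y = s\<^sup>2 / b\<close>.
\<close>

lemma bump_le_max:
  assumes "0 < b" "0 < s"
  shows "bump b s \<le> bump_max b"
proof -
  have "ln (s\<^sup>2 / b) \<le> s\<^sup>2 / b - 1" using assms by (intro ln_le_minus_one) auto
  then have "2 * ln s - ln b \<le> s\<^sup>2 / b - 1" using assms by (simp add: ln_div ln_realpow)
  then have "(b / 2) * (2 * ln s - ln b) \<le> (b / 2) * (s\<^sup>2 / b - 1)"
    using assms by (intro mult_left_mono) auto
  moreover have "(b / 2) * (2 * ln s - ln b) = b * ln s - (b / 2) * ln b" by (simp add: algebra_simps)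
  moreover have "(b / 2) * (s\<^sup>2 / b - 1) = s\<^sup>2 / 2 - b / 2" using assms by (simp add: field_simps)
  ultimately have "b * ln s - s\<^sup>2 / 2 \<le> (b / 2) * ln b - b / 2" by linarith
  then have "exp (b * ln s - s\<^sup>2 / 2) \<le> exp ((b / 2) * ln b - b / 2)" by simp
  moreover have "bump b s = exp (b * ln s - s\<^sup>2 / 2)" "bump_max b = exp ((b / 2) * ln b - b / 2)"
    using assms by (simp_all add: bump_def bump_max_def powr_def mult_exp_exp)
  ultimately show ?thesis by simp
qed

lemma bump_le_powr: "bump b s \<le> s powr b"
  unfolding bump_def by (rule mult_right_le_one_le) auto

lemma bump_le_inverse_powr:
  assumes "0 < b" "0 < s"
  shows "bump b s \<le> bump_max (2 * b) * s powr (- b)"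
proof -
  have "bump b s = bump (2 * b) s * s powr (- b)"
    using assms by (simp add: bump_def powr_minus field_simps flip: powr_add)
  also have "\<dots> \<le> bump_max (2 * b) * s powr (- b)"
    using bump_le_max[of "2 * b" s] assms by (intro mult_right_mono) auto
  finally show ?thesis .
qed

lemma bump_max_nonneg: "0 \<le> bump_max b" by (simp add: bump_max_def)

lemma geometric_partial_le:
  fixes x :: real
  assumes "0 \<le> x" "x < 1"
  shows "(\<Sum>i<n. x ^ i) \<le> 1 / (1 - x)"
  using assms by (simp add: sum_gp_strict divide_right_mono)

lemma sum_bump_small:
  assumes "0 < b" "0 < lam" "lam < 1" "0 < v" "v \<le> sqrt lam"
  shows "(\<Sum>i<n. bump b (v * lam ^ i)) \<le> lam powr (b / 2) / (1 - lam powr b)"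
proof -
  have "(\<Sum>i<n. bump b (v * lam ^ i)) \<le> (\<Sum>i<n. lam powr (b / 2) * (lam powr b) ^ i)"
  proof (rule sum_mono)
    fix i
    have "bump b (v * lam ^ i) \<le> (v * lam ^ i) powr b" by (rule bump_le_powr)
    also have "\<dots> = v powr b * (lam powr b) ^ i"
      using assms by (simp add: powr_mult powr_powr mult.commute flip: powr_realpow)
    also have "\<dots> \<le> lam powr (b / 2) * (lam powr b) ^ i"
    proof (rule mult_right_mono)
      have "v powr b \<le> sqrt lam powr b" using assms by (intro powr_mono2) auto
      also have "\<dots> = lam powr (b / 2)" using assms by (simp add: powr_half_sqrt[symmetric] powr_powr)
      finally show "v powr b \<le> lam powr (b / 2)" .
    qed simp
    finally show "bump b (v * lam ^ i) \<le> lam powr (b / 2) * (lam powr b) ^ i" .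
  qed
  also have "\<dots> = lam powr (b / 2) * (\<Sum>i<n. (lam powr b) ^ i)" by (simp add: sum_distrib_left)
  also have "\<dots> \<le> lam powr (b / 2) * (1 / (1 - lam powr b))"
    using assms by (intro mult_left_mono geometric_partial_le) (auto simp: powr_less_one_base)
  finally show ?thesis by simp
qed

lemma sum_bump_large:
  assumes "0 < b" "0 < lam" "lam < 1" "1 / sqrt lam \<le> v"
  shows "(\<Sum>i<n. bump b (v / lam ^ i)) \<le> bump_max (2 * b) * (lam powr (b / 2) / (1 - lam powr b))"
proof -
  have v: "0 < v" using assms by (smt (verit) divide_pos_pos real_sqrt_gt_zero)
  have "(\<Sum>i<n. bump b (v / lam ^ i)) \<le> (\<Sum>i<n. bump_max (2 * b) * (lam powr (b / 2) * (lam powr b) ^ i))"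
  proof (rule sum_mono)
    fix i
    have "bump b (v / lam ^ i) \<le> bump_max (2 * b) * (v / lam ^ i) powr (- b)"
      using assms v by (intro bump_le_inverse_powr) auto
    also have "(v / lam ^ i) powr (- b) = v powr (- b) * (lam powr b) ^ i"
      using assms v by (simp add: powr_divide powr_minus powr_powr mult.commute flip: powr_realpow) (simp add: field_simps powr_minus)
    also have "bump_max (2 * b) * (v powr (- b) * (lam powr b) ^ i) \<le> bump_max (2 * b) * (lam powr (b / 2) * (lam powr b) ^ i)"
    proof (intro mult_left_mono mult_right_mono bump_max_nonneg)
      have "v powr (- b) \<le> (1 / sqrt lam) powr (- b)" using assms v by (intro powr_mono2') auto
      also have "\<dots> = lam powr (b / 2)" using assms by (simp add: powr_half_sqrt[symmetric] powr_powr powr_divide powr_minus)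
      finally show "v powr (- b) \<le> lam powr (b / 2)" .
    qed simp
    finally show "bump b (v / lam ^ i) \<le> bump_max (2 * b) * (lam powr (b / 2) * (lam powr b) ^ i)" .
  qed
  also have "\<dots> = bump_max (2 * b) * (lam powr (b / 2) * (\<Sum>i<n. (lam powr b) ^ i))" by (simp add: sum_distrib_left)
  also have "\<dots> \<le> bump_max (2 * b) * (lam powr (b / 2) * (1 / (1 - lam powr b)))"
    using assms by (intro mult_left_mono geometric_partial_le bump_max_nonneg) (auto simp: powr_less_one_base)
  finally show ?thesis by simp
qed

text \<open>
  The arguments \<open>r / lam ^ k\<close> form a geometric progression with ratio \<open>1 / lam\<close>, so at most one of
  them lies strictly between \<open>sqrt lam\<close> and \<open>1 / sqrt lam\<close>. That one contributes at most the
  maximum; the smaller and the larger ones decay geometrically away from this window. The excess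
  over a single bump therefore tends to zero with \<open>lam\<close>.
\<close>

lemma sum_bump_le:
  assumes "0 < b" "0 < lam" "lam < 1" "0 < r"
  shows "(\<Sum>j<n. bump b (r / lam ^ Suc j)) \<le> bump_max b + (1 + bump_max (2 * b)) * (lam powr (b / 2) / (1 - lam powr b))"
proof -
  define \<eta> where "\<eta> = lam powr (b / 2) / (1 - lam powr b)"
  have \<eta>: "0 \<le> \<eta>" using assms by (auto simp: \<eta>_def powr_less_one_base intro!: divide_nonneg_pos)
  define u where "u j = r / lam ^ Suc j" for j
  have u: "0 < u j" for j using assms by (simp add: u_def)
  \<comment> \<open>the first index beyond the small regime; \<open>k = n\<close> if there is none\<close>
  define k where "k = (LEAST j. n \<le> j \<or> sqrt lam < u j)"
  have k: "n \<le> k \<or> sqrt lam < u k" unfolding k_def by (rule LeastI[of _ n]) simp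
  have kn: "k \<le> n" unfolding k_def by (rule Least_le) simp
  have small: "u j \<le> sqrt lam" if "j < k" for j
    using not_less_Least[of j "\<lambda>j. n \<le> j \<or> sqrt lam < u j"] that unfolding k_def by auto
  have first: "(\<Sum>j<k. bump b (u j)) \<le> \<eta>"
  proof (cases k)
    case 0 then show ?thesis using \<eta> by simp
  next
    case (Suc l)
    have "(\<Sum>j<k. bump b (u j)) = (\<Sum>j<k. bump b (u l * lam ^ (k - Suc j)))"
    proof (rule sum.cong[OF refl])
      fix j assume "j \<in> {..<k}"
      then have "j \<le> l" using Suc by simp
      then have "lam ^ Suc l = lam ^ Suc j * lam ^ (l - j)" by (simp flip: power_add)
      then have "u j = u l * lam ^ (k - Suc j)" using Suc assms by (simp add: u_def field_simps)
      then show "bump b (u j) = bump b (u l * lam ^ (k - Suc j))" by simp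
    qed
    also have "\<dots> = (\<Sum>i<k. bump b (u l * lam ^ i))" by (rule sum.nat_diff_reindex)
    also have "\<dots> \<le> \<eta>" unfolding \<eta>_def using assms u[of l] small[of l] Suc by (intro sum_bump_small) auto
    finally show ?thesis .
  qed
  show ?thesis
  proof (cases "k = n")
    case True
    then show ?thesis using first \<eta> bump_max_nonneg[of b] bump_max_nonneg[of "2 * b"]
      by (simp add: u_def \<eta>_def[symmetric] algebra_simps add_increasing add_increasing2)
  next
    case False
    then have kn: "k < n" using kn by simp
    then have uk: "sqrt lam < u k" using k by auto
    have eq: "{..<n} = {..<Suc k} \<union> {Suc k..<n}" using kn by auto
    have "(\<Sum>j<n. bump b (u j)) = (\<Sum>j<Suc k. bump b (u j)) + (\<Sum>j=Suc k..<n. bump b (u j))"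
      unfolding eq by (rule sum.union_disjoint) auto
    also have "(\<Sum>j<Suc k. bump b (u j)) = (\<Sum>j<k. bump b (u j)) + bump b (u k)" by simp
    also have "(\<Sum>j=Suc k..<n. bump b (u j)) = (\<Sum>i<n - Suc k. bump b (u (Suc k) / lam ^ i))"
    proof -
      have "(\<Sum>j=Suc k..<n. bump b (u j)) = (\<Sum>i<n - Suc k. bump b (u (i + Suc k)))"
        using kn by (intro sum.reindex_bij_witness[of _ "\<lambda>i. i + Suc k" "\<lambda>j. j - Suc k"]) auto
      also have "\<dots> = (\<Sum>i<n - Suc k. bump b (u (Suc k) / lam ^ i))"
        by (rule sum.cong) (auto simp: u_def power_add mult_ac)
      finally show ?thesis .
    qed
    also have "\<dots> \<le> bump_max (2 * b) * \<eta>"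
      unfolding \<eta>_def
    proof (rule sum_bump_large)
      have "u (Suc k) = u k / lam" by (simp add: u_def)
      moreover have "1 / sqrt lam = sqrt lam / lam" using assms by (simp add: real_div_sqrt field_simps)
      ultimately show "1 / sqrt lam \<le> u (Suc k)" using uk assms by (simp add: divide_right_mono)
    qed (use assms in auto)
    finally have "(\<Sum>j<n. bump b (u j)) \<le> \<eta> + bump_max b + bump_max (2 * b) * \<eta>"
      using first bump_le_max[of b "u k"] u assms by (simp add: add_mono)
    then show ?thesis by (simp add: u_def \<eta>_def[symmetric] algebra_simps)
  qed
qed

definition gauss_term :: "real \<Rightarrow> real \<Rightarrow> nat \<Rightarrow> real \<Rightarrow> real" where
  "gauss_term q lam j r = lam powr (q * real (Suc j)) * exp (- (r\<^sup>2 / (2 * lam ^ (2 * Suc j))))"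

definition gauss_series :: "real \<Rightarrow> real \<Rightarrow> real \<Rightarrow> real" where
  "gauss_series q lam r = (\<Sum>j. gauss_term q lam j r)"

lemma gauss_term_nonneg: "0 \<le> gauss_term q lam j r" by (simp add: gauss_term_def)

lemma gauss_term_has_derivative:
  assumes "0 < lam" "0 < r"
  shows "(gauss_term q lam j has_real_derivative - (r powr (q - 1) * bump (2 - q) (r / lam ^ Suc j))) (at r)"
proof -
  let ?l = "lam ^ Suc j"
  have l: "0 < ?l" using assms by simp
  have "(gauss_term q lam j has_real_derivative lam powr (q * real (Suc j)) * (exp (- (r\<^sup>2 / (2 * lam ^ (2 * Suc j)))) * (- (2 * r / (2 * lam ^ (2 * Suc j)))))) (at r)"
  proof -
    have "((\<lambda>r. A * exp (- (r\<^sup>2 / c))) has_real_derivative A * (exp (- (r\<^sup>2 / c)) * (- (2 * r / c)))) (at r)"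
      if "c \<noteq> 0" for A c :: real
      using that by (auto intro!: derivative_eq_intros simp: field_simps)
    from this[of "2 * lam ^ (2 * Suc j)"] show ?thesis
      unfolding gauss_term_def[abs_def] using assms by simp
  qed
  moreover have "lam powr (q * real (Suc j)) * (2 * r / (2 * lam ^ (2 * Suc j))) = r powr (q - 1) * (r / ?l) powr (2 - q)"
  proof -
    have l2: "?l = lam powr real (Suc j)" using assms by (simp only: powr_realpow)
    have "lam powr (q * real (Suc j)) = ?l powr q" unfolding l2 by (simp only: powr_powr mult.commute)
    moreover have "lam ^ (2 * Suc j) = ?l powr 2"
    proof -
      have "lam ^ (2 * Suc j) = ?l ^ 2" by (simp only: power_mult[symmetric] mult.commute)
      then show ?thesis using l by (simp only: powr_numeral)
    qed
    moreover have "(r / ?l) powr (2 - q) = r powr (2 - q) / (?l powr 2 / ?l powr q)"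
      using assms l by (simp add: powr_divide powr_diff[of ?l] del: power_Suc)
    moreover have "r powr (q - 1) * r powr (2 - q) = r" using assms by (simp flip: powr_add)
    ultimately show ?thesis by (simp add: field_simps)
  qed
  moreover have "r\<^sup>2 / (2 * lam ^ (2 * Suc j)) = (r / ?l)\<^sup>2 / 2"
  proof -
    have "lam ^ (2 * Suc j) = ?l ^ 2" by (simp only: power_mult[symmetric] mult.commute)
    then show ?thesis by (simp add: power_divide del: power_Suc)
  qed
  moreover have "A * (E * (- X)) = - ((A * X) * E)" for A E X :: real by simp
  ultimately show ?thesis unfolding bump_def by (simp only: mult.assoc)
qed

lemma exp_neg_le_fact_power:
  fixes x :: real assumes "0 < x" shows "exp (- x) \<le> fact n / x ^ n"
proof -
  have "(\<Sum>k\<in>{n}. x ^ k /\<^sub>R fact k) \<le> (\<Sum>k. x ^ k /\<^sub>R fact k)"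
    using assms exp_converges[of x] by (intro sum_le_suminf) (auto simp: sums_iff)
  then have "x ^ n / fact n \<le> exp x" using exp_converges[of x] by (simp add: sums_iff divide_inverse_commute)
  then show ?thesis using assms by (simp add: exp_minus field_simps)
qed

text \<open>
  \<open>exp (- x)\<close> beats any power of \<open>1 / x\<close>, which compensates the growing factor \<open>lam powr (q k)\<close>
  for negative \<open>q\<close>.
\<close>

lemma gauss_term_summable:
  assumes "0 < lam" "lam < 1" "0 < r" "0 < n" "- real n \<le> q"
  shows "summable (\<lambda>j. gauss_term q lam j r)"
proof (rule summable_comparison_test)
  let ?C = "fact n * (2 / r\<^sup>2) ^ n"
  have ln1: "lam ^ n < 1" using assms by (intro power_less_one_iff[THEN iffD2]) auto
  show "summable (\<lambda>j. ?C * (lam ^ n) ^ Suc j)"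
    using assms ln1 by (intro summable_mult summable_Suc_iff[THEN iffD2] summable_geometric) auto
  have "norm (gauss_term q lam j r) \<le> ?C * (lam ^ n) ^ Suc j" for j
  proof -
    let ?l = "lam ^ Suc j"
    have l: "0 < ?l" using assms by simp
    have e: "lam ^ (2 * Suc j) = ?l ^ 2" by (simp only: power_mult[symmetric] mult.commute)
    have "lam powr (q * real (Suc j)) \<le> lam powr (- real n * real (Suc j))"
      using assms by (intro powr_mono' mult_right_mono) auto
    also have "\<dots> = 1 / ?l ^ n"
    proof -
      have "lam powr (- real n * real (Suc j)) = 1 / lam powr (real (Suc j * n))"
      proof -
        have "- real n * real (Suc j) = - real (Suc j * n)" by (simp add: algebra_simps)
        then show ?thesis by (simp only: powr_minus_divide)
      qed
      also have "lam powr (real (Suc j * n)) = ?l ^ n"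
        using assms by (simp only: powr_realpow power_mult)
      finally show ?thesis .
    qed
    finally have 1: "lam powr (q * real (Suc j)) \<le> 1 / ?l ^ n" .
    have "exp (- (r\<^sup>2 / (2 * ?l ^ 2))) \<le> fact n / (r\<^sup>2 / (2 * ?l ^ 2)) ^ n"
      using assms l by (intro exp_neg_le_fact_power) auto
    also have "\<dots> = ?C * (?l ^ n * ?l ^ n)"
      using assms l by (simp add: power_divide power_mult_distrib field_simps power2_eq_square del: power_Suc)
    finally have 2: "exp (- (r\<^sup>2 / (2 * ?l ^ 2))) \<le> ?C * (?l ^ n * ?l ^ n)" .
    have "gauss_term q lam j r \<le> 1 / ?l ^ n * (?C * (?l ^ n * ?l ^ n))"
      unfolding gauss_term_def e by (intro mult_mono 1 2) (use assms in auto)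
    also have "\<dots> = ?C * ?l ^ n" using l by (simp add: field_simps del: power_Suc)
    also have "?l ^ n = (lam ^ n) ^ Suc j" by (simp only: power_mult[symmetric] mult.commute)
    finally show ?thesis by (simp add: gauss_term_nonneg)
  qed
  then show "\<exists>N. \<forall>j\<ge>N. norm (gauss_term q lam j r) \<le> ?C * (lam ^ n) ^ Suc j" by blast
qed

lemma gauss_term_summable_pos:
  assumes "0 < lam" "lam < 1" "0 < q"
  shows "summable (\<lambda>j. gauss_term q lam j r)"
proof (rule summable_comparison_test)
  show "summable (\<lambda>j. (lam powr q) ^ Suc j)"
    using assms by (intro summable_Suc_iff[THEN iffD2] summable_geometric) (auto simp: powr_less_one_base)
  have "norm (gauss_term q lam j r) \<le> (lam powr q) ^ Suc j" for j
  proof -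
    have "gauss_term q lam j r \<le> lam powr (q * real (Suc j))" unfolding gauss_term_def
      using assms by (intro mult_right_le_one_le) auto
    also have "\<dots> = (lam powr q) powr real (Suc j)" by (simp only: powr_powr)
    also have "\<dots> = (lam powr q) ^ Suc j" using assms by (intro powr_realpow) auto
    finally show ?thesis by (simp add: gauss_term_nonneg)
  qed
  then show "\<exists>N. \<forall>j\<ge>N. norm (gauss_term q lam j r) \<le> (lam powr q) ^ Suc j" by blast
qed

text \<open>
  The assumption \<open>small\<close> is the quantitative form of \<open>c < c_upper\<close> for small \<open>lam\<close>: by \<open>sum_bump_le\<close> the total Gaussian force is at most the fraction \<open>1 - \<theta>\<close> of the Riesz
  force at every distance.
\<close>

locale sparse_gaussians =
  fixes d :: nat and \<alpha> c lam \<theta> :: real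
  assumes d: "0 < d" and \<alpha>: "0 < \<alpha>" "\<alpha> < real d + 2" and c: "0 < c" and lam: "0 < lam" "lam < 1"
    and \<theta>: "0 < \<theta>" "\<theta> < 1"
    and small: "c * (bump_max (real d + 2 - \<alpha>) + (1 + bump_max (2 * (real d + 2 - \<alpha>))) *
        (lam powr ((real d + 2 - \<alpha>) / 2) / (1 - lam powr (real d + 2 - \<alpha>)))) \<le> (1 - \<theta>) * riesz_const_times_gap d \<alpha>"
begin

abbreviation "R \<equiv> riesz_kernel d \<alpha>"
abbreviation "S \<equiv> gauss_series (\<alpha> - real d) lam"
abbreviation "gap \<equiv> riesz_const_times_gap d \<alpha>"

definition profile :: "real \<Rightarrow> real" where "profile r = (1 - \<theta>) * R r - c * S r"

lemma summable: "0 < r \<or> real d < \<alpha> \<and> 0 \<le> r \<Longrightarrow> summable (\<lambda>j. gauss_term (\<alpha> - real d) lam j r)"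
  using gauss_term_summable[of lam r d "\<alpha> - real d"] gauss_term_summable_pos[of lam "\<alpha> - real d" r] lam d \<alpha> by auto

lemma continuous_on_riesz_kernel:
  assumes "0 < r \<or> real d < \<alpha> \<and> 0 \<le> r"
  shows "continuous_on {r..s} R"
proof (cases "real d < \<alpha>")
  case True
  then show ?thesis unfolding riesz_kernel_def[abs_def] using assms
    by (auto intro!: continuous_intros continuous_on_powr')
next
  case False
  then have "continuous_on {r..s} R"
    using assms riesz_kernel_has_derivative[OF \<alpha>(1), of _ d]
    by (intro DERIV_atLeastAtMost_imp_continuous_on) (metis less_le_trans)
  then show ?thesis .
qed

lemma riesz_antimono:
  assumes "0 < r \<or> real d < \<alpha> \<and> 0 \<le> r" "r \<le> s"
  shows "R s \<le> R r"
proof (cases "r = s")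
  case False
  then have "r \<le> s" using assms by simp
  then show ?thesis
  proof (rule DERIV_nonpos_imp_decreasing_open)
    fix x assume "r < x" "x < s"
    then have "0 < x" using assms by auto
    then show "\<exists>y. (R has_real_derivative y) (at x) \<and> y \<le> 0"
      using riesz_kernel_has_derivative[OF \<alpha>(1), of x d] riesz_const_times_gap_pos[OF \<alpha>]
      by (intro exI[of _ "- gap * x powr (\<alpha> - real d - 1)"]) auto
  qed (rule continuous_on_riesz_kernel[OF assms(1)])
qed simp

text \<open>
  By \<open>sum_bump_le\<close> the derivative is nonpositive for every partial sum, and the monotonicity passes
  to the limit. For \<open>\<alpha> > d\<close> the functions are continuous up to
  \<open>r = 0\<close>.
\<close>

lemma partial_profile_antimono:
  assumes "0 < r \<or> real d < \<alpha> \<and> 0 \<le> r" "r \<le> s"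
  shows "(1 - \<theta>) * R s - c * (\<Sum>j<n. gauss_term (\<alpha> - real d) lam j s)
      \<le> (1 - \<theta>) * R r - c * (\<Sum>j<n. gauss_term (\<alpha> - real d) lam j r)"
proof (cases "r = s")
  case False
  then have "r \<le> s" using assms by simp
  then show ?thesis
  proof (rule DERIV_nonpos_imp_decreasing_open)
    fix x assume "r < x" "x < s"
    then have x: "0 < x" using assms by auto
    let ?b = "real d + 2 - \<alpha>"
    let ?B = "\<lambda>j. bump ?b (x / lam ^ Suc j)"
    have e: "2 - (\<alpha> - real d) = ?b" by simp
    let ?y = "(1 - \<theta>) * (- gap * x powr (\<alpha> - real d - 1)) - c * (\<Sum>j<n. - (x powr (\<alpha> - real d - 1) * ?B j))"
    have "((\<lambda>s. (1 - \<theta>) * R s - c * (\<Sum>j<n. gauss_term (\<alpha> - real d) lam j s)) has_real_derivative ?y) (at x)"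
      using gauss_term_has_derivative[OF lam(1) x, of "\<alpha> - real d"] riesz_kernel_has_derivative[OF \<alpha>(1) x, of d]
      unfolding e by (intro DERIV_diff DERIV_cmult DERIV_sum)
    moreover have "?y = x powr (\<alpha> - real d - 1) * (c * (\<Sum>j<n. ?B j) - (1 - \<theta>) * gap)"
      by (simp add: sum_negf algebra_simps flip: sum_distrib_left)
    moreover have "c * (\<Sum>j<n. ?B j) \<le> (1 - \<theta>) * gap"
    proof -
      have "c * (\<Sum>j<n. ?B j) \<le> c * (bump_max ?b + (1 + bump_max (2 * ?b)) * (lam powr (?b / 2) / (1 - lam powr ?b)))"
        using \<alpha> lam x c by (intro mult_left_mono sum_bump_le) auto
      then show ?thesis using small by simp
    qed
    ultimately show "\<exists>y. ((\<lambda>s. (1 - \<theta>) * R s - c * (\<Sum>j<n. gauss_term (\<alpha> - real d) lam j s)) has_real_derivative y) (at x) \<and> y \<le> 0"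
      by (intro exI[of _ ?y]) (auto simp: mult_nonneg_nonpos)
  next
    show "continuous_on {r..s} (\<lambda>s. (1 - \<theta>) * R s - c * (\<Sum>j<n. gauss_term (\<alpha> - real d) lam j s))"
      unfolding gauss_term_def using lam continuous_on_riesz_kernel[OF assms(1)]
      by (intro continuous_intros) auto
  qed
qed simp

lemma profile_antimono:
  assumes "0 < r \<or> real d < \<alpha> \<and> 0 \<le> r" "r \<le> s"
  shows "profile s \<le> profile r"
proof -
  have "(\<lambda>n. (1 - \<theta>) * R r - c * (\<Sum>j<n. gauss_term (\<alpha> - real d) lam j r)) \<longlonglongrightarrow> profile r"
    if "0 < r \<or> real d < \<alpha> \<and> 0 \<le> r" for r
    unfolding profile_def gauss_series_def by (intro tendsto_intros summable_LIMSEQ summable that)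
  then show ?thesis
    using assms partial_profile_antimono[OF assms]
    by (intro LIMSEQ_le[of "\<lambda>n. (1 - \<theta>) * R s - c * (\<Sum>j<n. gauss_term (\<alpha> - real d) lam j s)" "profile s"
          "\<lambda>n. (1 - \<theta>) * R r - c * (\<Sum>j<n. gauss_term (\<alpha> - real d) lam j r)" "profile r"]) auto
qed

definition radial_potential :: "real \<Rightarrow> real" where "radial_potential r = R r + r\<^sup>2 / 2 - c * S r"

lemma radial_potential_eq: "radial_potential r = \<theta> * R r + r\<^sup>2 / 2 + profile r"
  by (simp add: radial_potential_def profile_def algebra_simps)

lemma S_nonneg: "0 < r \<or> real d < \<alpha> \<and> 0 \<le> r \<Longrightarrow> 0 \<le> S r"
  unfolding gauss_series_def by (intro suminf_nonneg summable gauss_term_nonneg)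

lemma radial_potential_le: "0 < r \<or> real d < \<alpha> \<and> 0 \<le> r \<Longrightarrow> radial_potential r \<le> R r + r\<^sup>2 / 2"
  using S_nonneg[of r] c by (simp add: radial_potential_def)

lemma radial_potential_ge:
  assumes "0 < r \<or> real d < \<alpha> \<and> 0 \<le> r" "r \<le> s"
  shows "\<theta> * R s + profile s \<le> radial_potential r"
proof -
  have "\<theta> * R s \<le> \<theta> * R r" using \<theta> riesz_antimono[OF assms] by (intro mult_left_mono) auto
  then show ?thesis using profile_antimono[OF assms] unfolding radial_potential_eq by (simp add: add_mono add_increasing2)
qed

text \<open>
  Both the power and the logarithmic singularity are dominated by an integrable power.
\<close>

lemma riesz_kernel_le_power:
  obtains p K where "0 < p" "p < real d" "0 \<le> K" "\<And>r. 0 < r \<Longrightarrow> R r \<le> K * r powr (- p)"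
proof -
  consider "\<alpha> < real d" | "\<alpha> = real d" | "real d < \<alpha>" by linarith
  then show ?thesis
  proof cases
    case 1
    have "0 \<le> riesz_const d \<alpha>"
      using 1 \<alpha> by (auto simp: riesz_const_def intro!: divide_nonneg_pos mult_pos_pos Gamma_real_pos Gamma_real_nonneg)
    then show ?thesis using 1 \<alpha> by (intro that[of "real d - \<alpha>" "riesz_const d \<alpha>"]) (auto simp: riesz_kernel_def)
  next
    case 2
    let ?K = "2 / (pi powr (real d / 2) * 2 powr \<alpha> * Gamma (\<alpha> / 2))"
    have K: "0 \<le> ?K" using \<alpha> by (auto intro!: divide_nonneg_pos mult_pos_pos Gamma_real_pos)
    show ?thesis
    proof (rule that[of "1/2" "?K * 2"])
      fix r :: real assume r: "0 < r"
      have "- ln r \<le> 2 * r powr (- (1/2))"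
      proof (cases "r < 1")
        case True
        then have "ln (1 / r) \<le> (1 / r) powr (1/2) / (1/2)" using r by (intro ln_powr_bound) auto
        then show ?thesis using r by (simp add: ln_div powr_minus_divide powr_divide)
      next
        case False
        then have "0 \<le> ln r" by simp
        moreover have "0 \<le> 2 * r powr (- (1/2))" by simp
        ultimately show ?thesis by linarith
      qed
      then have "?K * (- ln r) \<le> ?K * (2 * r powr (- (1/2)))" using K by (rule mult_left_mono)
      then show "R r \<le> ?K * 2 * r powr (- (1/2))" using 2 by (simp add: riesz_kernel_def mult_ac)
    qed (use d K in auto)
  next
    case 3
    have "R r \<le> 0 * r powr (- (1/2))" if "0 < r" for r
      using riesz_antimono[of 0 r] 3 that by (simp add: riesz_kernel_def)
    then show ?thesis using d by (intro that[of "1/2" 0]) auto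
  qed
qed

lemma cusp:
  assumes "real d < \<alpha>" "0 \<le> r"
  shows "radial_potential r - radial_potential 0 \<le> r\<^sup>2 / 2 - (- \<theta> * riesz_const d \<alpha>) * r powr (\<alpha> - real d)"
  using profile_antimono[of 0 r] assms unfolding radial_potential_eq by (simp add: riesz_kernel_def)

lemma riesz_const_neg: "real d < \<alpha> \<Longrightarrow> riesz_const d \<alpha> < 0"
  using riesz_const_times_gap_pos[OF \<alpha>] by (auto simp: riesz_const_times_gap_def zero_less_mult_iff)

end

text \<open>
  With \<open>x = h / b\<close>, the arithmetic-geometric mean inequality bounds
  \<open>(1 + x) powr P + (1 - x) powr P\<close> below by \<open>2 (1 - x\<^sup>2) powr (P / 2)\<close>, and this is at least
  \<open>2 (1 - x\<^sup>2)\<close> because \<open>0 < P / 2 \<le> 1\<close>.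
\<close>

lemma powr_second_difference:
  fixes b h P :: real
  assumes "0 < b" "\<bar>h\<bar> \<le> b" "0 < P" "P \<le> 1"
  shows "2 * b powr P - (b + h) powr P - (b - h) powr P \<le> 2 * b powr (P - 2) * h\<^sup>2"
proof -
  define x where "x = h / b"
  have x: "\<bar>x\<bar> \<le> 1" using assms by (simp add: x_def abs_divide)
  have x2: "0 \<le> 1 - x\<^sup>2" "1 - x\<^sup>2 \<le> 1" using x by (auto simp: abs_square_le_1)
  let ?u = "(1 + x) powr (P / 2)" and ?v = "(1 - x) powr (P / 2)"
  have "1 - x\<^sup>2 \<le> (1 - x\<^sup>2) powr (P / 2)"
  proof (cases "1 - x\<^sup>2 = 0")
    case False
    have "(1 - x\<^sup>2) powr 1 \<le> (1 - x\<^sup>2) powr (P / 2)" by (rule powr_mono') (use x2 assms in linarith)+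
    then show ?thesis using powr_one[OF x2(1)] by linarith
  qed simp
  also have "1 - x\<^sup>2 = (1 + x) * (1 - x)" by (simp add: power2_eq_square algebra_simps)
  also have "\<dots> powr (P / 2) = ?u * ?v" by (rule powr_mult)
  finally have 1: "1 - x\<^sup>2 \<le> ?u * ?v" using x2 by (simp add: power2_eq_square algebra_simps)
  have "0 \<le> (?u - ?v)\<^sup>2" by simp
  then have "2 * (?u * ?v) \<le> ?u * ?u + ?v * ?v" by (simp add: power2_eq_square algebra_simps)
  then have "2 * (?u * ?v) \<le> (1 + x) powr P + (1 - x) powr P" by (simp flip: powr_add)
  then have 2: "2 - (1 + x) powr P - (1 - x) powr P \<le> 2 * x\<^sup>2" using 1 by linarith
  have e: "b + h = b * (1 + x)" "b - h = b * (1 - x)" using assms by (simp_all add: x_def field_simps)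
  have "2 * b powr P - (b + h) powr P - (b - h) powr P = b powr P * (2 - (1 + x) powr P - (1 - x) powr P)"
    unfolding e powr_mult by (simp add: algebra_simps)
  also have "\<dots> \<le> b powr P * (2 * x\<^sup>2)" using 2 by (intro mult_left_mono) auto
  also have "\<dots> = 2 * b powr (P - 2) * h\<^sup>2"
    using assms by (simp add: x_def powr_diff power_divide)
  finally show ?thesis .
qed

context sparse_gaussians begin

text \<open>
  Each Gaussian is a convex function of the squared distance, and \<open>|z + v|\<^sup>2\<close> and \<open>|z - v|\<^sup>2\<close>
  average to \<open>|z|\<^sup>2 + |v|\<^sup>2\<close>.
\<close>

lemma S_midpoint_convex:
  fixes z v :: "'a::real_inner"
  assumes "real d < \<alpha>"
  shows "2 * S (sqrt ((norm z)\<^sup>2 + (norm v)\<^sup>2)) \<le> S (norm (z + v)) + S (norm (z - v))"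
proof -
  let ?t = "\<lambda>j r. gauss_term (\<alpha> - real d) lam j r"
  have "2 * ?t j (sqrt ((norm z)\<^sup>2 + (norm v)\<^sup>2)) \<le> ?t j (norm (z + v)) + ?t j (norm (z - v))" for j
  proof -
    let ?L = "2 * lam ^ (2 * Suc j)"
    define x where "x = - ((norm (z + v))\<^sup>2 / ?L)"
    define y where "y = - ((norm (z - v))\<^sup>2 / ?L)"
    have "(norm (z + v))\<^sup>2 + (norm (z - v))\<^sup>2 = 2 * ((norm z)\<^sup>2 + (norm v)\<^sup>2)"
      unfolding power2_norm_eq_inner by (simp add: inner_add_left inner_add_right inner_diff_left inner_diff_right inner_commute)
    then have m: "- (((norm z)\<^sup>2 + (norm v)\<^sup>2) / ?L) = x / 2 + y / 2"
    proof -
      have "x / 2 + y / 2 = - (((norm (z + v))\<^sup>2 + (norm (z - v))\<^sup>2) / 2 / ?L)"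
        by (simp add: x_def y_def add_divide_distrib mult.commute)
      also have "((norm (z + v))\<^sup>2 + (norm (z - v))\<^sup>2) / 2 = (norm z)\<^sup>2 + (norm v)\<^sup>2"
        using \<open>_ + _ = 2 * _\<close> by simp
      finally show ?thesis by simp
    qed
    have "0 \<le> (exp (x / 2) - exp (y / 2))\<^sup>2" by simp
    then have "2 * (exp (x / 2) * exp (y / 2)) \<le> exp (x / 2) * exp (x / 2) + exp (y / 2) * exp (y / 2)"
      by (simp add: power2_eq_square algebra_simps)
    then have "2 * exp (x / 2 + y / 2) \<le> exp x + exp y" by (simp flip: exp_add)
    then have "lam powr ((\<alpha> - real d) * real (Suc j)) * (2 * exp (x / 2 + y / 2)) \<le> lam powr ((\<alpha> - real d) * real (Suc j)) * (exp x + exp y)"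
      by (intro mult_left_mono) auto
    moreover have "(sqrt ((norm z)\<^sup>2 + (norm v)\<^sup>2))\<^sup>2 = (norm z)\<^sup>2 + (norm v)\<^sup>2" by simp
    ultimately show ?thesis
      unfolding gauss_term_def by (simp only: m x_def[symmetric] y_def[symmetric] distrib_left mult.left_commute[of "lam powr _" 2])
  qed
  then have "(\<Sum>j. 2 * ?t j (sqrt ((norm z)\<^sup>2 + (norm v)\<^sup>2))) \<le> (\<Sum>j. ?t j (norm (z + v)) + ?t j (norm (z - v)))"
    using assms by (intro suminf_le summable_mult summable_add summable) auto
  then show ?thesis unfolding gauss_series_def using assms
    by (simp add: suminf_mult summable suminf_add)
qed

text \<open>
  The second difference of the subtracted Gaussians is at most twice \<open>c (S |z| - S (sqrt b))\<close>, where
  \<open>b = |z|\<^sup>2 + |v|\<^sup>2\<close>, by convexity. Monotonicity of the profile replaces this by the same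
  increment of the Riesz kernel. The two Riesz contributions combine to a second difference of a
  power centred at \<open>b\<close>, with increment \<open>h = 2 z \<bullet> v\<close> of the squared distance.
\<close>

lemma semiconcave:
  fixes z v :: "'a::real_inner"
  assumes "real d < \<alpha>" "0 < r" "r \<le> norm z" "norm z \<le> A"
  shows "radial_potential (norm (z + v)) + radial_potential (norm (z - v)) - 2 * radial_potential (norm z)
    \<le> (1 - 8 * riesz_const d \<alpha> * (r\<^sup>2) powr ((\<alpha> - real d) / 2 - 2) * A\<^sup>2) * (norm v)\<^sup>2"
proof -
  define P where "P = (\<alpha> - real d) / 2"
  define b where "b = (norm z)\<^sup>2 + (norm v)\<^sup>2"
  define h where "h = 2 * inner z v"
  define k where "k = - riesz_const d \<alpha>"
  have k: "0 < k" using riesz_const_neg[OF assms(1)] by (simp add: k_def)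
  have P: "0 < P" "P \<le> 1" using assms(1) \<alpha> by (auto simp: P_def)
  have nz: "0 < norm z" using assms by linarith
  have b: "0 < b" "r\<^sup>2 \<le> b" using nz assms by (auto simp: b_def add_pos_nonneg add_increasing2 power_mono)
  have plus: "(norm (z + v))\<^sup>2 = b + h" and minus: "(norm (z - v))\<^sup>2 = b - h"
    unfolding b_def h_def power2_norm_eq_inner
    by (simp_all add: inner_add_left inner_add_right inner_diff_left inner_diff_right inner_commute)
  have hb: "\<bar>h\<bar> \<le> b" using plus minus zero_le_power2[of "norm (z + v)"] zero_le_power2[of "norm (z - v)"] by linarith
  have Rsq: "R s = - k * (s\<^sup>2) powr P" if "0 \<le> s" for s
  proof -
    have "2 * P = \<alpha> - real d" by (simp add: P_def)
    then have "s powr (\<alpha> - real d) = (s powr 2) powr P" by (simp only: powr_powr)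
    then show ?thesis using that assms(1) by (cases "s = 0") (auto simp: riesz_kernel_def k_def powr_numeral)
  qed
  have sb: "norm z \<le> sqrt b" unfolding b_def by (rule real_le_rsqrt) simp
  have sb2: "(sqrt b)\<^sup>2 = b" using b by simp
  have "c * (S (norm z) - S (sqrt b)) \<le> (1 - \<theta>) * (R (norm z) - R (sqrt b))"
    using profile_antimono[of "norm z" "sqrt b"] nz sb by (simp add: profile_def algebra_simps)
  also have "\<dots> \<le> R (norm z) - R (sqrt b)"
    using riesz_antimono[of "norm z" "sqrt b"] nz sb \<theta> by (intro mult_left_le_one_le) auto
  finally have 1: "c * (S (norm z) - S (sqrt b)) \<le> R (norm z) - R (sqrt b)" .
  have "c * (2 * S (sqrt b)) \<le> c * (S (norm (z + v)) + S (norm (z - v)))"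
    using S_midpoint_convex[OF assms(1), of z v] c by (intro mult_left_mono) (auto simp: b_def)
  then have 2: "c * (2 * S (norm z) - S (norm (z + v)) - S (norm (z - v))) \<le> 2 * (R (norm z) - R (sqrt b))"
    using 1 by (simp add: algebra_simps)
  have "radial_potential (norm (z + v)) + radial_potential (norm (z - v)) - 2 * radial_potential (norm z)
      = R (norm (z + v)) + R (norm (z - v)) - 2 * R (norm z) + (norm v)\<^sup>2
        + c * (2 * S (norm z) - S (norm (z + v)) - S (norm (z - v)))"
    unfolding radial_potential_def plus minus b_def by (simp add: algebra_simps add_divide_distrib diff_divide_distrib)
  also have "\<dots> \<le> R (norm (z + v)) + R (norm (z - v)) - 2 * R (sqrt b) + (norm v)\<^sup>2"
    by (rule order_trans[OF add_left_mono[OF 2]]) (simp add: algebra_simps)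
  also have "\<dots> = k * (2 * b powr P - (b + h) powr P - (b - h) powr P) + (norm v)\<^sup>2"
  proof -
    have "R (norm (z + v)) = - k * (b + h) powr P" "R (norm (z - v)) = - k * (b - h) powr P"
      by (simp_all only: Rsq[OF norm_ge_zero] plus minus)
    moreover have "R (sqrt b) = - k * b powr P" using Rsq[of "sqrt b"] b by (simp add: sb2)
    ultimately show ?thesis by (simp add: algebra_simps)
  qed
  also have "\<dots> \<le> k * (2 * b powr (P - 2) * h\<^sup>2) + (norm v)\<^sup>2"
    using k powr_second_difference[OF b(1) hb P] by simp
  also have "k * (2 * b powr (P - 2) * h\<^sup>2) \<le> k * (2 * (r\<^sup>2) powr (P - 2) * (4 * A\<^sup>2 * (norm v)\<^sup>2))"
  proof -
    have "b powr (P - 2) \<le> (r\<^sup>2) powr (P - 2)" using assms b P by (intro powr_mono2') auto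
    moreover have "h\<^sup>2 \<le> 4 * A\<^sup>2 * (norm v)\<^sup>2"
    proof -
      have "\<bar>inner z v\<bar> \<le> norm z * norm v" by (rule Cauchy_Schwarz_ineq2)
      also have "\<dots> \<le> A * norm v" using assms by (intro mult_right_mono) auto
      finally have "\<bar>inner z v\<bar>\<^sup>2 \<le> (A * norm v)\<^sup>2" by (intro power_mono) auto
      then show ?thesis by (simp add: h_def power_mult_distrib)
    qed
    ultimately show ?thesis using k by (intro mult_left_mono mult_mono) auto
  qed
  finally show ?thesis by (simp add: k_def P_def algebra_simps)
qed

end

text \<open>
  \<open>c < c_upper\<close> is equivalent to \<open>c\<close> times the maximal bump being less than the Riesz force
  constant. Then \<open>\<theta>\<close> uses half of the gap and \<open>lam0\<close> makes the excess in \<open>sum_bump_le\<close> fit into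
  the other half.
\<close>

lemma sparse_gaussians_eventually:
  assumes "0 < d" "0 < \<alpha>" "\<alpha> < real d + 2" "0 < c" "c < c_upper d \<alpha>"
  obtains \<theta> lam0 where "0 < lam0" "lam0 < 1" "\<And>lam. 0 < lam \<Longrightarrow> lam < lam0 \<Longrightarrow> sparse_gaussians d \<alpha> c lam \<theta>"
proof -
  define b where "b = real d + 2 - \<alpha>"
  have b: "0 < b" using assms by (simp add: b_def)
  define G where "G = riesz_const_times_gap d \<alpha>"
  have G: "0 < G" using riesz_const_times_gap_pos[OF assms(2,3)] by (simp add: G_def)
  have "bump_max b * (exp 1 / b) powr (b / 2) = 1"
    using b by (simp add: bump_max_def powr_divide powr_def[of "exp 1"] flip: exp_add)
  moreover have "bump_max b * c < bump_max b * ((exp 1 / b) powr (b / 2) * G)"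
    using assms(5) b unfolding c_upper_def b_def[symmetric] G_def[symmetric] by (simp add: bump_max_def)
  ultimately have "bump_max b * c < 1 * G" by (simp only: mult.assoc[symmetric])
  then have cM: "c * bump_max b < G" by (simp add: mult.commute)
  \<comment> \<open>places \<open>(1 - \<theta>) * G\<close> halfway between \<open>c * bump_max b\<close> and \<open>G\<close>\<close>
  define \<theta> where "\<theta> = (G - c * bump_max b) / (2 * G)"
  have \<theta>: "0 < \<theta>" "\<theta> < 1" using cM G assms(4) bump_max_nonneg[of b] by (auto simp: \<theta>_def field_simps add_pos_nonneg)
  have \<theta>G: "(1 - \<theta>) * G = (G + c * bump_max b) / 2" using G by (simp add: \<theta>_def field_simps)
  define K where "K = 1 + bump_max (2 * b)"
  have K: "1 \<le> K" using bump_max_nonneg[of "2 * b"] by (simp add: K_def)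
  define \<delta> where "\<delta> = min (1/2) ((G - c * bump_max b) / (4 * c * K))"
  have \<delta>: "0 < \<delta>" using cM assms(4) K by (auto simp: \<delta>_def)
  obtain lam0 where l0: "0 < lam0" "lam0 < 1" "lam0 powr (b / 2) < \<delta>"
    using small_power_exists[of 1 \<delta> "b / 2"] \<delta> b by auto
  show ?thesis
  proof (rule that[OF l0(1,2)])
    fix lam :: real assume lam: "0 < lam" "lam < lam0"
    define x where "x = lam powr (b / 2)"
    have "x \<le> lam0 powr (b / 2)" unfolding x_def using lam b by (intro powr_mono2) auto
    then have x: "0 < x" "x < 1/2" "x < (G - c * bump_max b) / (4 * c * K)"
      using l0(3) lam by (auto simp: \<delta>_def x_def)
    have "lam powr b = x * x" unfolding x_def by (simp flip: powr_add)
    moreover have "x * x \<le> 1/2 * 1" using x by (intro mult_mono) auto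
    ultimately have "x / (1 - lam powr b) \<le> x / (1/2)" using x by (intro divide_left_mono) auto
    then have "c * (K * (x / (1 - lam powr b))) \<le> c * (K * (x / (1/2)))" using assms(4) K by (intro mult_left_mono) auto
    also have "\<dots> = (4 * c * K) * x / 2" by simp
    also have "\<dots> \<le> (G - c * bump_max b) / 2" using x(3) assms(4) K by (simp add: field_simps)
    finally have "2 * (c * (K * (x / (1 - lam powr b)))) \<le> G - c * bump_max b"
      unfolding le_divide_eq_numeral1 mult.commute[of _ 2] by simp
    moreover have "2 * ((1 - \<theta>) * G) = G + c * bump_max b" unfolding \<theta>G by simp
    ultimately have "c * (bump_max b + K * (x / (1 - lam powr b))) \<le> (1 - \<theta>) * G"
      unfolding distrib_left by linarith
    then show "sparse_gaussians d \<alpha> c lam \<theta>"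
      using assms lam l0 \<theta> unfolding sparse_gaussians_def x_def b_def G_def K_def by auto
  qed
qed

section \<open>Local integrability of the potential and the two criteria\<close>

lemma nn_integral_abs_powr_finite:
  fixes s A :: real
  assumes "0 \<le> s" "s < 1" "0 < A"
  shows "(\<integral>\<^sup>+u. (if u = 0 then \<top> else ennreal (\<bar>u\<bar> powr (- s))) * indicator {-A..A} u \<partial>lborel) < \<infinity>"
proof -
  have AE0: "AE u in lborel. u \<noteq> (0::real)" by (rule AE_lborel_singleton)
  let ?g = "\<lambda>u::real. u powr (- s) * indicator {0..A} u"
  have H: "((\<lambda>u. u powr (- s)) has_integral A powr (- s + 1) / (- s + 1)) {0..A}"
    using assms by (intro has_integral_powr_from_0) auto
  have "(?g has_integral A powr (- s + 1) / (- s + 1)) UNIV"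
  proof -
    have "?g = (\<lambda>u. if u \<in> {0..A} then u powr (- s) else 0)" by (auto split: split_indicator)
    then show ?thesis using H by (simp only: has_integral_restrict_UNIV)
  qed
  then have "(\<integral>\<^sup>+u. ennreal (?g u) \<partial>lborel) = ennreal (A powr (- s + 1) / (- s + 1))"
    by (intro nn_integral_has_integral_lborel) auto
  then have fin: "(\<integral>\<^sup>+u. ennreal (?g u) \<partial>lborel) < \<infinity>" by simp
  have sym: "(\<integral>\<^sup>+u. ennreal (?g (- u)) \<partial>lborel) = (\<integral>\<^sup>+u. ennreal (?g u) \<partial>lborel)"
    using nn_integral_real_affine[of "\<lambda>u. ennreal (?g u)" "-1" 0] by simp
  have "(\<integral>\<^sup>+u. (if u = 0 then \<top> else ennreal (\<bar>u\<bar> powr (- s))) * indicator {-A..A} u \<partial>lborel)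
      \<le> (\<integral>\<^sup>+u. ennreal (?g u) + ennreal (?g (- u)) \<partial>lborel)"
  proof (rule nn_integral_mono_AE, use AE0 in eventually_elim)
    case (elim u)
    then show ?case by (cases "0 < u") (auto split: split_indicator simp: abs_if)
  qed
  also have "\<dots> = (\<integral>\<^sup>+u. ennreal (?g u) \<partial>lborel) + (\<integral>\<^sup>+u. ennreal (?g (- u)) \<partial>lborel)"
    by (rule nn_integral_add) auto
  also have "\<dots> < \<infinity>" using fin sym by simp
  finally show ?thesis .
qed

text \<open>
  Since \<open>norm x\<close> dominates every coordinate, \<open>norm x powr (- p)\<close> is at most the product of the
  \<open>\<bar>x \<bullet> b\<bar> powr (- p / d)\<close>, and \<open>p / d < 1\<close> makes each factor integrable. The value \<open>\<top>\<close> on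
  the coordinate hyperplanes keeps this inequality valid pointwise.
\<close>

lemma nn_integral_norm_powr_finite:
  fixes p A :: real
  assumes "0 < p" "p < real DIM('a::euclidean_space)" "0 < A"
  shows "(\<integral>\<^sup>+x\<in>ball (0::'a) A. ennreal (norm x powr (- p)) \<partial>lborel) < \<infinity>"
proof -
  let ?d = "DIM('a)"
  define s where "s = p / real ?d"
  have s: "0 \<le> s" "s < 1" "s * real ?d = p" using assms by (auto simp: s_def)
  let ?h = "\<lambda>u::real. (if u = 0 then \<top> else ennreal (\<bar>u\<bar> powr (- s))) * indicator {-A..A} u"
  have "(\<integral>\<^sup>+x\<in>ball (0::'a) A. ennreal (norm x powr (- p)) \<partial>lborel) \<le> (\<integral>\<^sup>+x. (\<Prod>b\<in>Basis. ?h ((x::'a) \<bullet> b)) \<partial>lborel)"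
  proof (rule nn_integral_mono)
    fix x :: 'a
    show "ennreal (norm x powr (- p)) * indicator (ball 0 A) x \<le> (\<Prod>b\<in>Basis. ?h (x \<bullet> b))"
    proof (cases "x \<in> ball 0 A")
      case True
      have "norm x powr (- p) = (norm x powr (- s)) ^ ?d"
        using s(3) by (cases "x = 0") (auto simp: powr_powr mult.commute simp flip: powr_realpow)
      then have "ennreal (norm x powr (- p)) = (\<Prod>b\<in>(Basis::'a set). ennreal (norm x powr (- s)))"
        by (simp add: prod_constant ennreal_power)
      also have "\<dots> \<le> (\<Prod>b\<in>Basis. ?h (x \<bullet> b))"
      proof (rule prod_mono_ennreal)
        fix b :: 'a assume b: "b \<in> Basis"
        have le: "\<bar>x \<bullet> b\<bar> \<le> norm x" using b by (rule Basis_le_norm)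
        then have "x \<bullet> b \<in> {-A..A}" using True by auto
        moreover have "norm x powr (- s) \<le> \<bar>x \<bullet> b\<bar> powr (- s)" if "x \<bullet> b \<noteq> 0"
          using that le s by (intro powr_mono2') auto
        ultimately show "ennreal (norm x powr (- s)) \<le> ?h (x \<bullet> b)" by (auto intro: ennreal_leI)
      qed
      finally show ?thesis using True by simp
    qed simp
  qed
  also have "\<dots> = (\<Prod>b\<in>(Basis::'a set). (\<integral>\<^sup>+u. ?h u \<partial>lborel))"
    by (rule nn_integral_lborel_prod) auto
  also have "\<dots> < \<infinity>"
    using nn_integral_abs_powr_finite[OF s(1,2) assms(3)]
    by (simp add: prod_constant power_less_top_ennreal)
  finally show ?thesis .
qed

lemma AE_off_diagonal:
  "AE p in (lborel :: 'a::euclidean_space measure) \<Otimes>\<^sub>M lborel. fst p \<noteq> snd p"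
proof -

  have [measurable]: "Measurable.pred (lborel \<Otimes>\<^sub>M lborel) (\<lambda>p :: 'a \<times> 'a. fst p \<noteq> snd p)"
  proof -
    have "Measurable.pred (lborel \<Otimes>\<^sub>M lborel) (\<lambda>p :: 'a \<times> 'a. norm (fst p - snd p) \<noteq> 0)" by measurable
    then show ?thesis by simp
  qed
  show ?thesis
  proof (rule lborel_pair.AE_pair_measure)
    show "AE x in lborel. AE y in (lborel :: 'a measure). fst (x, y) \<noteq> snd (x, y)"
    proof (rule AE_I2)
      fix x :: 'a
      show "AE y in lborel. fst (x, y) \<noteq> snd (x, y)"
        using AE_lborel_singleton[of x] by eventually_elim auto
    qed
  qed measurable
qed

lemma W_pot_measurable [measurable]: "W_pot \<alpha> c lam \<in> borel_measurable borel"
proof -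
  have [measurable]: "Measurable.pred borel (\<lambda>x :: 'a. x = 0)"
    by (simp add: pred_def)
  show ?thesis unfolding W_pot_def[abs_def] riesz_kernel_def by measurable
qed

context sparse_gaussians begin

lemma W_pot_eq:
  assumes "d = DIM('a::euclidean_space)"
  shows "W_pot \<alpha> c lam (x :: 'a) = (if \<alpha> \<le> real d \<and> x = 0 then \<infinity> else ereal (radial_potential (norm x)))"
  unfolding W_pot_def radial_potential_def gauss_series_def gauss_term_def assms[symmetric] by simp

lemma W_pot_ge:
  assumes "d = DIM('a::euclidean_space)" "norm (x :: 'a) \<le> A"
  shows "ereal (\<theta> * R A + profile A) \<le> W_pot \<alpha> c lam x"
  using radial_potential_ge[of "norm x" A] assms by (auto simp: W_pot_eq)

lemma W_pot_pos_locally_integrable: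
  assumes "d = DIM('a::euclidean_space)"
  shows "(\<integral>\<^sup>+x\<in>ball (0::'a) A. e2ennreal (W_pot \<alpha> c lam x) \<partial>lborel) < \<infinity>"
proof (cases "0 < A")
  case True
  have [measurable]: "ball (0::'a) A \<in> sets borel" by simp
  obtain p K where p: "0 < p" "p < real d" "0 \<le> K" "\<And>r. 0 < r \<Longrightarrow> R r \<le> K * r powr (- p)"
    by (rule riesz_kernel_le_power) blast
  have "(\<integral>\<^sup>+x\<in>ball (0::'a) A. e2ennreal (W_pot \<alpha> c lam x) \<partial>lborel)
    \<le> (\<integral>\<^sup>+x. ennreal K * (ennreal (norm x powr (- p)) * indicator (ball (0::'a) A) x) + ennreal (A\<^sup>2 / 2) * indicator (ball (0::'a) A) x \<partial>lborel)"
  proof (rule nn_integral_mono_AE, use AE_lborel_singleton[of "0::'a"] in eventually_elim)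
    case (elim x)
    show ?case
    proof (cases "x \<in> ball 0 A")
      case True
      have "radial_potential (norm x) \<le> R (norm x) + (norm x)\<^sup>2 / 2" using elim by (intro radial_potential_le) auto
      also have "\<dots> \<le> K * norm x powr (- p) + A\<^sup>2 / 2"
        using p(4)[of "norm x"] elim True by (intro add_mono divide_right_mono power_mono) auto
      finally have "ennreal (radial_potential (norm x)) \<le> ennreal (K * norm x powr (- p) + A\<^sup>2 / 2)" by (rule ennreal_leI)
      also have "\<dots> = ennreal K * ennreal (norm x powr (- p)) + ennreal (A\<^sup>2 / 2)"
        using p(3) by (simp add: ennreal_mult)
      finally show ?thesis using elim True by (simp add: W_pot_eq[OF assms])
    qed simp
  qed
  also have "\<dots> = ennreal K * (\<integral>\<^sup>+x\<in>ball (0::'a) A. ennreal (norm x powr (- p)) \<partial>lborel) + ennreal (A\<^sup>2 / 2) * emeasure lborel (ball (0::'a) A)"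
    by (subst nn_integral_add) (auto simp: nn_integral_cmult)
  also have "\<dots> < \<infinity>"
    using nn_integral_norm_powr_finite[of p A, where 'a='a] p True assms emeasure_lborel_ball_finite[of "0::'a" A]
    by (simp add: ennreal_mult_less_top)
  finally show ?thesis .
next
  case False
  then have e: "ball (0::'a) A = {}" by simp
  show ?thesis unfolding e by simp
qed

lemma local_minimizer_integrable:
  fixes \<rho> :: "'a::euclidean_space measure"
  assumes "d = DIM('a)" and \<rho>: "compact_prob \<rho>" and min: "d_infinity_local_minimizer (W_pot \<alpha> c lam) \<rho>"
  shows "integrable (\<rho> \<Otimes>\<^sub>M \<rho>) (\<lambda>p. real_of_ereal (W_pot \<alpha> c lam (fst p - snd p)))"
    and "AE p in \<rho> \<Otimes>\<^sub>M \<rho>. \<bar>W_pot \<alpha> c lam (fst p - snd p)\<bar> \<noteq> \<infinity>"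
    and "energy (W_pot \<alpha> c lam) \<rho> < \<infinity>"
proof -
  have p: "prob_space \<rho>" and s: "sets \<rho> = sets borel" using \<rho> by (auto simp: compact_prob_def)
  interpret \<rho>: prob_space \<rho> by fact
  show fin: "energy (W_pot \<alpha> c lam) \<rho> < \<infinity>"
    by (rule local_minimizer_energy_finite[OF \<rho> W_pot_measurable W_pot_pos_locally_integrable[OF assms(1)] min])
  obtain A where A: "0 < A" "AE x in \<rho>. norm x \<le> A" using compact_prob_AE_bounded[OF \<rho>] .
  define C where "C = - (\<theta> * R (2 * A) + profile (2 * A))"
  have bd: "AE p in \<rho> \<Otimes>\<^sub>M \<rho>. ereal (- C) \<le> W_pot \<alpha> c lam (fst p - snd p)"
    using AE_fst_pair[OF \<rho>.sigma_finite_measure_axioms p A(2)] AE_snd_pair[OF p \<rho>.sigma_finite_measure_axioms A(2)]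
  proof eventually_elim
    case (elim p)
    have "norm (fst p - snd p) \<le> norm (fst p) + norm (snd p)" by norm
    then have "norm (fst p - snd p) \<le> 2 * A" using elim by linarith
    then show ?case unfolding C_def minus_minus by (rule W_pot_ge[OF assms(1)])
  qed
  show "integrable (\<rho> \<Otimes>\<^sub>M \<rho>) (\<lambda>p. real_of_ereal (W_pot \<alpha> c lam (fst p - snd p)))"
    and "AE p in \<rho> \<Otimes>\<^sub>M \<rho>. \<bar>W_pot \<alpha> c lam (fst p - snd p)\<bar> \<noteq> \<infinity>"
    by (rule energy_finite_imp_integrable[OF p s W_pot_measurable fin bd])+
qed

lemma no_isolated_points:
  fixes \<rho> :: "'a::euclidean_space measure"
  assumes "d = DIM('a)" and \<rho>: "compact_prob \<rho>" and min: "d_infinity_local_minimizer (W_pot \<alpha> c lam) \<rho>"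
  shows "\<not> x0 isolated_in msupport \<rho>"
proof (cases "\<alpha> \<le> real d")
  case True
  show ?thesis
  proof
    assume "x0 isolated_in msupport \<rho>"
    then obtain r where "0 < measure \<rho> {x0}" using isolated_atom[OF \<rho>] by metis
    then have "energy (W_pot \<alpha> c lam) \<rho> = \<infinity>"
      using True by (intro atom_infinite_energy[OF \<rho> W_pot_measurable]) (auto simp: W_pot_eq[OF assms(1)])
    then show False using local_minimizer_integrable(3)[OF assms] by simp
  qed
next
  case False
  then have da: "real d < \<alpha>" by simp
  let ?Z = "\<lambda>z :: 'a. radial_potential (norm z)"
  have W: "W_pot \<alpha> c lam z = ereal (?Z z)" for z :: 'a using da by (simp add: W_pot_eq[OF assms(1)])
  have "?Z = (\<lambda>z. real_of_ereal (W_pot \<alpha> c lam z))" by (simp add: W)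
  then have [measurable]: "?Z \<in> borel_measurable borel" by simp
  show ?thesis
  proof (rule local_minimizer_no_isolated_point[OF \<rho> min W])
    fix A :: real
    show "\<exists>B. \<forall>z :: 'a. norm z \<le> A \<longrightarrow> \<bar>?Z z\<bar> \<le> B"
    proof (intro exI allI impI)
      fix z :: 'a assume z: "norm z \<le> A"
      have A: "0 \<le> A" using z norm_ge_zero order_trans by blast
      have "\<theta> * R A + profile A \<le> ?Z z" using radial_potential_ge[of "norm z" A] z da by simp
      moreover have "?Z z \<le> 0 + A\<^sup>2 / 2"
      proof -
        have "?Z z \<le> R (norm z) + (norm z)\<^sup>2 / 2" using da by (intro radial_potential_le) auto
        also have "\<dots> \<le> 0 + A\<^sup>2 / 2"
          using riesz_antimono[of 0 "norm z"] da z by (intro add_mono divide_right_mono power_mono) (auto simp: riesz_kernel_def)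
        finally show ?thesis .
      qed
      ultimately show "\<bar>?Z z\<bar> \<le> max (- (\<theta> * R A + profile A)) (A\<^sup>2 / 2)" by linarith
    qed
  next
    fix r A :: real assume "0 < r"
    then show "\<exists>C. \<forall>z v :: 'a. r \<le> norm z \<and> norm z \<le> A \<longrightarrow> ?Z (z + v) + ?Z (z - v) - 2 * ?Z z \<le> C * (norm v)\<^sup>2"
      using semiconcave[OF da, of r] by blast
  next
    show "?Z v - ?Z 0 \<le> (norm v)\<^sup>2 / 2 - (- \<theta> * riesz_const d \<alpha>) * norm v powr (\<alpha> - real d)" for v :: 'a
      using cusp[OF da, of "norm v"] by simp
    show "0 < - \<theta> * riesz_const d \<alpha>" using riesz_const_neg[OF da] \<theta> by (simp add: mult_pos_neg)
    show "\<alpha> - real d < 2" using \<alpha> by simp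
  qed measurable
qed

end

lemma ac_superlevel_lower_bound:
  fixes \<rho> :: "'a::euclidean_space measure"
  assumes "ac_part_representative \<rho> f" "A \<in> sets borel" "A \<subseteq> {x. \<epsilon>\<^sub>0 \<le> f x}"
  shows "ennreal \<epsilon>\<^sub>0 * emeasure lborel A \<le> emeasure \<rho> A"
proof -
  have "ennreal \<epsilon>\<^sub>0 * emeasure lborel A = (\<integral>\<^sup>+ x. ennreal \<epsilon>\<^sub>0 * indicator A x \<partial>lebesgue)"
  proof -
    have "A \<in> sets lebesgue" using assms(2) by (simp add: sets_completionI_sets)
    then show ?thesis using assms(2) by (simp add: nn_integral_cmult_indicator)
  qed
  also have "\<dots> \<le> (\<integral>\<^sup>+ x\<in>A. ennreal (f x) \<partial>lebesgue)"
    using assms(3) by (intro nn_integral_mono) (auto split: split_indicator intro!: ennreal_leI)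
  also have "\<dots> \<le> emeasure \<rho> A"
    using assms(1,2) unfolding ac_part_representative_def by (metis le_iff_add)
  finally show ?thesis .
qed

context sparse_gaussians begin

text \<open>
  The hypothesis \<open>test\<close> asks for negative directions of the quadratic form at every location
  and scale with a common bound \<open>C\<close>.
\<close>

lemma superlevel_interior_empty:
  fixes \<rho> :: "'a::euclidean_space measure"
  assumes "d = DIM('a)" and \<rho>: "compact_prob \<rho>" and min: "d_infinity_local_minimizer (W_pot \<alpha> c lam) \<rho>"
    and f: "ac_part_representative \<rho> f" and "0 < \<epsilon>\<^sub>0"
    and test: "\<And>r x0 :: 'a. 0 < r \<Longrightarrow> \<exists>\<mu>. \<mu> \<in> borel_measurable borel \<and> (\<forall>x. \<bar>\<mu> x\<bar> \<le> C \<and> (x \<notin> ball x0 r \<longrightarrow> \<mu> x = 0)) \<and>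
      (\<integral>x. \<mu> x \<partial>lborel) = 0 \<and> (\<integral>p. radial_potential (norm (fst p - snd p)) * (\<mu> (fst p) * \<mu> (snd p)) \<partial>(lborel \<Otimes>\<^sub>M lborel)) < 0"
  shows "interior {x. \<epsilon>\<^sub>0 \<le> f x} = {}"
proof (rule ccontr)
  assume "interior {x. \<epsilon>\<^sub>0 \<le> f x} \<noteq> {}"
  then obtain x0 r where r: "0 < r" "ball x0 r \<subseteq> {x. \<epsilon>\<^sub>0 \<le> f x}"
    by (metis ex_in_conv mem_interior)
  let ?W = "W_pot \<alpha> c lam :: 'a \<Rightarrow> ereal"
  obtain r0 where r0: "0 < r0" "\<And>\<mu>. \<mu> \<in> borel_measurable borel \<Longrightarrow> (\<And>x. \<bar>\<mu> x\<bar> \<le> C \<and> (x \<notin> ball x0 r0 \<longrightarrow> \<mu> x = 0))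
      \<Longrightarrow> (\<integral>x. \<mu> x \<partial>lborel) = 0
      \<Longrightarrow> 0 \<le> (\<integral>p. real_of_ereal (?W (fst p - snd p)) * (\<mu> (fst p) * \<mu> (snd p)) \<partial>(lborel \<Otimes>\<^sub>M lborel))"
  proof (rule local_minimizer_pairing_nonneg[OF \<rho> W_pot_measurable local_minimizer_integrable(1,2)[OF assms(1) \<rho> min] min r(1) \<open>0 < \<epsilon>\<^sub>0\<close>])
    fix A :: "'a set" assume "A \<in> sets borel" "A \<subseteq> ball x0 r"
    then show "ennreal \<epsilon>\<^sub>0 * emeasure lborel A \<le> emeasure \<rho> A"
      using r(2) by (intro ac_superlevel_lower_bound[OF f]) auto
  qed blast
  obtain \<mu> where \<mu>[measurable]: "\<mu> \<in> borel_measurable borel" and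
    *: "\<And>x. \<bar>\<mu> x\<bar> \<le> C \<and> (x \<notin> ball x0 r0 \<longrightarrow> \<mu> x = 0)" "(\<integral>x. \<mu> x \<partial>lborel) = 0"
      "(\<integral>p. radial_potential (norm (fst p - snd p)) * (\<mu> (fst p) * \<mu> (snd p)) \<partial>(lborel \<Otimes>\<^sub>M lborel)) < 0"
    using test[OF r0(1), of x0] by blast
  have ae: "AE p in (lborel :: 'a measure) \<Otimes>\<^sub>M lborel. real_of_ereal (?W (fst p - snd p)) = radial_potential (norm (fst p - snd p))"
    using AE_off_diagonal by eventually_elim (auto simp: W_pot_eq[OF assms(1)])
  have [measurable]: "(\<lambda>z :: 'a. radial_potential (norm z)) \<in> borel_measurable borel"
    unfolding radial_potential_def riesz_kernel_def gauss_series_def gauss_term_def by measurable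
  have "0 \<le> (\<integral>p. real_of_ereal (?W (fst p - snd p)) * (\<mu> (fst p) * \<mu> (snd p)) \<partial>(lborel \<Otimes>\<^sub>M lborel))"
    by (rule r0(2)[OF \<mu> *(1,2)])
  also have "\<dots> = (\<integral>p. radial_potential (norm (fst p - snd p)) * (\<mu> (fst p) * \<mu> (snd p)) \<partial>(lborel \<Otimes>\<^sub>M lborel))"
    by (rule integral_cong_AE) (use ae in auto)
  finally show False using *(3) by simp
qed

end

section \<open>Quadratic forms of kernels and the one-dimensional Fourier transform\<close>

text \<open>
  Sharp cut-offs are included: the wave packets below are differences of truncated cosines.
\<close>

definition test_function :: "('a::euclidean_space \<Rightarrow> real) \<Rightarrow> bool" where
  "test_function f \<longleftrightarrow> f \<in> borel_measurable borel \<and> (\<exists>C A. \<forall>x. \<bar>f x\<bar> \<le> C \<and> (A < norm x \<longrightarrow> f x = 0))"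

text \<open>
  The quadratic form of the kernel \<open>K\<close>, twice the interaction energy of the signed density \<open>f\<close>.
\<close>

definition pairing :: "('a::euclidean_space \<Rightarrow> real) \<Rightarrow> ('a \<Rightarrow> real) \<Rightarrow> real" where
  "pairing K f = (\<integral>p. K (fst p - snd p) * (f (fst p) * f (snd p)) \<partial>(lborel \<Otimes>\<^sub>M lborel))"

definition locally_integrable :: "('a::euclidean_space \<Rightarrow> real) \<Rightarrow> bool" where
  "locally_integrable K \<longleftrightarrow> K \<in> borel_measurable borel \<and> (\<forall>A. (\<integral>\<^sup>+x\<in>ball 0 A. ennreal \<bar>K x\<bar> \<partial>lborel) < \<infinity>)"

lemma test_functionE:
  assumes "test_function (f :: 'a::euclidean_space \<Rightarrow> real)"
  obtains C A where "f \<in> borel_measurable borel" "0 < C" "0 < A" "\<And>x. \<bar>f x\<bar> \<le> C" "\<And>x. A \<le> norm x \<Longrightarrow> f x = 0"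
proof -
  obtain C A where *: "f \<in> borel_measurable borel" "\<And>x. \<bar>f x\<bar> \<le> C \<and> (A < norm x \<longrightarrow> f x = 0)"
    using assms by (auto simp: test_function_def)
  have "\<bar>f x\<bar> \<le> \<bar>C\<bar> + 1" for x using *(2)[of x] by linarith
  moreover have "f x = 0" if "\<bar>A\<bar> + 1 \<le> norm x" for x using *(2)[of x] that by (auto intro: order.strict_trans2)
  ultimately show ?thesis using *(1) by (intro that[of "\<bar>C\<bar> + 1" "\<bar>A\<bar> + 1"]) auto
qed

lemma test_function_measurable [measurable_dest]: "test_function f \<Longrightarrow> f \<in> borel_measurable borel"
  by (simp add: test_function_def)

lemma integrable_mult_test_function:
  fixes f :: "'a::euclidean_space \<Rightarrow> real"
  assumes f: "test_function f" and g[measurable]: "g \<in> borel_measurable borel" and B: "\<And>x. \<bar>g x\<bar> \<le> B"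
  shows "integrable lborel (\<lambda>x. g x * f x)"
proof -
  obtain C A where [measurable]: "f \<in> borel_measurable borel" and C: "0 < C" "0 < A" "\<And>x. \<bar>f x\<bar> \<le> C" "\<And>x. A \<le> norm x \<Longrightarrow> f x = 0"
    using test_functionE[OF f] by metis
  show ?thesis
  proof (rule Bochner_Integration.integrable_bound[of _ "\<lambda>x. (B * C) * indicator (cball 0 A) x"])
    show "integrable lborel (\<lambda>x::'a. (B * C) * indicator (cball 0 A) x)"
      using emeasure_lborel_cball_finite[of "0::'a" A] by (intro integrable_mult_right integrable_real_indicator) auto
    have "\<bar>g x\<bar> * \<bar>f x\<bar> \<le> \<bar>B * C * indicator (cball 0 A) x\<bar>" for x
    proof (cases "norm x \<le> A")
      case True
      have "\<bar>g x\<bar> * \<bar>f x\<bar> \<le> B * C" using B[of x] C(3)[of x] by (intro mult_mono) auto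
      then show ?thesis using True by simp
    next
      case False then show ?thesis using C(4)[of x] by simp
    qed
    then show "AE x in lborel. norm (g x * f x) \<le> norm (B * C * indicator (cball 0 A) x)" by (simp add: abs_mult)
  qed measurable
qed

lemma integrable_test_function: "test_function f \<Longrightarrow> integrable lborel f"
  using integrable_mult_test_function[of f "\<lambda>_. 1" 1] by simp

lemma integrable_test_function_abs: "test_function f \<Longrightarrow> integrable lborel (\<lambda>x. \<bar>f x\<bar>)"
  using integrable_test_function by (rule integrable_abs)

lemma integrable_lborel_pair_mult:
  fixes f :: "'a::euclidean_space \<Rightarrow> real" and g :: "'b::euclidean_space \<Rightarrow> real"
  assumes f: "integrable lborel f" and g: "integrable lborel g"
  shows "integrable (lborel \<Otimes>\<^sub>M lborel) (\<lambda>p. f (fst p) * g (snd p))"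
    and "(\<integral>p. f (fst p) * g (snd p) \<partial>(lborel \<Otimes>\<^sub>M lborel)) = (\<integral>x. f x \<partial>lborel) * (\<integral>y. g y \<partial>lborel)"
proof -
  have [measurable]: "f \<in> borel_measurable borel" "g \<in> borel_measurable borel" using f g by auto
  show 1: "integrable (lborel \<Otimes>\<^sub>M lborel) (\<lambda>p. f (fst p) * g (snd p))"
  proof (rule lborel_pair.Fubini_integrable)
    have "(\<lambda>x. \<integral>y. norm (f (fst (x, y)) * g (snd (x, y))) \<partial>lborel) = (\<lambda>x. \<bar>f x\<bar> * (\<integral>y. \<bar>g y\<bar> \<partial>lborel))"
      by (simp add: abs_mult)
    then show "integrable lborel (\<lambda>x. \<integral>y. norm (f (fst (x, y)) * g (snd (x, y))) \<partial>lborel)"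
      using f by simp
    show "AE x in lborel. integrable lborel (\<lambda>y. f (fst (x, y)) * g (snd (x, y)))"
      using g by simp
  qed measurable
  show "(\<integral>p. f (fst p) * g (snd p) \<partial>(lborel \<Otimes>\<^sub>M lborel)) = (\<integral>x. f x \<partial>lborel) * (\<integral>y. g y \<partial>lborel)"
    using lborel_pair.integral_fst'[OF 1] by simp
qed

lemma pairing_integrable:
  fixes K :: "'a::euclidean_space \<Rightarrow> real"
  assumes K: "locally_integrable K" and f: "test_function f"
  shows "integrable (lborel \<Otimes>\<^sub>M lborel) (\<lambda>p. K (fst p - snd p) * (f (fst p) * f (snd p)))"
proof -
  obtain C A where [measurable]: "f \<in> borel_measurable borel" and C: "0 < C" "0 < A" "\<And>x. \<bar>f x\<bar> \<le> C" "\<And>x. A \<le> norm x \<Longrightarrow> f x = 0"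
    using test_functionE[OF f] by metis
  have [measurable]: "K \<in> borel_measurable borel" and Kfin: "\<And>A. (\<integral>\<^sup>+x\<in>ball 0 A. ennreal \<bar>K x\<bar> \<partial>lborel) < \<infinity>"
    using K by (auto simp: locally_integrable_def)
  have [measurable]: "ball (0::'a) (2 * A) \<in> sets borel" "ball (0::'a) A \<in> sets borel" by simp_all
  let ?I = "(\<integral>\<^sup>+x\<in>ball 0 (2 * A). ennreal \<bar>K x\<bar> \<partial>lborel)"
  have "(\<integral>\<^sup>+p. ennreal (norm (K (fst p - snd p) * (f (fst p) * f (snd p)))) \<partial>(lborel \<Otimes>\<^sub>M lborel))
     = (\<integral>\<^sup>+y. (\<integral>\<^sup>+x. ennreal (norm (K (x - y) * (f x * f y))) \<partial>lborel) \<partial>lborel)"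
    by (subst lborel_pair.nn_integral_snd[symmetric]) auto
  also have "\<dots> \<le> (\<integral>\<^sup>+y. ennreal (C\<^sup>2) * ?I * indicator (ball (0::'a) A) y \<partial>lborel)"
  proof (rule nn_integral_mono)
    fix y :: 'a
    show "(\<integral>\<^sup>+x. ennreal (norm (K (x - y) * (f x * f y))) \<partial>lborel) \<le> ennreal (C\<^sup>2) * ?I * indicator (ball 0 A) y"
    proof (cases "norm y < A")
      case True
      have "(\<integral>\<^sup>+x. ennreal (norm (K (x - y) * (f x * f y))) \<partial>lborel)
          \<le> (\<integral>\<^sup>+x. ennreal (C\<^sup>2) * (ennreal \<bar>K (x - y)\<bar> * indicator (ball 0 (2 * A)) (x - y)) \<partial>lborel)"
      proof (rule nn_integral_mono)
        fix x :: 'a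
        show "ennreal (norm (K (x - y) * (f x * f y))) \<le> ennreal (C\<^sup>2) * (ennreal \<bar>K (x - y)\<bar> * indicator (ball 0 (2 * A)) (x - y))"
        proof (cases "norm x < A")
          case True
          have "norm (x - y) \<le> norm x + norm y" by norm
          then have "x - y \<in> ball 0 (2 * A)" using True \<open>norm y < A\<close> by simp
          moreover have "\<bar>f x\<bar> * \<bar>f y\<bar> \<le> C * C" using C by (intro mult_mono) (auto intro: less_imp_le)
          then have "\<bar>K (x - y)\<bar> * (\<bar>f x\<bar> * \<bar>f y\<bar>) \<le> C\<^sup>2 * \<bar>K (x - y)\<bar>"
            by (subst mult.commute, intro mult_right_mono) (auto simp: power2_eq_square)
          ultimately show ?thesis by (simp add: abs_mult ennreal_leI flip: ennreal_mult)
        next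
          case False then show ?thesis using C(4)[of x] by simp
        qed
      qed
      also have "\<dots> = ennreal (C\<^sup>2) * (\<integral>\<^sup>+x. ennreal \<bar>K (x - y)\<bar> * indicator (ball 0 (2 * A)) (x - y) \<partial>lborel)"
        by (rule nn_integral_cmult) measurable
      also have "(\<integral>\<^sup>+x. ennreal \<bar>K (x - y)\<bar> * indicator (ball 0 (2 * A)) (x - y) \<partial>lborel) = ?I"
      proof -
        have eq: "(lborel :: 'a measure) = distr lborel borel (\<lambda>x. - y + x)" by (rule lborel_distr_plus[symmetric])
        show ?thesis by (subst (2) eq, subst nn_integral_distr) auto
      qed
      finally show ?thesis using True by simp
    next
      case False then show ?thesis using C(4)[of y] by simp
    qed
  qed
  also have "\<dots> = ennreal (C\<^sup>2) * ?I * emeasure lborel (ball (0::'a) A)"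
    by (rule nn_integral_cmult_indicator) simp
  also have "\<dots> < \<infinity>" using Kfin[of "2 * A"] emeasure_lborel_ball_finite[of "0::'a" A]
    by (auto simp: ennreal_mult_less_top)
  finally show ?thesis by (intro integrableI_bounded) auto
qed

lemma locally_integrable_bounded:
  fixes K :: "'a::euclidean_space \<Rightarrow> real"
  assumes [measurable]: "K \<in> borel_measurable borel" and B: "\<And>x A. norm x < A \<Longrightarrow> \<bar>K x\<bar> \<le> B A"
  shows "locally_integrable K"
  unfolding locally_integrable_def
proof (intro conjI allI)
  fix A
  have "(\<integral>\<^sup>+x\<in>ball 0 A. ennreal \<bar>K x\<bar> \<partial>lborel) \<le> (\<integral>\<^sup>+x. ennreal (B A) * indicator (ball (0::'a) A) x \<partial>lborel)"
    by (intro nn_integral_mono) (auto split: split_indicator intro!: ennreal_leI B)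
  also have "\<dots> = ennreal (B A) * emeasure lborel (ball (0::'a) A)" by (rule nn_integral_cmult_indicator) simp
  also have "\<dots> < \<infinity>" using emeasure_lborel_ball_finite[of "0::'a" A] by (auto simp: ennreal_mult_less_top)
  finally show "(\<integral>\<^sup>+x\<in>ball 0 A. ennreal \<bar>K x\<bar> \<partial>lborel) < \<infinity>" .
qed fact

text \<open>
  The one-dimensional heat kernel. It is kept apart from the kernel on a Euclidean space below,
  which factors into copies of it.
\<close>

definition heat :: "real \<Rightarrow> real \<Rightarrow> real" where
  "heat t u = exp (- (u\<^sup>2 / (4 * t))) / sqrt (4 * pi * t)"

definition cos_transform :: "(real \<Rightarrow> real) \<Rightarrow> real \<Rightarrow> real" where
  "cos_transform f \<eta> = (\<integral>x. cos (\<eta> * x) * f x \<partial>lborel)"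

definition sin_transform :: "(real \<Rightarrow> real) \<Rightarrow> real \<Rightarrow> real" where
  "sin_transform f \<eta> = (\<integral>x. sin (\<eta> * x) * f x \<partial>lborel)"

text \<open>
  The squared modulus of the Fourier transform.
\<close>

definition spectrum :: "(real \<Rightarrow> real) \<Rightarrow> real \<Rightarrow> real" where
  "spectrum f \<eta> = (cos_transform f \<eta>)\<^sup>2 + (sin_transform f \<eta>)\<^sup>2"

text \<open>
  A rescaling of the characteristic function of the standard normal distribution.
\<close>

lemma gaussian_cos_integral:
  assumes "0 < t"
  shows "integrable lborel (\<lambda>\<eta>. exp (- (t * \<eta>\<^sup>2)))"
    and "(\<integral>\<eta>. exp (- (t * \<eta>\<^sup>2)) * cos (u * \<eta>) \<partial>lborel) = 2 * pi * heat t u"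
proof -
  have 1: "(\<integral>x. std_normal_density x * cos (s * x) \<partial>lborel) = exp (- s\<^sup>2 / 2)" for s
  proof -
    interpret real_distribution std_normal_distribution by (rule real_dist_normal_dist)
    have "char std_normal_distribution s = (CLINT x|std_normal_distribution. iexp (s * x))" by (simp add: char_def)
    then have "complex_of_real (exp (- s\<^sup>2 / 2)) = (CLINT x|std_normal_distribution. iexp (s * x))"
      by (simp add: char_std_normal_distribution)
    then have "exp (- s\<^sup>2 / 2) = Re (CLINT x|std_normal_distribution. iexp (s * x))" by (metis Re_complex_of_real)
    also have "\<dots> = (LINT x|std_normal_distribution. Re (iexp (s * x)))"
      by (rule integral_Re[symmetric]) (rule integrable_iexp, auto)
    also have "\<dots> = (LINT x|std_normal_distribution. cos (s * x))" by (simp add: Re_exp)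
    also have "\<dots> = (\<integral>x. std_normal_density x * cos (s * x) \<partial>lborel)"
      by (subst integral_density) auto
    finally show ?thesis by simp
  qed
  define k where "k = sqrt (2 * t)"
  have k: "0 < k" "k\<^sup>2 = 2 * t" using assms by (auto simp: k_def)
  have dens: "std_normal_density (0 + k * x) = exp (- (t * x\<^sup>2)) / sqrt (2 * pi)" for x
    using k by (simp add: std_normal_density_def power_mult_distrib)
  have "integrable lborel (\<lambda>x. std_normal_density (0 + k * x))"
    using k by (subst lborel_integrable_real_affine_iff) (auto intro: integrable_normal_density)
  then have "integrable lborel (\<lambda>x. sqrt (2 * pi) * (exp (- (t * x\<^sup>2)) / sqrt (2 * pi)))" unfolding dens by (rule integrable_mult_right)
  then show "integrable lborel (\<lambda>\<eta>. exp (- (t * \<eta>\<^sup>2)))" by simp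
  have "exp (- (u / k)\<^sup>2 / 2) = \<bar>k\<bar> *\<^sub>R (\<integral>x. std_normal_density (0 + k * x) * cos ((u / k) * (0 + k * x)) \<partial>lborel)"
    unfolding 1[symmetric] using k by (intro lborel_integral_real_affine) auto
  also have "\<dots> = k * (\<integral>x. (exp (- (t * x\<^sup>2)) * cos (u * x)) / sqrt (2 * pi) \<partial>lborel)"
    unfolding dens using k by simp
  also have "\<dots> = k * (\<integral>x. exp (- (t * x\<^sup>2)) * cos (u * x) \<partial>lborel) / sqrt (2 * pi)" by simp
  finally have 2: "exp (- (u / k)\<^sup>2 / 2) = k * (\<integral>x. exp (- (t * x\<^sup>2)) * cos (u * x) \<partial>lborel) / sqrt (2 * pi)" .
  have e: "exp (- (u / k)\<^sup>2 / 2) = heat t u * sqrt (4 * pi * t)"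
    using assms k by (simp add: heat_def power_divide)
  have s: "sqrt (4 * pi * t) = k * sqrt (2 * pi)" unfolding k_def real_sqrt_mult[symmetric] by (simp add: mult_ac)
  have "(\<integral>x. exp (- (t * x\<^sup>2)) * cos (u * x) \<partial>lborel) = heat t u * (sqrt (2 * pi) * sqrt (2 * pi))"
    using 2 k unfolding e s by (simp add: field_simps)
  then show "(\<integral>\<eta>. exp (- (t * \<eta>\<^sup>2)) * cos (u * \<eta>) \<partial>lborel) = 2 * pi * heat t u" by simp
qed

lemma transform_measurable [measurable]:
  assumes [measurable]: "f \<in> borel_measurable borel"
  shows "cos_transform f \<in> borel_measurable borel" "sin_transform f \<in> borel_measurable borel" "spectrum f \<in> borel_measurable borel"
  unfolding spectrum_def[abs_def] cos_transform_def[abs_def] sin_transform_def[abs_def] by measurable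

lemma spectrum_nonneg: "0 \<le> spectrum f \<eta>" by (simp add: spectrum_def)

lemma spectrum_eq_pairing:
  assumes f: "test_function f"
  shows "(\<integral>p. cos ((fst p - snd p) * \<eta>) * (f (fst p) * f (snd p)) \<partial>(lborel \<Otimes>\<^sub>M lborel)) = spectrum f \<eta>"
proof -
  have ic: "integrable lborel (\<lambda>x. cos (\<eta> * x) * f x)" and isn: "integrable lborel (\<lambda>x. sin (\<eta> * x) * f x)"
    by (rule integrable_mult_test_function[OF f, of _ 1]; simp)+
  have "(\<integral>p. cos ((fst p - snd p) * \<eta>) * (f (fst p) * f (snd p)) \<partial>(lborel \<Otimes>\<^sub>M lborel))
    = (\<integral>p. (cos (\<eta> * fst p) * f (fst p)) * (cos (\<eta> * snd p) * f (snd p)) + (sin (\<eta> * fst p) * f (fst p)) * (sin (\<eta> * snd p) * f (snd p)) \<partial>(lborel \<Otimes>\<^sub>M lborel))"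
    by (intro Bochner_Integration.integral_cong) (auto simp: left_diff_distrib cos_diff algebra_simps)
  also have "\<dots> = (cos_transform f \<eta>)\<^sup>2 + (sin_transform f \<eta>)\<^sup>2"
    unfolding cos_transform_def sin_transform_def power2_eq_square
      integrable_lborel_pair_mult(2)[OF ic ic, symmetric] integrable_lborel_pair_mult(2)[OF isn isn, symmetric]
    by (intro Bochner_Integration.integral_add integrable_lborel_pair_mult ic isn)
  finally show ?thesis by (simp add: spectrum_def)
qed

text \<open>
  Parseval for the heat kernel: insert its representation as a cosine integral and exchange the
  order of integration.
\<close>

lemma pairing_heat_eq_spectrum:
  assumes f: "test_function f" and t: "0 < t"
  shows "pairing (heat t) f = 1 / (2 * pi) * (\<integral>\<eta>. exp (- (t * \<eta>\<^sup>2)) * spectrum f \<eta> \<partial>lborel)"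
    and "integrable lborel (\<lambda>\<eta>. exp (- (t * \<eta>\<^sup>2)) * spectrum f \<eta>)"
proof -
  interpret L2: sigma_finite_measure "(lborel :: real measure) \<Otimes>\<^sub>M (lborel :: real measure)"
    unfolding lborel_prod by (rule sigma_finite_lborel)
  interpret P3: pair_sigma_finite "(lborel :: real measure) \<Otimes>\<^sub>M (lborel :: real measure)" "lborel :: real measure" ..
  have [measurable]: "f \<in> borel_measurable borel" using f by (rule test_function_measurable)
  let ?F = "\<lambda>q :: (real \<times> real) \<times> real. exp (- (t * (snd q)\<^sup>2)) * (cos ((fst (fst q) - snd (fst q)) * snd q) * (f (fst (fst q)) * f (snd (fst q))))"
  have i2: "integrable (lborel \<Otimes>\<^sub>M lborel) (\<lambda>p. \<bar>f (fst p)\<bar> * \<bar>f (snd p)\<bar>)"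
    using integrable_lborel_pair_mult(1)[OF integrable_test_function_abs[OF f] integrable_test_function_abs[OF f]] .
  then have i3: "integrable ((lborel \<Otimes>\<^sub>M lborel) \<Otimes>\<^sub>M lborel) (\<lambda>q. (\<bar>f (fst (fst q))\<bar> * \<bar>f (snd (fst q))\<bar>) * exp (- (t * (snd q)\<^sup>2)))"
    using integrable_lborel_pair_mult(1)[of "\<lambda>p. \<bar>f (fst p)\<bar> * \<bar>f (snd p)\<bar>" "\<lambda>\<eta>. exp (- (t * \<eta>\<^sup>2))"] gaussian_cos_integral(1)[OF t]
    by (simp add: lborel_prod)
  have iF: "integrable ((lborel \<Otimes>\<^sub>M lborel) \<Otimes>\<^sub>M lborel) ?F"
  proof (rule Bochner_Integration.integrable_bound[OF i3])
    show "AE q in (lborel \<Otimes>\<^sub>M lborel) \<Otimes>\<^sub>M lborel. norm (?F q) \<le> norm ((\<bar>f (fst (fst q))\<bar> * \<bar>f (snd (fst q))\<bar>) * exp (- (t * (snd q)\<^sup>2)))"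
    proof (rule AE_I2)
      fix q :: "(real \<times> real) \<times> real"
      have "\<bar>cos ((fst (fst q) - snd (fst q)) * snd q)\<bar> * (\<bar>f (fst (fst q))\<bar> * \<bar>f (snd (fst q))\<bar>) \<le> 1 * (\<bar>f (fst (fst q))\<bar> * \<bar>f (snd (fst q))\<bar>)"
        by (intro mult_right_mono) auto
      then show "norm (?F q) \<le> norm ((\<bar>f (fst (fst q))\<bar> * \<bar>f (snd (fst q))\<bar>) * exp (- (t * (snd q)\<^sup>2)))"
        by (simp add: abs_mult mult.commute mult_right_mono)
    qed
  qed measurable
  have "(\<integral>\<eta>. (\<integral>p. ?F (p, \<eta>) \<partial>(lborel \<Otimes>\<^sub>M lborel)) \<partial>lborel) = (\<integral>p. (\<integral>\<eta>. ?F (p, \<eta>) \<partial>lborel) \<partial>(lborel \<Otimes>\<^sub>M lborel))"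
    using P3.Fubini_integral[of "\<lambda>p \<eta>. ?F (p, \<eta>)"] iF by (simp add: split_beta')
  moreover have "(\<integral>p. ?F (p, \<eta>) \<partial>(lborel \<Otimes>\<^sub>M lborel)) = exp (- (t * \<eta>\<^sup>2)) * spectrum f \<eta>" for \<eta>
    using spectrum_eq_pairing[OF f, of \<eta>] by simp
  moreover have "(\<integral>\<eta>. ?F (p, \<eta>) \<partial>lborel) = 2 * pi * (heat t (fst p - snd p) * (f (fst p) * f (snd p)))" for p
    using gaussian_cos_integral(2)[OF t, of "fst p - snd p"] by (simp add: mult.assoc[symmetric])
  ultimately show "pairing (heat t) f = 1 / (2 * pi) * (\<integral>\<eta>. exp (- (t * \<eta>\<^sup>2)) * spectrum f \<eta> \<partial>lborel)"
    unfolding pairing_def by simp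
  have "integrable lborel (\<lambda>\<eta>. \<integral>p. ?F (p, \<eta>) \<partial>(lborel \<Otimes>\<^sub>M lborel))"
    using P3.integrable_snd[of "\<lambda>p \<eta>. ?F (p, \<eta>)"] iF by (simp add: split_beta')
  then show "integrable lborel (\<lambda>\<eta>. exp (- (t * \<eta>\<^sup>2)) * spectrum f \<eta>)"
    using spectrum_eq_pairing[OF f] by simp
qed

lemma pairing_heat_nonneg: "test_function f \<Longrightarrow> 0 < t \<Longrightarrow> 0 \<le> pairing (heat t) f"
  by (simp add: pairing_heat_eq_spectrum(1) spectrum_nonneg)

definition cdiff :: "real \<Rightarrow> (real \<Rightarrow> real) \<Rightarrow> real \<Rightarrow> real" where
  "cdiff h f x = f (x + h) - f (x - h)"

lemma test_function_cdiff:
  assumes "test_function f"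
  shows "test_function (cdiff h f)"
proof -
  obtain C A where [measurable]: "f \<in> borel_measurable borel" and C: "0 < C" "0 < A" "\<And>x. \<bar>f x\<bar> \<le> C" "\<And>x. A \<le> norm x \<Longrightarrow> f x = 0"
    using test_functionE[OF assms] by metis
  have "\<bar>cdiff h f x\<bar> \<le> 2 * C" for x unfolding cdiff_def using C(3)[of "x + h"] C(3)[of "x - h"] by linarith
  moreover have "cdiff h f x = 0" if "A + \<bar>h\<bar> < norm x" for x
    unfolding cdiff_def using that by (subst (1 2) C(4)) auto
  moreover have "cdiff h f \<in> borel_measurable borel" unfolding cdiff_def[abs_def] by measurable
  ultimately show ?thesis unfolding test_function_def by blast
qed

text \<open>
  Differences are used in place of derivatives because they preserve test functions. Iterated
  \<open>n\<close> times they produce a zero of order \<open>2 n\<close> of the spectrum at the origin, which tames the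
  singular weight \<open>\<bar>\<eta>\<bar> powr (- \<alpha>)\<close>.
\<close>

lemma spectrum_cdiff:
  assumes f: "test_function f"
  shows "spectrum (cdiff h f) \<eta> = (2 * sin (h * \<eta>))\<^sup>2 * spectrum f \<eta>"
proof -
  have [measurable]: "f \<in> borel_measurable borel" using f by (rule test_function_measurable)
  have ic: "integrable lborel (\<lambda>x. cos (\<eta> * x) * f x)" and isn: "integrable lborel (\<lambda>x. sin (\<eta> * x) * f x)"
    by (rule integrable_mult_test_function[OF f, of _ 1]; simp)+
  have sh: "(\<integral>x. g x * f (x + a) \<partial>lborel) = (\<integral>x. g (x - a) * f x \<partial>lborel)" for g a
    using lborel_integral_real_affine[of 1 "\<lambda>x. g (x - a) * f x" a] by (simp add: add.commute)
  have shi: "integrable lborel (\<lambda>x. g x * f (x + a))" if "g \<in> borel_measurable borel" "\<And>x. \<bar>g x\<bar> \<le> 1" for g a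
  proof -
    have "integrable lborel (\<lambda>x. g (x - a) * f x)" using that by (intro integrable_mult_test_function[OF f, of _ 1]) auto
    from lborel_integrable_real_affine[OF this, of 1 a] show ?thesis by (simp add: add.commute)
  qed
  have split: "(\<integral>x. g x * cdiff h f x \<partial>lborel) = (\<integral>x. (g (x - h) - g (x + h)) * f x \<partial>lborel)"
    if g[measurable]: "g \<in> borel_measurable borel" and g1: "\<And>x. \<bar>g x\<bar> \<le> 1" for g
  proof -
    have "(\<integral>x. g x * cdiff h f x \<partial>lborel) = (\<integral>x. g x * f (x + h) - g x * f (x + - h) \<partial>lborel)"
      by (simp add: cdiff_def right_diff_distrib)
    also have "\<dots> = (\<integral>x. g (x - h) * f x \<partial>lborel) - (\<integral>x. g (x + h) * f x \<partial>lborel)"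
      using shi[OF that] shi[OF that, of "- h"] sh[of g h] sh[of g "- h"] by (subst Bochner_Integration.integral_diff) auto
    also have "\<dots> = (\<integral>x. (g (x - h) - g (x + h)) * f x \<partial>lborel)"
      unfolding left_diff_distrib
      by (intro Bochner_Integration.integral_diff[symmetric] integrable_mult_test_function[OF f, of _ 1]) (auto simp: g1)
    finally show ?thesis .
  qed
  have "cos_transform (cdiff h f) \<eta> = (\<integral>x. 2 * sin (h * \<eta>) * (sin (\<eta> * x) * f x) \<partial>lborel)"
    unfolding cos_transform_def by (subst split) (auto simp: right_diff_distrib distrib_left cos_diff cos_add mult_ac)
  also have "\<dots> = 2 * sin (h * \<eta>) * sin_transform f \<eta>" unfolding sin_transform_def by (rule integral_mult_right_zero)
  finally have 1: "cos_transform (cdiff h f) \<eta> = 2 * sin (h * \<eta>) * sin_transform f \<eta>" .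
  have "sin_transform (cdiff h f) \<eta> = (\<integral>x. - 2 * sin (h * \<eta>) * (cos (\<eta> * x) * f x) \<partial>lborel)"
    unfolding sin_transform_def by (subst split) (auto simp: right_diff_distrib distrib_left sin_diff sin_add mult_ac)
  also have "\<dots> = - 2 * sin (h * \<eta>) * cos_transform f \<eta>" unfolding cos_transform_def by (rule integral_mult_right_zero)
  finally have 2: "sin_transform (cdiff h f) \<eta> = - 2 * sin (h * \<eta>) * cos_transform f \<eta>" .
  show ?thesis unfolding spectrum_def 1 2 by (simp add: power_mult_distrib algebra_simps)
qed

lemma test_function_cdiff_iterate: "test_function f \<Longrightarrow> test_function ((cdiff h ^^ n) f)"
  by (induction n) (auto intro: test_function_cdiff)

lemma spectrum_cdiff_iterate:
  "test_function f \<Longrightarrow> spectrum ((cdiff h ^^ n) f) \<eta> = (2 * sin (h * \<eta>)) ^ (2 * n) * spectrum f \<eta>"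
  by (induction n) (auto simp: spectrum_cdiff test_function_cdiff_iterate power_add power2_eq_square)

section \<open>A one-dimensional wave packet\<close>

text \<open>
  A plane wave cut off sharply at \<open>L\<close>; its spectrum is a pair of Fejer kernels at \<open>\<eta>0\<close> and
  \<open>- \<eta>0\<close>.
\<close>

definition cos_window :: "real \<Rightarrow> real \<Rightarrow> real \<Rightarrow> real" where
  "cos_window \<eta>0 L x = cos (\<eta>0 * x) * indicator {-L..L} x"

lemma test_function_cos_window: "test_function (cos_window \<eta>0 L)"
  unfolding test_function_def
proof (intro conjI exI allI)
  show "cos_window \<eta>0 L \<in> borel_measurable borel" unfolding cos_window_def[abs_def] by measurable
  show "\<bar>cos_window \<eta>0 L x\<bar> \<le> 1" "L < norm x \<longrightarrow> cos_window \<eta>0 L x = 0" for x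
    by (auto simp: cos_window_def split: split_indicator)
qed

lemma spectrum_cos_window:
  assumes "\<eta> \<noteq> \<eta>0" "\<eta> \<noteq> - \<eta>0" "0 < L"
  shows "spectrum (cos_window \<eta>0 L) \<eta> = (sin (L * (\<eta> - \<eta>0)) / (\<eta> - \<eta>0) + sin (L * (\<eta> + \<eta>0)) / (\<eta> + \<eta>0))\<^sup>2"
proof -
  let ?a = "\<eta> - \<eta>0" and ?b = "\<eta> + \<eta>0"
  have nz: "?a \<noteq> 0" "?b \<noteq> 0" using assms by auto
  have prod_cos: "cos (\<eta> * x) * cos (\<eta>0 * x) = (cos (?a * x) + cos (?b * x)) / 2" for x
    by (simp add: left_diff_distrib distrib_right cos_diff cos_add)
  have prod_sin: "sin (\<eta> * x) * cos (\<eta>0 * x) = (sin (?a * x) + sin (?b * x)) / 2" for x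
    by (simp add: left_diff_distrib distrib_right sin_diff sin_add)
  have "cos_transform (cos_window \<eta>0 L) \<eta> = (\<integral>x. ((cos (?a * x) + cos (?b * x)) / 2) * indicator {-L..L} x \<partial>lborel)"
    unfolding cos_transform_def cos_window_def by (simp only: mult.assoc[symmetric] prod_cos)
  also have "\<dots> = (sin (?a * L) / ?a + sin (?b * L) / ?b) / 2 - (sin (?a * (- L)) / ?a + sin (?b * (- L)) / ?b) / 2"
  proof (rule integral_FTC_Icc_real)
    fix x
    show "((\<lambda>x. (sin (?a * x) / ?a + sin (?b * x) / ?b) / 2) has_real_derivative (cos (?a * x) + cos (?b * x)) / 2) (at x)"
      using nz by (auto intro!: derivative_eq_intros)
    show "isCont (\<lambda>x. (cos (?a * x) + cos (?b * x)) / 2) x" by (intro continuous_intros) auto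
  qed (use assms in auto)
  also have "\<dots> = sin (L * ?a) / ?a + sin (L * ?b) / ?b"
  proof -
    have "(A + B) / 2 - (- A - B) / 2 = A + B" for A B :: real by (simp add: field_simps)
    then show ?thesis by (simp add: mult.commute)
  qed
  finally have c: "cos_transform (cos_window \<eta>0 L) \<eta> = sin (L * ?a) / ?a + sin (L * ?b) / ?b" .
  have "sin_transform (cos_window \<eta>0 L) \<eta> = (\<integral>x. ((sin (?a * x) + sin (?b * x)) / 2) * indicator {-L..L} x \<partial>lborel)"
    unfolding sin_transform_def cos_window_def by (simp only: mult.assoc[symmetric] prod_sin)
  also have "\<dots> = (- (cos (?a * L) / ?a) - cos (?b * L) / ?b) / 2 - (- (cos (?a * (- L)) / ?a) - cos (?b * (- L)) / ?b) / 2"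
  proof (rule integral_FTC_Icc_real)
    fix x
    show "((\<lambda>x. (- (cos (?a * x) / ?a) - cos (?b * x) / ?b) / 2) has_real_derivative (sin (?a * x) + sin (?b * x)) / 2) (at x)"
      using nz by (auto intro!: derivative_eq_intros)
    show "isCont (\<lambda>x. (sin (?a * x) + sin (?b * x)) / 2) x" by (intro continuous_intros) auto
  qed (use assms in auto)
  also have "\<dots> = 0" by simp
  finally show ?thesis unfolding spectrum_def c by simp
qed

lemma spectrum_bounded:
  assumes f: "test_function f"
  shows "spectrum f \<eta> \<le> 2 * (\<integral>x. \<bar>f x\<bar> \<partial>lborel)\<^sup>2"
proof -
  have *: "(\<integral>x. g x * f x \<partial>lborel)\<^sup>2 \<le> (\<integral>x. \<bar>f x\<bar> \<partial>lborel)\<^sup>2"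
    if "g \<in> borel_measurable borel" "\<And>x. \<bar>g x\<bar> \<le> 1" for g
  proof -
    have i: "integrable lborel (\<lambda>x. g x * f x)" by (rule integrable_mult_test_function[OF f that])
    have "\<bar>\<integral>x. g x * f x \<partial>lborel\<bar> \<le> (\<integral>x. \<bar>g x * f x\<bar> \<partial>lborel)" by (rule integral_abs_bound)
    also have "\<dots> \<le> (\<integral>x. \<bar>f x\<bar> \<partial>lborel)"
    proof (rule integral_mono[OF integrable_abs[OF i] integrable_test_function_abs[OF f]])
      fix x show "\<bar>g x * f x\<bar> \<le> \<bar>f x\<bar>"
        unfolding abs_mult using that(2)[of x] by (intro mult_left_le_one_le) auto
    qed
    finally show ?thesis by (metis abs_ge_zero power2_abs power_mono)
  qed
  show ?thesis
    using *[of "\<lambda>x. cos (\<eta> * x)"] *[of "\<lambda>x. sin (\<eta> * x)"]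
    unfolding spectrum_def cos_transform_def sin_transform_def by simp
qed

definition cut_inverse_square :: "real \<Rightarrow> real \<Rightarrow> real" where
  "cut_inverse_square \<delta> u = (if \<bar>u\<bar> < \<delta> then 0 else 1 / u\<^sup>2)"

lemma cut_inverse_square_measurable [measurable]: "cut_inverse_square \<delta> \<in> borel_measurable borel"
  unfolding cut_inverse_square_def[abs_def] by measurable

lemma cut_inverse_square_nonneg: "0 \<le> cut_inverse_square \<delta> u" by (simp add: cut_inverse_square_def)

lemma cut_inverse_square_integral:
  assumes "0 < \<delta>"
  shows "integrable lborel (\<lambda>u. cut_inverse_square \<delta> (u - a))" and "(\<integral>u. cut_inverse_square \<delta> (u - a) \<partial>lborel) \<le> 2 / \<delta>"
proof -
  let ?g = "\<lambda>u::real. 1 / u\<^sup>2 * indicator {\<delta>..} u"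
  have m: "(\<lambda>u::real. 1 / u\<^sup>2) \<in> borel_measurable borel" by measurable
  have half: "(\<integral>\<^sup>+u. ennreal (1 / u\<^sup>2) * indicator {\<delta>..} u \<partial>lborel) = ennreal (0 - (- 1 / \<delta>))"
  proof (rule nn_integral_FTC_atLeast[OF m])
    fix x assume "\<delta> \<le> x"
    then show "((\<lambda>x. - 1 / x) has_real_derivative 1 / x\<^sup>2) (at x)"
      using assms by (auto intro!: derivative_eq_intros simp: power2_eq_square)
  next
    show "((\<lambda>x::real. - 1 / x) \<longlongrightarrow> 0) at_top" by real_asymp
  qed auto
  have refl: "(\<integral>\<^sup>+u. ennreal (1 / u\<^sup>2) * indicator {\<delta>..} (- u) \<partial>lborel) = (\<integral>\<^sup>+u. ennreal (1 / u\<^sup>2) * indicator {\<delta>..} u \<partial>lborel)"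
    using nn_integral_real_affine[of "\<lambda>u. ennreal (1 / u\<^sup>2) * indicator {\<delta>..} u" "-1" 0] by simp
  have "(\<integral>\<^sup>+u. ennreal (cut_inverse_square \<delta> (u - a)) \<partial>lborel) = (\<integral>\<^sup>+u. ennreal (cut_inverse_square \<delta> u) \<partial>lborel)"
    using nn_integral_real_affine[of "\<lambda>u. ennreal (cut_inverse_square \<delta> (u - a))" 1 a] by simp
  also have "\<dots> \<le> (\<integral>\<^sup>+u. ennreal (1 / u\<^sup>2) * indicator {\<delta>..} u + ennreal (1 / u\<^sup>2) * indicator {\<delta>..} (- u) \<partial>lborel)"
    by (rule nn_integral_mono) (auto simp: cut_inverse_square_def abs_if split: split_indicator if_splits)
  also have "\<dots> = ennreal (1 / \<delta>) + ennreal (1 / \<delta>)"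
    using half refl by (subst nn_integral_add) auto
  also have "\<dots> = ennreal (2 / \<delta>)" using assms by (simp flip: ennreal_plus)
  finally have le: "(\<integral>\<^sup>+u. ennreal (cut_inverse_square \<delta> (u - a)) \<partial>lborel) \<le> ennreal (2 / \<delta>)" .
  show i: "integrable lborel (\<lambda>u. cut_inverse_square \<delta> (u - a))"
    using le by (intro integrableI_nonneg) (auto simp: cut_inverse_square_nonneg intro: le_less_trans)
  then show "(\<integral>u. cut_inverse_square \<delta> (u - a) \<partial>lborel) \<le> 2 / \<delta>"
    using le nn_integral_eq_integral[OF i] assms by (simp add: cut_inverse_square_nonneg)
qed

lemma sin_ge_half:
  fixes s :: real assumes "0 \<le> s" "s \<le> 1" shows "s / 2 \<le> sin s"
proof -
  have "s - s ^ 3 / 6 \<le> sin s"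
  proof -
    have "\<exists>y. DERIV (\<lambda>s. sin s - s + s ^ 3 / 6) x :> y \<and> 0 \<le> y" for x :: real
    proof -
      have "DERIV (\<lambda>s. sin s - s + s ^ 3 / 6) x :> cos x - 1 + x\<^sup>2 / 2"
        by (auto intro!: derivative_eq_intros simp: power2_eq_square)
      moreover have "0 \<le> cos x - 1 + x\<^sup>2 / 2"       proof -
        have "(sin (x / 2))\<^sup>2 \<le> (x / 2)\<^sup>2"
          using abs_sin_x_le_abs_x[of "x / 2"] by (simp only: abs_le_square_iff)
        then show ?thesis using cos_double_sin[of "x / 2"] by (simp add: power_divide)
      qed
      ultimately show ?thesis by blast
    qed
    then have "sin 0 - 0 + 0 ^ 3 / 6 \<le> sin s - s + s ^ 3 / 6"
      using assms(1) by (intro DERIV_nonneg_imp_nondecreasing[of 0 s "\<lambda>s. sin s - s + s ^ 3 / 6"]) auto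
    then show ?thesis by simp
  qed
  moreover have "s ^ 3 \<le> s"
  proof -
    have "s * (s * s) \<le> s * 1" using assms by (intro mult_left_mono) (auto simp: mult_le_one)
    then show ?thesis by (simp add: power3_eq_cube mult_ac)
  qed
  ultimately show ?thesis using assms by linarith
qed

text \<open>
  Near \<open>\<eta>0\<close> the spectrum of the truncated wave has height of order \<open>L\<^sup>2\<close> on an interval of
  length of order \<open>1 / L\<close>, hence mass of order \<open>L\<close>, while away from \<open>\<eta>0\<close> and \<open>- \<eta>0\<close> its
  mass is bounded independently of \<open>L\<close>. A bounded weight that is negative near these two
  frequencies is therefore negative on average for large \<open>L\<close>.
\<close>

lemma fejer_concentration:
  assumes w[measurable]: "w \<in> borel_measurable borel" and B: "\<And>\<eta>. \<bar>w \<eta>\<bar> \<le> B"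
    and pos: "0 < \<kappa>" "0 < \<delta>" "0 < \<eta>0"
    and near: "\<And>\<eta>. \<bar>\<eta> - \<eta>0\<bar> < \<delta> \<Longrightarrow> w \<eta> \<le> - \<kappa>" "\<And>\<eta>. \<bar>\<eta> + \<eta>0\<bar> < \<delta> \<Longrightarrow> w \<eta> \<le> 0"
  obtains L where "0 < L" "integrable lborel (spectrum (cos_window \<eta>0 L))"
    "(\<integral>\<eta>. w \<eta> * spectrum (cos_window \<eta>0 L) \<eta> \<partial>lborel) < 0"
proof -
  have B0: "0 \<le> B" using B[of 0] by linarith
  \<comment> \<open>the first two terms separate the peaks and put the main lobe within \<open>\<delta>\<close>; the last makes the gain \<open>\<kappa> * L / 8\<close> exceed the loss \<open>8 * B / \<delta>\<close>\<close>
  define L where "L = 4 / \<eta>0 + 2 / \<delta> + 64 * (B + 1) / (\<delta> * \<kappa>)"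
  have L: "0 < L" "4 / \<eta>0 \<le> L" "2 / \<delta> \<le> L" "64 * (B + 1) / (\<delta> * \<kappa>) \<le> L"
    using pos B0 by (auto simp: L_def add_pos_nonneg)
  have L1: "1 / L < \<delta>" "4 \<le> L * \<eta>0" using L pos by (auto simp: field_simps)
  define S where "S = spectrum (cos_window \<eta>0 L)"
  have [measurable]: "S \<in> borel_measurable borel" unfolding S_def
    by (rule transform_measurable(3)[OF test_function_measurable[OF test_function_cos_window]])
  have S0: "0 \<le> S \<eta>" for \<eta> by (simp add: S_def spectrum_nonneg)
  define M where "M = 2 * (\<integral>x. \<bar>cos_window \<eta>0 L x\<bar> \<partial>lborel)\<^sup>2"
  have M: "S \<eta> \<le> M" "0 \<le> M" for \<eta> unfolding S_def M_def by (auto intro: spectrum_bounded[OF test_function_cos_window])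
  let ?G = "\<lambda>\<eta>. 2 * cut_inverse_square \<delta> (\<eta> - \<eta>0) + 2 * cut_inverse_square \<delta> (\<eta> - (- \<eta>0))"
  have iI: "integrable lborel (indicator {a..b} :: real \<Rightarrow> real)" for a b :: real
    by (cases "a \<le> b") (auto intro!: integrable_real_indicator)
  have iG: "integrable lborel ?G"
    by (intro Bochner_Integration.integrable_add integrable_mult_right cut_inverse_square_integral(1) pos)
  have AE: "AE \<eta> in lborel. \<eta> \<noteq> \<eta>0 \<and> \<eta> \<noteq> - \<eta>0"
    using AE_lborel_singleton[of \<eta>0] AE_lborel_singleton[of "- \<eta>0"] by eventually_elim simp
  have away: "S \<eta> \<le> ?G \<eta>" if "\<eta> \<noteq> \<eta>0 \<and> \<eta> \<noteq> - \<eta>0" "\<delta> \<le> \<bar>\<eta> - \<eta>0\<bar>" "\<delta> \<le> \<bar>\<eta> + \<eta>0\<bar>" for \<eta>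
  proof -
    let ?a = "sin (L * (\<eta> - \<eta>0)) / (\<eta> - \<eta>0)" and ?b = "sin (L * (\<eta> + \<eta>0)) / (\<eta> + \<eta>0)"
    have "S \<eta> = (?a + ?b)\<^sup>2" unfolding S_def using that L(1) by (intro spectrum_cos_window) auto
    also have "\<dots> \<le> 2 * ?a\<^sup>2 + 2 * ?b\<^sup>2"
      using zero_le_power2[of "?a - ?b"] unfolding power2_sum power2_diff by linarith
    finally have "S \<eta> \<le> 2 * ?a\<^sup>2 + 2 * ?b\<^sup>2" .
    moreover have "?a\<^sup>2 \<le> cut_inverse_square \<delta> (\<eta> - \<eta>0)"
      using that by (simp add: cut_inverse_square_def power_divide abs_square_le_1 divide_right_mono)
    moreover have "?b\<^sup>2 \<le> cut_inverse_square \<delta> (\<eta> - (- \<eta>0))"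
      using that by (simp add: cut_inverse_square_def power_divide abs_square_le_1 divide_right_mono)
    ultimately show ?thesis by linarith
  qed
  have iS: "integrable lborel S"
  proof (rule Bochner_Integration.integrable_bound)
    show "integrable lborel (\<lambda>\<eta>. M * indicator {\<eta>0 - \<delta>..\<eta>0 + \<delta>} \<eta> + M * indicator {- \<eta>0 - \<delta>..- \<eta>0 + \<delta>} \<eta> + ?G \<eta>)"
      by (intro Bochner_Integration.integrable_add integrable_mult_right cut_inverse_square_integral(1) pos iI)
    show "AE \<eta> in lborel. norm (S \<eta>) \<le> norm (M * indicator {\<eta>0 - \<delta>..\<eta>0 + \<delta>} \<eta> + M * indicator {- \<eta>0 - \<delta>..- \<eta>0 + \<delta>} \<eta> + ?G \<eta>)"
      using AE
    proof eventually_elim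
      case (elim \<eta>)
      have G: "0 \<le> ?G \<eta>" by (simp add: cut_inverse_square_nonneg)
      consider "\<bar>\<eta> - \<eta>0\<bar> < \<delta>" | "\<bar>\<eta> + \<eta>0\<bar> < \<delta>" | "\<delta> \<le> \<bar>\<eta> - \<eta>0\<bar>" "\<delta> \<le> \<bar>\<eta> + \<eta>0\<bar>" by linarith
      then have "S \<eta> \<le> M * indicator {\<eta>0 - \<delta>..\<eta>0 + \<delta>} \<eta> + M * indicator {- \<eta>0 - \<delta>..- \<eta>0 + \<delta>} \<eta> + ?G \<eta>"
      proof cases
        case 1
        then have "indicator {\<eta>0 - \<delta>..\<eta>0 + \<delta>} \<eta> = (1::real)" by (auto simp: abs_less_iff)
        moreover have "0 \<le> M * indicator {- \<eta>0 - \<delta>..- \<eta>0 + \<delta>} \<eta>" using M by simp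
        ultimately show ?thesis using M(1)[of \<eta>] G by simp
      next
        case 2
        then have "indicator {- \<eta>0 - \<delta>..- \<eta>0 + \<delta>} \<eta> = (1::real)" by (auto simp: abs_less_iff)
        moreover have "0 \<le> M * indicator {\<eta>0 - \<delta>..\<eta>0 + \<delta>} \<eta>" using M by simp
        ultimately show ?thesis using M(1)[of \<eta>] G by simp
      next
        case 3
        have "0 \<le> M * indicator {\<eta>0 - \<delta>..\<eta>0 + \<delta>} \<eta>" "0 \<le> M * indicator {- \<eta>0 - \<delta>..- \<eta>0 + \<delta>} \<eta>" using M by simp_all
        then show ?thesis using away[OF elim 3] by linarith
      qed
      then show ?case using S0[of \<eta>] by simp
    qed
  qed measurable
  have iwS: "integrable lborel (\<lambda>\<eta>. w \<eta> * S \<eta>)"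
  proof (rule Bochner_Integration.integrable_bound[of _ "\<lambda>\<eta>. B * S \<eta>"])
    show "AE \<eta> in lborel. norm (w \<eta> * S \<eta>) \<le> norm (B * S \<eta>)"
      using B S0 B0 by (auto intro!: AE_I2 mult_right_mono simp: abs_mult)
  qed (use iS in auto)
  let ?H = "\<lambda>\<eta>. B * ?G \<eta> - \<kappa> * (L\<^sup>2 / 16) * indicator {\<eta>0 - 1 / L..\<eta>0 + 1 / L} \<eta>"
  have iH: "integrable lborel ?H"
    by (intro Bochner_Integration.integrable_diff integrable_mult_right iG iI)
  have "(\<integral>\<eta>. w \<eta> * S \<eta> \<partial>lborel) \<le> (\<integral>\<eta>. ?H \<eta> \<partial>lborel)"
  proof (rule integral_mono_AE[OF iwS iH], use AE in eventually_elim)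
    case (elim \<eta>)
    have G: "0 \<le> B * ?G \<eta>" using B0 by (simp add: cut_inverse_square_nonneg)
    show ?case
    proof (cases "\<bar>\<eta> - \<eta>0\<bar> \<le> 1 / L")
      case True
      let ?u = "\<eta> - \<eta>0"
      let ?a = "sin (L * ?u) / ?u" and ?b = "sin (L * (\<eta> + \<eta>0)) / (\<eta> + \<eta>0)"
      have "L / 2 \<le> ?a"
      proof -
        have "sin (L * u) / u = sin (L * \<bar>u\<bar>) / \<bar>u\<bar>" for u :: real by (cases "0 \<le> u") (auto simp: abs_if)
        then have e: "?a = sin (L * \<bar>?u\<bar>) / \<bar>?u\<bar>" .
        have u: "0 < \<bar>?u\<bar>" using elim by simp
        have "L * \<bar>?u\<bar> \<le> 1" using True L(1) by (simp add: field_simps)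
        then have "L * \<bar>?u\<bar> / 2 \<le> sin (L * \<bar>?u\<bar>)" using L(1) by (intro sin_ge_half) auto
        then show ?thesis unfolding e using u by (simp add: field_simps)
      qed
      moreover have "- (1 / \<eta>0) \<le> ?b"
      proof -
        have "1 / L \<le> \<eta>0" using L1 L(1) by (simp add: field_simps)
        then have "\<eta>0 \<le> \<eta> + \<eta>0" using True by (simp add: abs_le_iff)
        then have "\<bar>?b\<bar> \<le> 1 / \<eta>0" unfolding abs_divide using pos by (intro frac_le) auto
        then show ?thesis by linarith
      qed
      moreover have "1 / \<eta>0 \<le> L / 4" using L1 pos by (simp add: field_simps)
      ultimately have "L / 4 \<le> ?a + ?b" by linarith
      then have "(L / 4)\<^sup>2 \<le> (?a + ?b)\<^sup>2" using L(1) by (intro power_mono) auto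
      also have "\<dots> = S \<eta>" unfolding S_def using elim L(1) by (intro spectrum_cos_window[symmetric]) auto
      finally have SL: "L\<^sup>2 / 16 \<le> S \<eta>" by (simp add: power_divide)
      have wk: "w \<eta> \<le> - \<kappa>" using True L1(1) by (intro near) linarith
      have "w \<eta> * S \<eta> \<le> - \<kappa> * S \<eta>" using wk S0 by (intro mult_right_mono) auto
      also have "\<dots> \<le> - \<kappa> * (L\<^sup>2 / 16)" using SL pos by (intro mult_left_mono_neg) auto
      finally have "w \<eta> * S \<eta> \<le> - (\<kappa> * (L\<^sup>2 / 16))" by simp
      moreover have "indicator {\<eta>0 - 1 / L..\<eta>0 + 1 / L} \<eta> = (1::real)" using True by (auto simp: abs_le_iff)
      ultimately show ?thesis using G by simp
    next
      case False
      then have ind: "indicator {\<eta>0 - 1 / L..\<eta>0 + 1 / L} \<eta> = (0::real)" by (auto simp: abs_le_iff)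
      consider "\<bar>\<eta> - \<eta>0\<bar> < \<delta> \<or> \<bar>\<eta> + \<eta>0\<bar> < \<delta>" | "\<delta> \<le> \<bar>\<eta> - \<eta>0\<bar>" "\<delta> \<le> \<bar>\<eta> + \<eta>0\<bar>" by linarith
      then have "w \<eta> * S \<eta> \<le> B * ?G \<eta>"
      proof cases
        case 1
        then have "w \<eta> \<le> 0" using near[of \<eta>] pos by (meson less_imp_le neg_0_le_iff_le neg_le_0_iff_le order_trans)
        then show ?thesis using S0[of \<eta>] G by (meson mult_nonpos_nonneg order_trans)
      next
        case 2
        have "w \<eta> * S \<eta> \<le> B * S \<eta>" using B[of \<eta>] S0 by (intro mult_right_mono) auto
        also have "\<dots> \<le> B * ?G \<eta>" using away[OF elim 2] B0 by (rule mult_left_mono)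
        finally show ?thesis .
      qed
      then show ?thesis using ind by simp
    qed
  qed
  also have "(\<integral>\<eta>. ?H \<eta> \<partial>lborel) = B * (\<integral>\<eta>. ?G \<eta> \<partial>lborel) - \<kappa> * (L\<^sup>2 / 16) * (2 / L)"
  proof -
    have "(\<integral>\<eta>. ?H \<eta> \<partial>lborel) = (\<integral>\<eta>. B * ?G \<eta> \<partial>lborel) - (\<integral>\<eta>. \<kappa> * (L\<^sup>2 / 16) * indicator {\<eta>0 - 1 / L..\<eta>0 + 1 / L} \<eta> \<partial>lborel)"
      by (intro Bochner_Integration.integral_diff integrable_mult_right iG iI)
    also have "(\<integral>\<eta>. \<kappa> * (L\<^sup>2 / 16) * indicator {\<eta>0 - 1 / L..\<eta>0 + 1 / L} \<eta> \<partial>lborel) = \<kappa> * (L\<^sup>2 / 16) * (2 / L)"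
      using L(1) by (subst integral_mult_right_zero) simp
    finally show ?thesis by simp
  qed
  also have "\<dots> \<le> B * (8 / \<delta>) - \<kappa> * (L\<^sup>2 / 16) * (2 / L)"
  proof -
    have "(\<integral>\<eta>. ?G \<eta> \<partial>lborel) = 2 * (\<integral>\<eta>. cut_inverse_square \<delta> (\<eta> - \<eta>0) \<partial>lborel) + 2 * (\<integral>\<eta>. cut_inverse_square \<delta> (\<eta> - (- \<eta>0)) \<partial>lborel)"
      using cut_inverse_square_integral(1)[OF pos(2), of \<eta>0] cut_inverse_square_integral(1)[OF pos(2), of "- \<eta>0"] by simp
    also have "\<dots> \<le> 8 / \<delta>" using cut_inverse_square_integral(2)[OF pos(2), of \<eta>0] cut_inverse_square_integral(2)[OF pos(2), of "- \<eta>0"] by simp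
    finally have "B * (\<integral>\<eta>. ?G \<eta> \<partial>lborel) \<le> B * (8 / \<delta>)" using B0 by (rule mult_left_mono)
    then show ?thesis by simp
  qed
  also have "\<dots> < 0"
  proof -
    have "\<kappa> * (L\<^sup>2 / 16) * (2 / L) = \<kappa> * L / 8" using L(1) by (simp add: power2_eq_square)
    moreover have "64 * (B + 1) \<le> L * (\<delta> * \<kappa>)" using L(4) pos by (simp add: pos_divide_le_eq)
    then have "8 * (B + 1) / \<delta> \<le> \<kappa> * L / 8" using pos by (simp add: field_simps)
    moreover have "B * (8 / \<delta>) < 8 * (B + 1) / \<delta>" using pos by (simp add: field_simps)
    ultimately show ?thesis by linarith
  qed
  finally show ?thesis using that[OF L(1)] iS unfolding S_def by simp
qed

text \<open>
  The hypothesis says that \<open>\<bar>\<eta>\<bar> powr (- \<alpha>) - c' exp (- \<eta>\<^sup>2 / 2)\<close> is negative at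
  \<open>\<eta> = sqrt \<alpha>\<close>, the frequency at which the ratio of the two terms is smallest. The difference operators
  multiply this weight by \<open>(2 sin (h \<eta>)) ^ (2 m)\<close>, which makes it bounded and keeps its
  sign, and \<open>fejer_concentration\<close> applies. The vanishing of the spectrum at the origin also
  yields mean zero.
\<close>

lemma one_dimensional_test_function:
  fixes \<alpha> c' :: real
  assumes "0 < \<alpha>" and c': "\<alpha> powr (- (\<alpha> / 2)) < c' * exp (- (\<alpha> / 2))"
  obtains f where "test_function f" "(\<integral>x. f x \<partial>lborel) = 0"
    "integrable lborel (\<lambda>\<eta>. \<bar>\<eta>\<bar> powr (- \<alpha>) * spectrum f \<eta>)"
    "(\<integral>\<eta>. \<bar>\<eta>\<bar> powr (- \<alpha>) * spectrum f \<eta> \<partial>lborel) < c' * (\<integral>\<eta>. exp (- (\<eta>\<^sup>2 / 2)) * spectrum f \<eta> \<partial>lborel)"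
proof -
  have c'0: "0 < c'"
  proof -
    have "0 < c' * exp (- (\<alpha> / 2))" using c' by (rule le_less_trans[rotated]) simp
    then show ?thesis by (simp add: zero_less_mult_iff)
  qed
  define \<eta>0 where "\<eta>0 = sqrt \<alpha>"
  have \<eta>0: "0 < \<eta>0" "\<eta>0\<^sup>2 = \<alpha>" using assms by (auto simp: \<eta>0_def)
  \<comment> \<open>any step with \<open>sin (h * \<eta>0) \<noteq> 0\<close> works: the differences must not annihilate the chosen frequency\<close>
  define h where "h = 1 / \<eta>0"
  have h: "0 < h" "h * \<eta>0 = 1" using \<eta>0 by (auto simp: h_def)
  \<comment> \<open>\<open>2 * m \<ge> \<alpha>\<close> cancels the singularity at the origin, and \<open>m \<ge> 1\<close> forces mean zero\<close>
  define m where "m = Suc (nat \<lceil>\<alpha>\<rceil>)"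
  have m: "\<alpha> \<le> real (2 * m)" unfolding m_def using real_nat_ceiling_ge[of \<alpha>] by simp
  let ?s = "\<lambda>\<eta>. (2 * sin (h * \<eta>)) ^ (2 * m)"
  define w1 where "w1 \<eta> = ?s \<eta> * \<bar>\<eta>\<bar> powr (- \<alpha>)" for \<eta>
  define w2 where "w2 \<eta> = ?s \<eta> * exp (- (\<eta>\<^sup>2 / 2))" for \<eta>
  define w where "w \<eta> = w1 \<eta> - c' * w2 \<eta>" for \<eta>
  have [measurable]: "w1 \<in> borel_measurable borel" "w2 \<in> borel_measurable borel" "w \<in> borel_measurable borel"
    unfolding w1_def[abs_def] w2_def[abs_def] w_def[abs_def] by measurable
  have s0: "0 \<le> ?s \<eta>" for \<eta> by (simp add: power_mult)
  have s2: "?s \<eta> \<le> 2 ^ (2 * m)" for \<eta>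
  proof -
    have "?s \<eta> = \<bar>2 * sin (h * \<eta>)\<bar> ^ (2 * m)" by (simp add: power_mult)
    also have "\<dots> \<le> 2 ^ (2 * m)" by (intro power_mono) (auto simp: abs_mult)
    finally show ?thesis .
  qed
  define B where "B = (2 * h) ^ (2 * m) + 2 ^ (2 * m)"
  have w1B: "\<bar>w1 \<eta>\<bar> \<le> B" for \<eta>
  proof (cases "\<bar>\<eta>\<bar> < 1")
    case True
    show ?thesis
    proof (cases "\<eta> = 0")
      case False
      have "?s \<eta> = \<bar>2 * sin (h * \<eta>)\<bar> ^ (2 * m)" by (simp add: power_mult)
      also have "\<dots> \<le> (2 * h * \<bar>\<eta>\<bar>) ^ (2 * m)"
        using abs_sin_x_le_abs_x[of "h * \<eta>"] h by (intro power_mono) (auto simp: abs_mult)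
      also have "\<dots> = (2 * h) ^ (2 * m) * \<bar>\<eta>\<bar> powr real (2 * m)" using False by (simp only: power_mult_distrib powr_realpow)
      finally have "w1 \<eta> \<le> (2 * h) ^ (2 * m) * \<bar>\<eta>\<bar> powr real (2 * m) * \<bar>\<eta>\<bar> powr (- \<alpha>)"
        unfolding w1_def by (intro mult_right_mono) auto
      also have "\<dots> = (2 * h) ^ (2 * m) * \<bar>\<eta>\<bar> powr (real (2 * m) - \<alpha>)" by (simp only: mult.assoc powr_add[symmetric] diff_conv_add_uminus)
      also have "\<dots> \<le> (2 * h) ^ (2 * m) * 1" using True m h by (intro mult_left_mono powr_le1) auto
      finally show ?thesis using s0[of \<eta>] by (simp add: w1_def B_def abs_mult add_increasing2)
    qed (simp add: w1_def B_def h less_imp_le)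
  next
    case False
    have "\<bar>\<eta>\<bar> powr (- \<alpha>) \<le> 1 powr (- \<alpha>)" using False assms by (intro powr_mono2') auto
    then have "w1 \<eta> \<le> 2 ^ (2 * m) * 1" unfolding w1_def using s2[of \<eta>] by (intro mult_mono) auto
    then show ?thesis using s0[of \<eta>] h by (simp add: w1_def B_def abs_mult add_increasing)
  qed
  have w2B: "\<bar>w2 \<eta>\<bar> \<le> 2 ^ (2 * m)" for \<eta>
  proof -
    have "w2 \<eta> \<le> 2 ^ (2 * m) * 1" unfolding w2_def using s2[of \<eta>] by (intro mult_mono) auto
    then show ?thesis using s0[of \<eta>] by (simp add: w2_def abs_mult)
  qed
  have wB: "\<bar>w \<eta>\<bar> \<le> B + c' * 2 ^ (2 * m)" for \<eta>
  proof -
    have "\<bar>w \<eta>\<bar> \<le> \<bar>w1 \<eta>\<bar> + c' * \<bar>w2 \<eta>\<bar>" unfolding w_def using abs_triangle_ineq4[of "w1 \<eta>" "c' * w2 \<eta>"] c'0 by (simp add: abs_mult)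
    also have "\<dots> \<le> B + c' * 2 ^ (2 * m)" using w1B w2B c'0 by (intro add_mono mult_left_mono) auto
    finally show ?thesis .
  qed
  have even: "w (- \<eta>) = w \<eta>" for \<eta> by (simp add: w_def w1_def w2_def)
  have neg: "w \<eta>0 < 0"
  proof -
    have "\<eta>0 powr (- \<alpha>) = \<alpha> powr (- (\<alpha> / 2))"
      using assms by (simp add: \<eta>0_def powr_half_sqrt[symmetric] powr_powr)
    then have "\<eta>0 powr (- \<alpha>) - c' * exp (- (\<eta>0\<^sup>2 / 2)) < 0" using c' \<eta>0 by simp
    moreover have "0 < ?s \<eta>0" using h(2) sin_ge_half[of 1] by (simp add: zero_less_power)
    moreover have "w \<eta>0 = ?s \<eta>0 * (\<eta>0 powr (- \<alpha>) - c' * exp (- (\<eta>0\<^sup>2 / 2)))"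
      using \<eta>0 by (simp add: w_def w1_def w2_def algebra_simps)
    ultimately show ?thesis by (simp add: mult_pos_neg)
  qed
  have "isCont w \<eta>0" unfolding w_def[abs_def] w1_def[abs_def] w2_def[abs_def] using \<eta>0 by (intro continuous_intros) auto
  then obtain \<delta> where \<delta>: "0 < \<delta>" "\<And>\<eta>. \<bar>\<eta> - \<eta>0\<bar> < \<delta> \<Longrightarrow> \<bar>w \<eta> - w \<eta>0\<bar> < - w \<eta>0 / 2"
    using neg unfolding continuous_at_eps_delta dist_real_def by (metis half_gt_zero neg_0_less_iff_less)
  have near: "w \<eta> \<le> - (- w \<eta>0 / 2)" if "\<bar>\<eta> - \<eta>0\<bar> < \<delta>" for \<eta> using \<delta>(2)[OF that] by linarith
  have near': "w \<eta> \<le> 0" if "\<bar>\<eta> + \<eta>0\<bar> < \<delta>" for \<eta>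
  proof -
    have "\<bar>- \<eta> - \<eta>0\<bar> < \<delta>" using that by linarith
    from near[OF this] show ?thesis using neg even[of \<eta>] by linarith
  qed
  have half: "0 < - w \<eta>0 / 2" using neg by simp
  obtain L where L: "0 < L" "integrable lborel (spectrum (cos_window \<eta>0 L))"
    "(\<integral>\<eta>. w \<eta> * spectrum (cos_window \<eta>0 L) \<eta> \<partial>lborel) < 0"
    using fejer_concentration[OF \<open>w \<in> borel_measurable borel\<close> wB half \<delta>(1) \<eta>0(1) near near'] by blast
  let ?S = "spectrum (cos_window \<eta>0 L)"
  define f where "f = (cdiff h ^^ m) (cos_window \<eta>0 L)"
  have f: "test_function f" unfolding f_def by (rule test_function_cdiff_iterate[OF test_function_cos_window])
  have sf: "spectrum f \<eta> = ?s \<eta> * ?S \<eta>" for \<eta>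
    unfolding f_def by (rule spectrum_cdiff_iterate[OF test_function_cos_window])
  have e1: "\<bar>\<eta>\<bar> powr (- \<alpha>) * spectrum f \<eta> = w1 \<eta> * ?S \<eta>" and e2: "exp (- (\<eta>\<^sup>2 / 2)) * spectrum f \<eta> = w2 \<eta> * ?S \<eta>" for \<eta>
    by (simp_all add: sf w1_def w2_def)
  have [measurable]: "?S \<in> borel_measurable borel"
    by (rule transform_measurable(3)[OF test_function_measurable[OF test_function_cos_window]])
  have ii: "integrable lborel (\<lambda>\<eta>. v \<eta> * ?S \<eta>)" if [measurable]: "v \<in> borel_measurable borel" and "\<And>\<eta>. \<bar>v \<eta>\<bar> \<le> b" for v b
  proof (rule Bochner_Integration.integrable_bound[of _ "\<lambda>\<eta>. b * ?S \<eta>"])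
    have "\<bar>v \<eta>\<bar> * \<bar>?S \<eta>\<bar> \<le> \<bar>b\<bar> * \<bar>?S \<eta>\<bar>" for \<eta> using that(2)[of \<eta>] by (intro mult_right_mono) auto
    then show "AE \<eta> in lborel. norm (v \<eta> * ?S \<eta>) \<le> norm (b * ?S \<eta>)" by (simp add: abs_mult)
  qed (use L(2) in auto)
  have i1: "integrable lborel (\<lambda>\<eta>. w1 \<eta> * ?S \<eta>)" and i2: "integrable lborel (\<lambda>\<eta>. w2 \<eta> * ?S \<eta>)"
    using ii[OF _ w1B] ii[OF _ w2B] by auto
  have "(\<integral>\<eta>. w \<eta> * ?S \<eta> \<partial>lborel) = (\<integral>\<eta>. w1 \<eta> * ?S \<eta> - c' * (w2 \<eta> * ?S \<eta>) \<partial>lborel)"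
    by (simp add: w_def algebra_simps)
  also have "\<dots> = (\<integral>\<eta>. w1 \<eta> * ?S \<eta> \<partial>lborel) - c' * (\<integral>\<eta>. w2 \<eta> * ?S \<eta> \<partial>lborel)"
    using i1 i2 by simp
  finally have lt: "(\<integral>\<eta>. w1 \<eta> * ?S \<eta> \<partial>lborel) < c' * (\<integral>\<eta>. w2 \<eta> * ?S \<eta> \<partial>lborel)" using L(3) by simp
  have "spectrum f 0 = 0" unfolding sf by (simp add: m_def)
  then have "(cos_transform f 0)\<^sup>2 = 0" unfolding spectrum_def by (simp add: sum_power2_eq_zero_iff)
  then have "(\<integral>x. f x \<partial>lborel) = 0" by (simp add: cos_transform_def)
  then show ?thesis using that[OF f] i1 lt unfolding e1 e2 by simp
qed

section \<open>Tensor products and the heat kernel\<close>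

lemma pairing_iterated:
  fixes K :: "'a::euclidean_space \<Rightarrow> real"
  assumes "locally_integrable K" "test_function f"
  shows "pairing K f = (\<integral>y. (\<integral>x. K (x - y) * f x \<partial>lborel) * f y \<partial>lborel)"
proof -
  have "pairing K f = (\<integral>y. (\<integral>x. K (x - y) * (f x * f y) \<partial>lborel) \<partial>lborel)"
    unfolding pairing_def using lborel_pair.integral_snd[of "\<lambda>x y. K (x - y) * (f x * f y)"] pairing_integrable[OF assms]
    by (simp add: split_beta')
  then show ?thesis by (simp add: mult.assoc[symmetric])
qed

lemma heat_eq_normal_density: "0 < t \<Longrightarrow> heat t u = normal_density 0 (sqrt (2 * t)) u"
  by (simp add: heat_def normal_density_def mult_ac)

lemma heat_nonneg: "0 \<le> heat t u" if "0 < t"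
  using that by (simp add: heat_def)

lemma heat_measurable [measurable]: "heat t \<in> borel_measurable borel"
  unfolding heat_def[abs_def] by measurable

lemma heat_bounded: "0 < t \<Longrightarrow> \<bar>heat t u\<bar> \<le> 1 / sqrt (4 * pi * t)"
  by (simp add: heat_def divide_right_mono)

lemma heat_integrable: "0 < t \<Longrightarrow> integrable lborel (\<lambda>x. heat t (x - y))"
  and heat_integral: "0 < t \<Longrightarrow> (\<integral>x. heat t (x - y) \<partial>lborel) = 1"
proof -
  assume t: "0 < t"
  have e: "heat t (x - y) = normal_density y (sqrt (2 * t)) x" for x
    using t by (simp add: heat_eq_normal_density normal_density_def)
  show "integrable lborel (\<lambda>x. heat t (x - y))" "(\<integral>x. heat t (x - y) \<partial>lborel) = 1"
    unfolding e using t by (auto intro: integrable_normal_density)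
qed

lemma locally_integrable_heat: "0 < t \<Longrightarrow> locally_integrable (heat t)"
  by (rule locally_integrable_bounded[of _ "\<lambda>_. 1 / sqrt (4 * pi * t)"]) (auto simp: heat_bounded)

text \<open>
  The cut-off used in the coordinates in which the test function does not oscillate.
\<close>

definition window :: "real \<Rightarrow> real \<Rightarrow> real" where "window L = indicator {-L..L}"

lemma window_measurable [measurable]: "window L \<in> borel_measurable borel"
  unfolding window_def by measurable

lemma test_function_window: "test_function (window L)"
  unfolding test_function_def
proof (intro conjI exI allI)
  show "\<bar>window L x\<bar> \<le> 1" "L < norm x \<longrightarrow> window L x = 0" for x
    by (auto simp: window_def split: split_indicator)
qed measurable

lemma integral_window: "0 \<le> L \<Longrightarrow> (\<integral>x. window L x \<partial>lborel) = 2 * L"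
  by (simp add: window_def)

lemma heat_window_convolution:
  assumes "0 < t"
  shows "integrable lborel (\<lambda>x. heat t (x - y) * window L x)"
    and "0 \<le> (\<integral>x. heat t (x - y) * window L x \<partial>lborel)"
    and "(\<integral>x. heat t (x - y) * window L x \<partial>lborel) \<le> 1"
    and "integrable lborel (\<lambda>y. (\<integral>x. heat t (x - y) * window L x \<partial>lborel) * window L y)"
proof -
  show i: "integrable lborel (\<lambda>x. heat t (x - y) * window L x)" for y
    by (rule integrable_mult_test_function[OF test_function_window, of _ "1 / sqrt (4 * pi * t)"]) (auto simp: heat_bounded assms)
  show h0: "0 \<le> (\<integral>x. heat t (x - y) * window L x \<partial>lborel)" for y
    by (intro Bochner_Integration.integral_nonneg) (auto simp: heat_nonneg assms window_def)
  show h1: "(\<integral>x. heat t (x - y) * window L x \<partial>lborel) \<le> 1" for y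
  proof -
    have "(\<integral>x. heat t (x - y) * window L x \<partial>lborel) \<le> (\<integral>x. heat t (x - y) \<partial>lborel)"
      by (rule integral_mono[OF i heat_integrable]) (auto simp: window_def heat_nonneg assms split: split_indicator)
    then show ?thesis using heat_integral[OF assms] by simp
  qed
  show "integrable lborel (\<lambda>y. (\<integral>x. heat t (x - y) * window L x \<partial>lborel) * window L y)"
    by (rule integrable_mult_test_function[OF test_function_window, of _ 1]) (use h0 h1 in \<open>auto simp: abs_le_iff intro: order_trans[of _ 0]\<close>)
qed

lemma pairing_heat_window_le:
  assumes "0 < t" "0 < L"
  shows "pairing (heat t) (window L) \<le> 2 * L"
proof -
  note h = heat_window_convolution[OF assms(1)]
  have "pairing (heat t) (window L) = (\<integral>y. (\<integral>x. heat t (x - y) * window L x \<partial>lborel) * window L y \<partial>lborel)"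
    by (rule pairing_iterated[OF locally_integrable_heat[OF assms(1)] test_function_window])
  also have "\<dots> \<le> (\<integral>y. window L y \<partial>lborel)"
  proof (rule integral_mono[OF h(4) integrable_test_function[OF test_function_window]])
    show "(\<integral>x. heat t (x - y) * window L x \<partial>lborel) * window L y \<le> window L y" for y
      using h(2,3) by (intro mult_left_le_one_le) (auto simp: window_def)
  qed
  finally show ?thesis using assms by (simp add: integral_window)
qed

lemma pairing_heat_window_ge:
  assumes "0 < t" "0 < l" "l < L"
  shows "2 * (L - l) * (\<integral>u. heat t u * window l u \<partial>lborel) \<le> pairing (heat t) (window L)"
proof -
  let ?m = "\<integral>u. heat t u * window l u \<partial>lborel"
  note h = heat_window_convolution[OF assms(1)]
  have ih': "integrable lborel (\<lambda>x. heat t (x - y) * window l (x - y))" for y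
    using lborel_integrable_real_affine[OF h(1)[of 0 l], of 1 "- y"] by simp
  have m: "(\<integral>x. heat t (x - y) * window l (x - y) \<partial>lborel) = ?m" for y
    using lborel_integral_real_affine[of 1 "\<lambda>x. heat t x * window l x" "- y"] by simp
  have "2 * (L - l) * ?m = (\<integral>y. ?m * window (L - l) y \<partial>lborel)" using assms by (simp add: integral_window)
  also have "\<dots> \<le> (\<integral>y. (\<integral>x. heat t (x - y) * window L x \<partial>lborel) * window L y \<partial>lborel)"
  proof (rule integral_mono[OF _ h(4)])
    show "integrable lborel (\<lambda>y. ?m * window (L - l) y)" by (intro integrable_mult_right integrable_test_function test_function_window)
    fix y
    show "?m * window (L - l) y \<le> (\<integral>x. heat t (x - y) * window L x \<partial>lborel) * window L y"
    proof (cases "\<bar>y\<bar> \<le> L - l")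
      case True
      have "?m \<le> (\<integral>x. heat t (x - y) * window L x \<partial>lborel)"
        unfolding m[of y, symmetric]
      proof (rule integral_mono[OF ih' h(1)])
        fix x
        have "window l (x - y) \<le> window L x" using True by (auto simp: window_def split: split_indicator)
        then show "heat t (x - y) * window l (x - y) \<le> heat t (x - y) * window L x"
          by (intro mult_left_mono heat_nonneg assms)
      qed
      moreover have "window (L - l) y = 1" "window L y = 1" using True assms by (auto simp: window_def split: split_indicator)
      ultimately show ?thesis by simp
    next
      case False
      then have "window (L - l) y = 0" by (auto simp: window_def split: split_indicator)
      then show ?thesis using h(2)[of y L] by (simp add: window_def)
    qed
  qed
  also have "\<dots> = pairing (heat t) (window L)"
    by (rule pairing_iterated[OF locally_integrable_heat[OF assms(1)] test_function_window, symmetric])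
  finally show ?thesis .
qed

text \<open>
  Up to boundary effects a long window does not feel the heat flow: the points within \<open>l\<close> of the
  ends, whose heat leaks out, form a small fraction of the window.
\<close>

lemma pairing_heat_window_asymptotic:
  assumes t: "0 < t" and \<epsilon>: "0 < \<epsilon>" "\<epsilon> < 1"
  obtains L where "0 < L" "(1 - \<epsilon>) * (2 * L) \<le> pairing (heat t) (window L)"
proof -
  have "(\<lambda>n. \<integral>u. heat t u * window (real n) u \<partial>lborel) \<longlonglongrightarrow> (\<integral>u. heat t u \<partial>lborel)"
  proof (rule integral_dominated_convergence)
    show "integrable lborel (heat t)" using heat_integrable[OF t, of 0] by simp
    show "AE u in lborel. (\<lambda>n. heat t u * window (real n) u) \<longlonglongrightarrow> heat t u"
    proof (rule AE_I2)
      fix u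
      have "\<forall>\<^sub>F n in sequentially. heat t u * window (real n) u = heat t u"
      proof (rule eventually_sequentiallyI)
        fix n assume "nat \<lceil>\<bar>u\<bar>\<rceil> \<le> n"
        then have "\<bar>u\<bar> \<le> real n" by linarith
        then show "heat t u * window (real n) u = heat t u" by (auto simp: window_def split: split_indicator)
      qed
      then show "(\<lambda>n. heat t u * window (real n) u) \<longlonglongrightarrow> heat t u" by (rule tendsto_eventually)
    qed
    show "AE u in lborel. norm (heat t u * window (real n) u) \<le> heat t u" for n
      using heat_nonneg[OF t] by (auto simp: window_def split: split_indicator)
  qed measurable
  also have "(\<integral>u. heat t u \<partial>lborel) = 1" using heat_integral[OF t, of 0] by simp
  finally have lim: "(\<lambda>n. \<integral>u. heat t u * window (real n) u \<partial>lborel) \<longlonglongrightarrow> 1" .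
  have "\<forall>\<^sub>F n in sequentially. 1 - \<epsilon> / 2 < (\<integral>u. heat t u * window (real n) u \<partial>lborel)"
    using order_tendstoD(1)[OF lim] \<epsilon> by simp
  then have "\<forall>\<^sub>F n in sequentially. 1 - \<epsilon> / 2 < (\<integral>u. heat t u * window (real n) u \<partial>lborel) \<and> 0 < n"
    using eventually_gt_at_top[of 0] by (rule eventually_conj)
  then obtain n where n: "1 - \<epsilon> / 2 < (\<integral>u. heat t u * window (real n) u \<partial>lborel)" "0 < n"
    by (auto dest: eventually_happens)
  define L where "L = 2 * real n / \<epsilon>"
  have L: "0 < L" "real n = L * (\<epsilon> / 2)" using n \<epsilon> by (auto simp: L_def)
  have nL: "real n < L" unfolding L(2) using L(1) \<epsilon> by simp
  have "(1 - \<epsilon>) * (2 * L) \<le> 2 * (L - real n) * (1 - \<epsilon> / 2)"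
  proof -
    have "2 * (L - real n) * (1 - \<epsilon> / 2) = (1 - \<epsilon>) * (2 * L) + L * \<epsilon>\<^sup>2 / 2"
      unfolding L(2) by (simp add: power2_eq_square field_simps)
    then show ?thesis using L(1) by simp
  qed
  also have "\<dots> \<le> 2 * (L - real n) * (\<integral>u. heat t u * window (real n) u \<partial>lborel)"
    using n nL by (intro mult_left_mono) auto
  also have "\<dots> \<le> pairing (heat t) (window L)" using n nL by (intro pairing_heat_window_ge[OF t]) auto
  finally show ?thesis using that L(1) by blast
qed

definition tensor :: "('a::euclidean_space \<Rightarrow> real \<Rightarrow> real) \<Rightarrow> 'a \<Rightarrow> real" where
  "tensor F x = (\<Prod>b\<in>Basis. F b (x \<bullet> b))"

lemma tensor_measurable [measurable (raw)]:
  "(\<And>b. b \<in> Basis \<Longrightarrow> F b \<in> borel_measurable borel) \<Longrightarrow> tensor F \<in> borel_measurable borel"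
  unfolding tensor_def[abs_def]
  by (intro borel_measurable_prod measurable_compose[of "\<lambda>x. x \<bullet> b" borel borel "F b" for b]) auto

lemma integral_tensor:
  fixes F :: "'a::euclidean_space \<Rightarrow> real \<Rightarrow> real"
  assumes "\<And>b. b \<in> Basis \<Longrightarrow> integrable lborel (F b)"
  shows "(\<integral>x. tensor F x \<partial>lborel) = (\<Prod>b\<in>Basis. \<integral>u. F b u \<partial>lborel)"
proof -
  interpret product_sigma_finite "\<lambda>_::'a. lborel :: real measure" ..
  have [measurable]: "F b \<in> borel_measurable borel" if "b \<in> Basis" for b using assms[OF that] by auto
  have "(\<integral>x. tensor F x \<partial>lborel) = (\<integral>x. tensor F x \<partial>distr (\<Pi>\<^sub>M b\<in>Basis. lborel) borel (\<lambda>f. \<Sum>b\<in>Basis. f b *\<^sub>R b))"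
    by (subst lborel_eq) simp
  also have "\<dots> = (\<integral>f. tensor F (\<Sum>b\<in>Basis. f b *\<^sub>R b) \<partial>(\<Pi>\<^sub>M b\<in>Basis. lborel))"
    by (subst integral_distr) auto
  also have "\<dots> = (\<integral>f. (\<Prod>b\<in>Basis. F b (f b)) \<partial>(\<Pi>\<^sub>M b\<in>Basis. lborel))"
    unfolding tensor_def by (intro Bochner_Integration.integral_cong prod.cong refl) (simp add: inner_sum_left_Basis)
  also have "\<dots> = (\<Prod>b\<in>Basis. \<integral>u. F b u \<partial>lborel)"
    by (rule product_integral_prod) (auto intro: assms)
  finally show ?thesis .
qed

lemma test_function_tensor:
  fixes F :: "'a::euclidean_space \<Rightarrow> real \<Rightarrow> real"
  assumes "\<And>b. b \<in> Basis \<Longrightarrow> test_function (F b)"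
  shows "test_function (tensor F)"
proof -
  have "\<forall>b\<in>Basis. \<exists>CA. F b \<in> borel_measurable borel \<and> (\<forall>x. \<bar>F b x\<bar> \<le> fst CA \<and> (snd CA < norm x \<longrightarrow> F b x = 0)) \<and> 0 \<le> snd CA"
  proof
    fix b :: 'a assume "b \<in> Basis"
    then obtain C A where "F b \<in> borel_measurable borel" "0 < C" "0 < A" "\<And>x. \<bar>F b x\<bar> \<le> C" "\<And>x. A \<le> norm x \<Longrightarrow> F b x = 0"
      using test_functionE[OF assms] by metis
    then show "\<exists>CA. F b \<in> borel_measurable borel \<and> (\<forall>x. \<bar>F b x\<bar> \<le> fst CA \<and> (snd CA < norm x \<longrightarrow> F b x = 0)) \<and> 0 \<le> snd CA"
      by (intro exI[of _ "(C, A)"]) auto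
  qed
  then obtain CA where CA: "\<And>b. b \<in> Basis \<Longrightarrow> F b \<in> borel_measurable borel \<and> (\<forall>x. \<bar>F b x\<bar> \<le> fst (CA b) \<and> (snd (CA b) < norm x \<longrightarrow> F b x = 0)) \<and> 0 \<le> snd (CA b)"
    by metis
  show ?thesis unfolding test_function_def
  proof (intro conjI exI allI impI)
    show "tensor F \<in> borel_measurable borel" using CA by (intro tensor_measurable) auto
    fix x :: 'a
    show "\<bar>tensor F x\<bar> \<le> (\<Prod>b\<in>Basis. fst (CA b))"
      unfolding tensor_def abs_prod using CA by (intro prod_mono) auto
    assume x: "(\<Sum>b\<in>Basis. snd (CA b)) < norm x"
    have "\<exists>b\<in>Basis. snd (CA b) < \<bar>x \<bullet> b\<bar>"
    proof (rule ccontr)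
      assume "\<not> (\<exists>b\<in>Basis. snd (CA b) < \<bar>x \<bullet> b\<bar>)"
      then have "(\<Sum>b\<in>Basis. \<bar>x \<bullet> b\<bar>) \<le> (\<Sum>b\<in>Basis. snd (CA b))" by (intro sum_mono) (auto simp: not_less)
      then show False using x norm_le_l1[of x] by linarith
    qed
    then obtain b where "b \<in> Basis" "F b (x \<bullet> b) = 0" using CA by auto
    then show "tensor F x = 0" unfolding tensor_def by (auto intro!: prod_zero)
  qed
qed

definition heat_kernel :: "real \<Rightarrow> 'a::euclidean_space \<Rightarrow> real" where
  "heat_kernel t z = exp (- ((norm z)\<^sup>2 / (4 * t))) * (4 * pi * t) powr (- real DIM('a) / 2)"

lemma heat_kernel_measurable [measurable]: "heat_kernel t \<in> borel_measurable borel"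
  unfolding heat_kernel_def[abs_def] by measurable

lemma heat_kernel_eq_tensor:
  assumes "0 < t"
  shows "heat_kernel t z = (\<Prod>b\<in>Basis. heat t ((z :: 'a::euclidean_space) \<bullet> b))"
proof -
  have "(\<Prod>b\<in>Basis. heat t (z \<bullet> b)) = exp (\<Sum>b\<in>Basis. - ((z \<bullet> b)\<^sup>2 / (4 * t))) / sqrt (4 * pi * t) ^ DIM('a)"
    by (simp add: heat_def prod_dividef exp_sum)
  also have "(\<Sum>b\<in>Basis. - ((z \<bullet> b)\<^sup>2 / (4 * t))) = - ((norm z)\<^sup>2 / (4 * t))"
    by (simp add: sum_negf norm_eq_sqrt_inner euclidean_inner[of z z] power2_eq_square sum_divide_distrib sum_nonneg)
  also have "sqrt (4 * pi * t) ^ DIM('a) = (4 * pi * t) powr (real DIM('a) / 2)"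
    using assms by (simp add: powr_half_sqrt[symmetric] powr_powr flip: powr_realpow)
  finally show ?thesis by (simp add: heat_kernel_def powr_minus_divide)
qed

lemma locally_integrable_heat_kernel: "0 < t \<Longrightarrow> locally_integrable (heat_kernel t :: 'a::euclidean_space \<Rightarrow> real)"
  by (rule locally_integrable_bounded[of _ "\<lambda>_. (4 * pi * t) powr (- real DIM('a) / 2)"]) (auto simp: heat_kernel_def)

text \<open>
  The heat kernel is a product over the coordinates, so both integrations split.
\<close>

lemma pairing_heat_kernel_tensor:
  fixes F :: "'a::euclidean_space \<Rightarrow> real \<Rightarrow> real"
  assumes t: "0 < t" and F: "\<And>b. b \<in> Basis \<Longrightarrow> test_function (F b)"
  shows "pairing (heat_kernel t) (tensor F) = (\<Prod>b\<in>Basis. pairing (heat t) (F b))"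
proof -
  have [measurable]: "F b \<in> borel_measurable borel" if "b \<in> Basis" for b using F[OF that] by (rule test_function_measurable)
  define H where "H b v = (\<integral>u. heat t (u - v) * F b u \<partial>lborel)" for b v
  have iF: "integrable lborel (\<lambda>u. heat t (u - v) * F b u)" if "b \<in> Basis" for b v
    by (rule integrable_mult_test_function[OF F[OF that], of _ "1 / sqrt (4 * pi * t)"]) (auto simp: heat_bounded t)
  have Hm[measurable]: "H b \<in> borel_measurable borel" if "b \<in> Basis" for b
    unfolding H_def[abs_def] using that by measurable
  have Hb: "\<bar>H b v\<bar> \<le> 1 / sqrt (4 * pi * t) * (\<integral>u. \<bar>F b u\<bar> \<partial>lborel)" if "b \<in> Basis" for b v
  proof -
    have "\<bar>H b v\<bar> \<le> (\<integral>u. \<bar>heat t (u - v) * F b u\<bar> \<partial>lborel)" unfolding H_def by (rule integral_abs_bound)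
    also have "\<dots> \<le> (\<integral>u. 1 / sqrt (4 * pi * t) * \<bar>F b u\<bar> \<partial>lborel)"
    proof (rule integral_mono[OF integrable_abs[OF iF[OF that]] integrable_mult_right[OF integrable_test_function_abs[OF F[OF that]]]])
      fix u show "\<bar>heat t (u - v) * F b u\<bar> \<le> 1 / sqrt (4 * pi * t) * \<bar>F b u\<bar>"
        unfolding abs_mult by (intro mult_right_mono heat_bounded t) auto
    qed
    finally show ?thesis by simp
  qed
  have iH: "integrable lborel (\<lambda>v. H b v * F b v)" if "b \<in> Basis" for b
    using integrable_mult_test_function[OF F[OF that] Hm[OF that] Hb[OF that]] .
  have "pairing (heat_kernel t) (tensor F) = (\<integral>y. (\<integral>x. heat_kernel t (x - y) * tensor F x \<partial>lborel) * tensor F y \<partial>lborel)"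
    by (rule pairing_iterated[OF locally_integrable_heat_kernel[OF t] test_function_tensor[OF F]])
  also have "\<dots> = (\<integral>y. tensor (\<lambda>b v. H b v * F b v) y \<partial>lborel)"
  proof (rule Bochner_Integration.integral_cong[OF refl])
    fix y :: 'a
    have "(\<integral>x. heat_kernel t (x - y) * tensor F x \<partial>lborel) = (\<integral>x. tensor (\<lambda>b u. heat t (u - y \<bullet> b) * F b u) x \<partial>lborel)"
      unfolding heat_kernel_eq_tensor[OF t] tensor_def prod.distrib[symmetric] by (simp add: inner_diff_left)
    also have "\<dots> = (\<Prod>b\<in>Basis. H b (y \<bullet> b))" unfolding H_def by (rule integral_tensor[OF iF])
    finally show "(\<integral>x. heat_kernel t (x - y) * tensor F x \<partial>lborel) * tensor F y = tensor (\<lambda>b v. H b v * F b v) y"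
      by (simp add: tensor_def prod.distrib)
  qed
  also have "\<dots> = (\<Prod>b\<in>Basis. \<integral>v. H b v * F b v \<partial>lborel)" by (rule integral_tensor[OF iH])
  also have "\<dots> = (\<Prod>b\<in>Basis. pairing (heat t) (F b))"
    unfolding H_def by (intro prod.cong refl pairing_iterated[symmetric] locally_integrable_heat t F)
  finally show ?thesis .
qed

section \<open>The Riesz kernel as a superposition of heat kernels\<close>

lemma gamma_nn_integral_scaled:
  fixes p c :: real
  assumes "0 < p" "0 < c"
  shows "(\<integral>\<^sup>+t. ennreal (indicator {0<..} t * (t powr (p - 1) * exp (- (c * t)))) \<partial>lborel) = ennreal (Gamma p * c powr (- p))"
proof -
  let ?I = "\<integral>\<^sup>+t. ennreal (indicator {0<..} t * (t powr (p - 1) * exp (- (c * t)))) \<partial>lborel"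
  have "ennreal (Gamma p) = (\<integral>\<^sup>+t. ennreal (indicator {0..} t * t powr (p - 1) / exp t) \<partial>lborel)"
    by (rule Gamma_conv_nn_integral_real[OF assms(1)])
  also have "\<dots> = ennreal \<bar>c\<bar> * (\<integral>\<^sup>+x. ennreal (indicator {0..} (0 + c * x) * (0 + c * x) powr (p - 1) / exp (0 + c * x)) \<partial>lborel)"
    using assms by (intro nn_integral_real_affine) auto
  also have "(\<integral>\<^sup>+x. ennreal (indicator {0..} (0 + c * x) * (0 + c * x) powr (p - 1) / exp (0 + c * x)) \<partial>lborel)
     = (\<integral>\<^sup>+x. ennreal (c powr (p - 1)) * ennreal (indicator {0<..} x * (x powr (p - 1) * exp (- (c * x)))) \<partial>lborel)"
  proof (rule nn_integral_cong)
    fix x :: real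
    have "indicator {0..} (0 + c * x) * (0 + c * x) powr (p - 1) / exp (0 + c * x)
      = c powr (p - 1) * (indicator {0<..} x * (x powr (p - 1) * exp (- (c * x))))"
      using assms by (cases "0 < x") (auto simp: powr_mult exp_minus field_simps indicator_def zero_le_mult_iff)
    then show "ennreal (indicator {0..} (0 + c * x) * (0 + c * x) powr (p - 1) / exp (0 + c * x))
      = ennreal (c powr (p - 1)) * ennreal (indicator {0<..} x * (x powr (p - 1) * exp (- (c * x))))"
      by (simp add: ennreal_mult')
  qed
  also have "\<dots> = ennreal (c powr (p - 1)) * ?I" by (rule nn_integral_cmult) measurable
  also have "ennreal \<bar>c\<bar> * (ennreal (c powr (p - 1)) * ?I) = ennreal (c powr p) * ?I"
  proof -
    have "c * c powr (p - 1) = c powr p" using assms by (simp add: powr_diff)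
    then show ?thesis using assms by (simp add: mult.assoc[symmetric] flip: ennreal_mult)
  qed
  finally have "ennreal (c powr (- p)) * ennreal (Gamma p) = ennreal (c powr (- p)) * (ennreal (c powr p) * ?I)" by simp
  also have "\<dots> = ?I" using assms by (simp add: mult.assoc[symmetric] flip: ennreal_mult powr_add)
  finally show ?thesis using assms by (simp add: ennreal_mult' mult.commute Gamma_real_pos less_imp_le)
qed

lemma nn_integral_eq_absolutely_integrable:
  fixes h :: "real \<Rightarrow> real"
  assumes [measurable]: "h \<in> borel_measurable borel" "S \<in> sets borel" and h: "\<And>t. t \<in> S \<Longrightarrow> 0 \<le> h t" and "0 \<le> b"
  shows "(\<integral>\<^sup>+t. ennreal (indicator S t * h t) \<partial>lborel) = ennreal b \<longleftrightarrow> h absolutely_integrable_on S \<and> integral S h = b"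
proof
  have nn: "0 \<le> indicator S t * h t" for t using h by (auto split: split_indicator)
  {
    assume eq: "(\<integral>\<^sup>+t. ennreal (indicator S t * h t) \<partial>lborel) = ennreal b"
    have i: "integrable lborel (\<lambda>t. indicator S t * h t)"
      by (rule integrableI_nn_integral_finite[OF _ _ eq]) (use nn in auto)
    then have s: "set_integrable lborel S h" by (simp add: set_integrable_def)
    have "integrable lebesgue (\<lambda>t. indicator S t * h t)" using i by (subst integrable_completion) auto
    then have "h absolutely_integrable_on S" by (simp add: set_integrable_def)
    moreover have "integral S h = b"
    proof -
      have "0 \<le> (\<integral>t. indicator S t * h t \<partial>lborel)" using nn by (rule Bochner_Integration.integral_nonneg)
      moreover have "ennreal (\<integral>t. indicator S t * h t \<partial>lborel) = ennreal b"
        using nn_integral_eq_integral[OF i] nn eq by simp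
      ultimately have "(\<integral>t. indicator S t * h t \<partial>lborel) = b" using \<open>0 \<le> b\<close> by simp
      then show ?thesis
        using set_borel_integral_eq_integral(2)[OF s] by (simp add: set_lebesgue_integral_def)
    qed
    ultimately show "h absolutely_integrable_on S \<and> integral S h = b" by blast
  }
  {
    assume *: "h absolutely_integrable_on S \<and> integral S h = b"
    then have "integrable lebesgue (\<lambda>t. indicator S t * h t)" by (simp add: set_integrable_def)
    then have i: "integrable lborel (\<lambda>t. indicator S t * h t)" by (subst (asm) integrable_completion) auto
    then have s: "set_integrable lborel S h" by (simp add: set_integrable_def)
    show "(\<integral>\<^sup>+t. ennreal (indicator S t * h t) \<partial>lborel) = ennreal b"
      using set_borel_integral_eq_integral(2)[OF s] nn_integral_eq_integral[OF i] nn *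
      by (simp add: set_lebesgue_integral_def)
  }
qed

text \<open>
  The substitution \<open>t \<mapsto> 1 / t\<close> in the Gamma integral.
\<close>

lemma inverse_gamma_nn_integral:
  fixes p c :: real
  assumes "0 < p" "0 < c"
  shows "(\<integral>\<^sup>+t. ennreal (indicator {0<..} t * (t powr (- p - 1) * exp (- (c / t)))) \<partial>lborel) = ennreal (Gamma p * c powr (- p))"
proof -
  let ?b = "Gamma p * c powr (- p)" and ?S = "{0<..} :: real set"
  let ?f = "\<lambda>v. v powr (p - 1) * exp (- (c * v))"
  have b: "0 \<le> ?b" using assms by (simp add: Gamma_real_pos less_imp_le)
  have "?f absolutely_integrable_on ?S \<and> integral ?S ?f = ?b"
    using gamma_nn_integral_scaled[OF assms] b by (subst nn_integral_eq_absolutely_integrable[symmetric]) auto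
  moreover have "(\<lambda>t::real. 1 / t) ` ?S = ?S"
  proof safe
    fix x :: real assume "0 < x"
    then show "x \<in> (\<lambda>t. 1 / t) ` ?S" by (intro image_eqI[of _ _ "1 / x"]) auto
  qed auto
  ultimately have "(\<lambda>t. \<bar>- 1 / t\<^sup>2\<bar> * ?f (1 / t)) absolutely_integrable_on ?S \<and> integral ?S (\<lambda>t. \<bar>- 1 / t\<^sup>2\<bar> * ?f (1 / t)) = ?b"
    by (subst has_absolute_integral_change_of_variables_1'[where g = "\<lambda>t. 1 / t"])
       (auto intro!: derivative_eq_intros simp: power2_eq_square inj_on_def)
  then have "(\<integral>\<^sup>+t. ennreal (indicator ?S t * (\<bar>- 1 / t\<^sup>2\<bar> * ?f (1 / t))) \<partial>lborel) = ennreal ?b"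
    using b by (subst nn_integral_eq_absolutely_integrable) auto
  moreover have "indicator ?S t * (\<bar>- 1 / t\<^sup>2\<bar> * ?f (1 / t)) = indicator ?S t * (t powr (- p - 1) * exp (- (c / t)))" for t :: real
  proof (cases "0 < t")
    case True
    have "(1 / t) powr (p - 1) = t powr (- (p - 1))"
      using True by (simp only: powr_divide powr_minus_divide powr_one_eq_one)
    moreover have "1 / t\<^sup>2 = t powr (- 2)" using True by (simp only: powr_minus_divide powr_numeral)
    ultimately have "1 / t\<^sup>2 * (1 / t) powr (p - 1) = t powr (- 2) * t powr (- (p - 1))" by simp
    also have "\<dots> = t powr (- p - 1)"
    proof -
      have "- 2 + - (p - 1) = - p - 1" by simp
      then show ?thesis by (simp only: powr_add[symmetric])
    qed
    finally show ?thesis using True by (simp add: mult.assoc[symmetric])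
  qed simp
  ultimately show ?thesis by simp
qed

text \<open>
  The heat kernel at time \<open>t\<close> and distance \<open>r\<close>, weighted by \<open>t powr (\<alpha> / 2 - 1)\<close>.
\<close>

definition riesz_density :: "nat \<Rightarrow> real \<Rightarrow> real \<Rightarrow> real \<Rightarrow> real" where
  "riesz_density d \<alpha> r t = t powr (\<alpha> / 2 - 1) * (exp (- (r\<^sup>2 / (4 * t))) * (4 * pi * t) powr (- real d / 2))"

lemma riesz_density_measurable [measurable]:
  "(\<lambda>p. riesz_density d \<alpha> (f p) (g p)) \<in> borel_measurable M"
  if [measurable]: "f \<in> borel_measurable M" "g \<in> borel_measurable M"
  unfolding riesz_density_def by measurable

lemma riesz_density_antimono: "0 < t \<Longrightarrow> 0 \<le> a \<Longrightarrow> a \<le> b \<Longrightarrow> riesz_density d \<alpha> b t \<le> riesz_density d \<alpha> a t"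
  unfolding riesz_density_def by (intro mult_left_mono mult_right_mono) (auto intro!: divide_right_mono power_mono)

text \<open>
  Only differences of values of the Riesz kernel are represented. The time integral of the
  difference converges for \<open>0 < \<alpha> < d + 2\<close>, whereas a single kernel is integrable in time
  only for \<open>\<alpha> < d\<close>; this treats the power and the logarithmic case alike. The proof writes
  the difference as an integral over the distance and exchanges the integrals.
\<close>

lemma riesz_density_nn_integral:
  assumes "0 < \<alpha>" "\<alpha> < real d + 2" "0 < a" "a \<le> b"
  shows "(\<integral>\<^sup>+t. ennreal (indicator {0<..} t * (riesz_density d \<alpha> a t - riesz_density d \<alpha> b t)) \<partial>lborel)
    = ennreal (Gamma (\<alpha> / 2) * (riesz_kernel d \<alpha> a - riesz_kernel d \<alpha> b))"
proof -
  define \<beta> where "\<beta> = (real d + 2 - \<alpha>) / 2"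
  have \<beta>: "0 < \<beta>" using assms by (simp add: \<beta>_def)
  define \<phi> where "\<phi> t u = t powr (\<alpha> / 2 - 1) * (4 * pi * t) powr (- real d / 2) * (u / (2 * t) * exp (- (u\<^sup>2 / (4 * t))))" for t u
  have [measurable]: "(\<lambda>p. \<phi> (fst p) (snd p)) \<in> borel_measurable (lborel \<Otimes>\<^sub>M lborel)" unfolding \<phi>_def by measurable
  have [measurable]: "(\<lambda>u. \<phi> t u) \<in> borel_measurable borel" "(\<lambda>t. \<phi> t u) \<in> borel_measurable borel" for t u unfolding \<phi>_def by measurable
  have step1: "ennreal (indicator {0<..} t * (riesz_density d \<alpha> a t - riesz_density d \<alpha> b t))
     = (\<integral>\<^sup>+u. ennreal (indicator {0<..} t * \<phi> t u) * indicator {a..b} u \<partial>lborel)" for t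
  proof (cases "0 < t")
    case True
    let ?A = "t powr (\<alpha> / 2 - 1) * (4 * pi * t) powr (- real d / 2)"
    have "(\<integral>\<^sup>+u. ennreal (\<phi> t u) * indicator {a..b} u \<partial>lborel) = ennreal ((- (?A * exp (- (b\<^sup>2 / (4 * t))))) - (- (?A * exp (- (a\<^sup>2 / (4 * t))))))"
    proof (rule nn_integral_FTC_Icc)
      fix u assume "u \<in> {a..b}"
      then have u: "a \<le> u" "u \<le> b" by auto
      show "((\<lambda>u. - (?A * exp (- (u\<^sup>2 / (4 * t))))) has_real_derivative \<phi> t u) (at u)"
        unfolding \<phi>_def using True
        by (auto intro!: derivative_eq_intros)
      show "0 \<le> \<phi> t u" unfolding \<phi>_def using True u assms by auto
    qed (use assms in auto)
    then show ?thesis using True by (simp add: riesz_density_def algebra_simps)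
  qed simp
  have step2: "(\<integral>\<^sup>+t. ennreal (indicator {0<..} t * \<phi> t u) * indicator {a..b} u \<partial>lborel)
     = ennreal (Gamma (\<alpha> / 2) * (riesz_const_times_gap d \<alpha> * u powr (\<alpha> - real d - 1))) * indicator {a..b} u" for u
  proof (cases "u \<in> {a..b}")
    case True
    then have u: "0 < u" using assms by auto
    define C where "C = (4 * pi) powr (- real d / 2) * (u / 2)"
    have C: "0 \<le> C" using u by (simp add: C_def)
    have E: "indicator {0<..} t * \<phi> t u = C * (indicator {0<..} t * (t powr (- \<beta> - 1) * exp (- ((u\<^sup>2 / 4) / t))))" for t
    proof (cases "0 < t")
      case True
      have "t powr (\<alpha> / 2 - 1) * t powr (- real d / 2) / t = t powr (\<alpha> / 2 - 1 + - real d / 2 - 1)"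
        unfolding powr_diff[of t "\<alpha> / 2 - 1 + - real d / 2" 1] powr_add[of t "\<alpha> / 2 - 1" "- real d / 2"] using True by simp
      also have "\<alpha> / 2 - 1 + - real d / 2 - 1 = - \<beta> - 1" by (simp add: \<beta>_def field_simps)
      finally have e: "t powr (\<alpha> / 2 - 1) * t powr (- real d / 2) / t = t powr (- \<beta> - 1)" .
      have "\<phi> t u = C * ((t powr (\<alpha> / 2 - 1) * t powr (- real d / 2) / t) * exp (- ((u\<^sup>2 / 4) / t)))"
        using True by (simp add: \<phi>_def C_def powr_mult)
      then show ?thesis unfolding e using True by simp
    qed simp
    have "(\<integral>\<^sup>+t. ennreal (indicator {0<..} t * \<phi> t u) \<partial>lborel)
       = ennreal C * (\<integral>\<^sup>+t. ennreal (indicator {0<..} t * (t powr (- \<beta> - 1) * exp (- ((u\<^sup>2 / 4) / t)))) \<partial>lborel)"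
      unfolding E ennreal_mult'[OF C] by (rule nn_integral_cmult) measurable
    also have "\<dots> = ennreal (C * (Gamma \<beta> * (u\<^sup>2 / 4) powr (- \<beta>)))"
      using inverse_gamma_nn_integral[OF \<beta>, of "u\<^sup>2 / 4"] u C by (simp add: ennreal_mult')
    also have "C * (Gamma \<beta> * (u\<^sup>2 / 4) powr (- \<beta>)) = Gamma (\<alpha> / 2) * (riesz_const_times_gap d \<alpha> * u powr (\<alpha> - real d - 1))"
    proof -
      have gg: "Gamma (\<alpha> / 2) * riesz_const_times_gap d \<alpha> = 2 * Gamma \<beta> / (pi powr (real d / 2) * 2 powr \<alpha>)"
      proof -
        have "Gamma (\<alpha> / 2) \<noteq> 0"
          using Gamma_real_pos[of "\<alpha> / 2"] assms(1) by (metis half_gt_zero less_irrefl)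
        then show ?thesis using riesz_const_times_gap_eq[OF assms(1,2)] by (simp add: \<beta>_def)
      qed
      have "(u\<^sup>2 / 4) powr (- \<beta>) = ((u / 2) powr 2) powr (- \<beta>)" using u by (simp add: power_divide powr_numeral)
      also have "\<dots> = (u / 2) powr (\<alpha> - real d - 2)"
      proof -
        have "2 * - \<beta> = \<alpha> - real d - 2" by (simp add: \<beta>_def field_simps)
        then show ?thesis by (simp only: powr_powr)
      qed
      finally have X: "(u\<^sup>2 / 4) powr (- \<beta>) = (u / 2) powr (\<alpha> - real d - 2)" .
      have "u / 2 * (u\<^sup>2 / 4) powr (- \<beta>) = (u / 2) powr 1 * (u / 2) powr (\<alpha> - real d - 2)"
        unfolding X using u by simp
      also have "\<dots> = (u / 2) powr (\<alpha> - real d - 1)"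
      proof -
        have "1 + (\<alpha> - real d - 2) = \<alpha> - real d - 1" by simp
        then show ?thesis by (simp only: powr_add[symmetric])
      qed
      also have "\<dots> = u powr (\<alpha> - real d - 1) / 2 powr (\<alpha> - real d - 1)" by (rule powr_divide)
      finally have uu: "u / 2 * (u\<^sup>2 / 4) powr (- \<beta>) = u powr (\<alpha> - real d - 1) / 2 powr (\<alpha> - real d - 1)" .
      have four: "(4 * pi) powr (- real d / 2) = 1 / (2 powr real d * pi powr (real d / 2))"
      proof -
        have "(4 :: real) powr (real d / 2) = (2 powr 2) powr (real d / 2)" by simp
        also have "\<dots> = 2 powr real d" unfolding powr_powr by simp
        finally show ?thesis by (simp add: powr_mult powr_minus_divide)
      qed
      have two: "2 powr real d * 2 powr (\<alpha> - real d - 1) = 2 powr \<alpha> / (2 :: real)" by (simp add: powr_diff)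
      have "C * (Gamma \<beta> * (u\<^sup>2 / 4) powr (- \<beta>)) = (4 * pi) powr (- real d / 2) * (Gamma \<beta> * (u / 2 * (u\<^sup>2 / 4) powr (- \<beta>)))"
        by (simp add: C_def)
      also have "\<dots> = Gamma \<beta> * u powr (\<alpha> - real d - 1) / (pi powr (real d / 2) * (2 powr real d * 2 powr (\<alpha> - real d - 1)))"
        unfolding uu four by simp
      also have "\<dots> = (2 * Gamma \<beta> / (pi powr (real d / 2) * 2 powr \<alpha>)) * u powr (\<alpha> - real d - 1)" unfolding two by simp
      also have "\<dots> = Gamma (\<alpha> / 2) * (riesz_const_times_gap d \<alpha> * u powr (\<alpha> - real d - 1))" unfolding gg[symmetric] by simp
      finally show ?thesis .
    qed
    finally show ?thesis using True by simp
  qed simp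
  have "(\<integral>\<^sup>+t. ennreal (indicator {0<..} t * (riesz_density d \<alpha> a t - riesz_density d \<alpha> b t)) \<partial>lborel)
     = (\<integral>\<^sup>+t. (\<integral>\<^sup>+u. ennreal (indicator {0<..} t * \<phi> t u) * indicator {a..b} u \<partial>lborel) \<partial>lborel)"
    unfolding step1 ..
  also have "\<dots> = (\<integral>\<^sup>+u. (\<integral>\<^sup>+t. ennreal (indicator {0<..} t * \<phi> t u) * indicator {a..b} u \<partial>lborel) \<partial>lborel)"
  proof -
    have "(\<lambda>(t, u). ennreal (indicator {0<..} t * \<phi> t u) * indicator {a..b} u) \<in> borel_measurable (lborel \<Otimes>\<^sub>M lborel)"
      unfolding \<phi>_def by measurable
    from lborel_pair.Fubini'[OF this] show ?thesis by simp
  qed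
  also have "\<dots> = (\<integral>\<^sup>+u. ennreal (Gamma (\<alpha> / 2) * (riesz_const_times_gap d \<alpha> * u powr (\<alpha> - real d - 1))) * indicator {a..b} u \<partial>lborel)"
    unfolding step2 ..
  also have "\<dots> = ennreal ((- (Gamma (\<alpha> / 2) * riesz_kernel d \<alpha> b)) - (- (Gamma (\<alpha> / 2) * riesz_kernel d \<alpha> a)))"
  proof (rule nn_integral_FTC_Icc)
    fix u assume "u \<in> {a..b}"
    then have u: "a \<le> u" "u \<le> b" by auto
    have "((\<lambda>u. - (Gamma (\<alpha> / 2) * riesz_kernel d \<alpha> u)) has_real_derivative
        - (Gamma (\<alpha> / 2) * (- riesz_const_times_gap d \<alpha> * u powr (\<alpha> - real d - 1)))) (at u)"
      using u assms by (intro DERIV_minus DERIV_cmult riesz_kernel_has_derivative) auto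
    then show "((\<lambda>u. - (Gamma (\<alpha> / 2) * riesz_kernel d \<alpha> u)) has_real_derivative
        Gamma (\<alpha> / 2) * (riesz_const_times_gap d \<alpha> * u powr (\<alpha> - real d - 1))) (at u)" by simp
    show "0 \<le> Gamma (\<alpha> / 2) * (riesz_const_times_gap d \<alpha> * u powr (\<alpha> - real d - 1))"
      using Gamma_real_pos[of "\<alpha> / 2"] riesz_const_times_gap_pos[OF assms(1,2)] assms(1) by (intro mult_nonneg_nonneg) auto
  qed (use assms in auto)
  finally show ?thesis by (simp add: algebra_simps)
qed

lemma riesz_density_integral:
  assumes "0 < \<alpha>" "\<alpha> < real d + 2" "0 < r"
  defines "g \<equiv> \<lambda>t. indicator {0<..} t * (riesz_density d \<alpha> r t - riesz_density d \<alpha> 1 t)"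
  shows "integrable lborel g" "(\<integral>t. g t \<partial>lborel) = Gamma (\<alpha> / 2) * (riesz_kernel d \<alpha> r - riesz_kernel d \<alpha> 1)"
    and "(\<integral>t. \<bar>g t\<bar> \<partial>lborel) = Gamma (\<alpha> / 2) * \<bar>riesz_kernel d \<alpha> r - riesz_kernel d \<alpha> 1\<bar>"
proof -
  have main: "integrable lborel h \<and> (\<integral>t. h t \<partial>lborel) = Gamma (\<alpha> / 2) * (riesz_kernel d \<alpha> a - riesz_kernel d \<alpha> b)
      \<and> 0 \<le> riesz_kernel d \<alpha> a - riesz_kernel d \<alpha> b \<and> (\<forall>t. 0 \<le> h t)"
    if "0 < a" "a \<le> b" "h = (\<lambda>t. indicator {0<..} t * (riesz_density d \<alpha> a t - riesz_density d \<alpha> b t))" for a b h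
  proof -
    have nn: "0 \<le> h t" for t using riesz_density_antimono[of t a b d \<alpha>] that by (auto split: split_indicator)
    have [measurable]: "h \<in> borel_measurable borel" unfolding that(3) by measurable
    have eq: "(\<integral>\<^sup>+t. ennreal (h t) \<partial>lborel) = ennreal (Gamma (\<alpha> / 2) * (riesz_kernel d \<alpha> a - riesz_kernel d \<alpha> b))"
      unfolding that(3) by (rule riesz_density_nn_integral[OF assms(1,2) that(1,2)])
    have i: "integrable lborel h" by (rule integrableI_nn_integral_finite[OF _ _ eq]) (use nn in auto)
    have R: "0 \<le> riesz_kernel d \<alpha> a - riesz_kernel d \<alpha> b" using riesz_kernel_antimono[OF assms(1,2) that(1,2)] by simp
    have "0 \<le> Gamma (\<alpha> / 2) * (riesz_kernel d \<alpha> a - riesz_kernel d \<alpha> b)"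
      using R Gamma_real_pos[of "\<alpha> / 2"] assms(1) by (intro mult_nonneg_nonneg) auto
    moreover have "0 \<le> (\<integral>t. h t \<partial>lborel)" using nn by (rule Bochner_Integration.integral_nonneg)
    ultimately have "(\<integral>t. h t \<partial>lborel) = Gamma (\<alpha> / 2) * (riesz_kernel d \<alpha> a - riesz_kernel d \<alpha> b)"
      using nn_integral_eq_integral[OF i] nn eq by simp
    then show ?thesis using i R nn by blast
  qed
  have "integrable lborel g \<and> (\<integral>t. g t \<partial>lborel) = Gamma (\<alpha> / 2) * (riesz_kernel d \<alpha> r - riesz_kernel d \<alpha> 1)
    \<and> (\<integral>t. \<bar>g t\<bar> \<partial>lborel) = Gamma (\<alpha> / 2) * \<bar>riesz_kernel d \<alpha> r - riesz_kernel d \<alpha> 1\<bar>"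
  proof (cases "r \<le> 1")
    case True
    from main[OF assms(3) True, of g] 
    have *: "integrable lborel g" "(\<integral>t. g t \<partial>lborel) = Gamma (\<alpha> / 2) * (riesz_kernel d \<alpha> r - riesz_kernel d \<alpha> 1)"
      "0 \<le> riesz_kernel d \<alpha> r - riesz_kernel d \<alpha> 1" "\<And>t. 0 \<le> g t" by (simp_all only: g_def)
    then show ?thesis by simp
  next
    case False
    define h where "h t = indicator {0<..} t * (riesz_density d \<alpha> 1 t - riesz_density d \<alpha> r t)" for t
    have gh: "g = (\<lambda>t. - h t)" unfolding g_def h_def by (auto simp: algebra_simps)
    from main[of 1 r h] False
    have *: "integrable lborel h" "(\<integral>t. h t \<partial>lborel) = Gamma (\<alpha> / 2) * (riesz_kernel d \<alpha> 1 - riesz_kernel d \<alpha> r)"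
      "0 \<le> riesz_kernel d \<alpha> 1 - riesz_kernel d \<alpha> r" "\<And>t. 0 \<le> h t" by (auto simp: h_def[abs_def])
    show ?thesis unfolding gh using * by (simp add: algebra_simps abs_minus_commute)
  qed
  then show "integrable lborel g" "(\<integral>t. g t \<partial>lborel) = Gamma (\<alpha> / 2) * (riesz_kernel d \<alpha> r - riesz_kernel d \<alpha> 1)"
    "(\<integral>t. \<bar>g t\<bar> \<partial>lborel) = Gamma (\<alpha> / 2) * \<bar>riesz_kernel d \<alpha> r - riesz_kernel d \<alpha> 1\<bar>" by auto
qed

lemma locally_integrable_affine_bound:
  fixes K K' :: "'a::euclidean_space \<Rightarrow> real"
  assumes K: "locally_integrable K" and [measurable]: "K' \<in> borel_measurable borel" and ab: "0 \<le> a" 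
    and le: "\<And>x A. norm x < A \<Longrightarrow> x \<noteq> 0 \<Longrightarrow> \<bar>K' x\<bar> \<le> a * \<bar>K x\<bar> + b A"
  shows "locally_integrable K'"
  unfolding locally_integrable_def
proof (intro conjI allI)
  fix A
  have [measurable]: "K \<in> borel_measurable borel" "ball (0::'a) A \<in> sets borel" using K by (auto simp: locally_integrable_def)
  have "(\<integral>\<^sup>+x\<in>ball 0 A. ennreal \<bar>K' x\<bar> \<partial>lborel) \<le> (\<integral>\<^sup>+x. ennreal a * (ennreal \<bar>K x\<bar> * indicator (ball (0::'a) A) x) + ennreal \<bar>b A\<bar> * indicator (ball (0::'a) A) x \<partial>lborel)"
  proof (rule nn_integral_mono_AE, use AE_lborel_singleton[of "0::'a"] in eventually_elim)
    case (elim x)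
    show ?case
    proof (cases "x \<in> ball 0 A")
      case True
      have "\<bar>K' x\<bar> \<le> a * \<bar>K x\<bar> + \<bar>b A\<bar>" using le[of x A] True elim by auto
      then have "ennreal \<bar>K' x\<bar> \<le> ennreal (a * \<bar>K x\<bar> + \<bar>b A\<bar>)" by (rule ennreal_leI)
      then show ?thesis using True ab by (simp add: ennreal_mult')
    qed simp
  qed
  also have "\<dots> = ennreal a * (\<integral>\<^sup>+x\<in>ball (0::'a) A. ennreal \<bar>K x\<bar> \<partial>lborel) + ennreal \<bar>b A\<bar> * emeasure lborel (ball (0::'a) A)"
    by (subst nn_integral_add) (auto simp: nn_integral_cmult)
  also have "\<dots> < \<infinity>"
    using K emeasure_lborel_ball_finite[of "0::'a" A] by (auto simp: ennreal_mult_less_top locally_integrable_def)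
  finally show "(\<integral>\<^sup>+x\<in>ball 0 A. ennreal \<bar>K' x\<bar> \<partial>lborel) < \<infinity>" .
qed measurable

lemma test_function_abs: "test_function f \<Longrightarrow> test_function (\<lambda>x. \<bar>f x\<bar>)"
  unfolding test_function_def by fastforce

lemma pairing_const:
  fixes \<mu> :: "'a::euclidean_space \<Rightarrow> real"
  assumes "test_function \<mu>" "(\<integral>x. \<mu> x \<partial>lborel) = 0"
  shows "pairing (\<lambda>_. k) \<mu> = 0"
  unfolding pairing_def using integrable_lborel_pair_mult(2)[OF integrable_test_function[OF assms(1)] integrable_test_function[OF assms(1)]] assms(2)
  by simp

text \<open>
  Mean zero allows the value of the kernel at distance one to be subtracted at no cost. The
  integrand then has a constant sign in \<open>t\<close> for each pair of points, so absolute integrability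
  follows from local integrability of the Riesz kernel.
\<close>

lemma riesz_pairing_subordination:
  fixes \<mu> :: "'a::euclidean_space \<Rightarrow> real"
  assumes \<alpha>: "0 < \<alpha>" "\<alpha> < real DIM('a) + 2"
    and loc: "locally_integrable (\<lambda>z::'a. riesz_kernel DIM('a) \<alpha> (norm z))"
    and \<mu>: "test_function \<mu>" and \<mu>0: "(\<integral>x. \<mu> x \<partial>lborel) = 0"
  shows "integrable lborel (\<lambda>t. indicator {0<..} t * (t powr (\<alpha> / 2 - 1) * pairing (heat_kernel t) \<mu>))"
    and "Gamma (\<alpha> / 2) * pairing (\<lambda>z. riesz_kernel DIM('a) \<alpha> (norm z)) \<mu> =
      (\<integral>t. indicator {0<..} t * (t powr (\<alpha> / 2 - 1) * pairing (heat_kernel t) \<mu>) \<partial>lborel)"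
proof -
  let ?d = "DIM('a)"
  let ?P = "(lborel :: 'a measure) \<Otimes>\<^sub>M (lborel :: 'a measure)"
  let ?R = "riesz_kernel ?d \<alpha>" and ?\<Gamma> = "Gamma (\<alpha> / 2)"
  interpret L2: sigma_finite_measure ?P unfolding lborel_prod by (rule sigma_finite_lborel)
  interpret P3: pair_sigma_finite ?P "lborel :: real measure" ..
  have \<Gamma>: "0 < ?\<Gamma>" using Gamma_real_pos[of "\<alpha> / 2"] \<alpha>(1) by simp
  have [measurable]: "\<mu> \<in> borel_measurable borel" using \<mu> by (rule test_function_measurable)
  have Rm[measurable]: "(\<lambda>z::'a. ?R (norm z)) \<in> borel_measurable borel" using loc by (simp add: locally_integrable_def)
  define k where "k z t = indicator {0<..} t * (riesz_density ?d \<alpha> (norm z) t - riesz_density ?d \<alpha> 1 t)" for z :: 'a and t :: real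
  define G where "G p t = k (fst p - snd p) t * (\<mu> (fst p) * \<mu> (snd p))" for p :: "'a \<times> 'a" and t
  have Gm[measurable]: "(\<lambda>(p, t). G p t) \<in> borel_measurable (?P \<Otimes>\<^sub>M lborel)"
    unfolding G_def k_def by measurable
  have tint: "integrable lborel (G p)" "(\<integral>t. G p t \<partial>lborel) = ?\<Gamma> * ((?R (norm (fst p - snd p)) - ?R 1) * (\<mu> (fst p) * \<mu> (snd p)))"
    "(\<integral>t. \<bar>G p t\<bar> \<partial>lborel) = ?\<Gamma> * (\<bar>?R (norm (fst p - snd p)) - ?R 1\<bar> * (\<bar>\<mu> (fst p)\<bar> * \<bar>\<mu> (snd p)\<bar>))"
    if "fst p \<noteq> snd p" for p
  proof -
    have n: "0 < norm (fst p - snd p)" using that by simp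
    note r = riesz_density_integral[OF \<alpha> n]
    show "integrable lborel (G p)" unfolding G_def[abs_def] k_def using r(1) by (intro integrable_mult_left) auto
    show "(\<integral>t. G p t \<partial>lborel) = ?\<Gamma> * ((?R (norm (fst p - snd p)) - ?R 1) * (\<mu> (fst p) * \<mu> (snd p)))"
      unfolding G_def k_def using r(2) by (subst integral_mult_left_zero) (simp add: mult_ac)
    show "(\<integral>t. \<bar>G p t\<bar> \<partial>lborel) = ?\<Gamma> * (\<bar>?R (norm (fst p - snd p)) - ?R 1\<bar> * (\<bar>\<mu> (fst p)\<bar> * \<bar>\<mu> (snd p)\<bar>))"
      unfolding G_def k_def abs_mult[of _ "\<mu> _ * \<mu> _"] using r(3) by (subst integral_mult_left_zero) (simp add: abs_mult mult_ac)
  qed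
  have locd: "locally_integrable (\<lambda>z::'a. \<bar>?R (norm z) - ?R 1\<bar>)"
    by (rule locally_integrable_affine_bound[OF loc, of _ 1 "\<lambda>_. \<bar>?R 1\<bar>"]) auto
  have AEd: "AE p in ?P. fst p \<noteq> snd p" by (rule AE_off_diagonal)
  have iG: "integrable (?P \<Otimes>\<^sub>M lborel) (\<lambda>(p, t). G p t)"
  proof (rule P3.Fubini_integrable[OF Gm])
    have "integrable ?P (\<lambda>p. ?\<Gamma> * (\<bar>?R (norm (fst p - snd p)) - ?R 1\<bar> * (\<bar>\<mu> (fst p)\<bar> * \<bar>\<mu> (snd p)\<bar>)))"
      using pairing_integrable[OF locd test_function_abs[OF \<mu>]] by (rule integrable_mult_right)
    then have "integrable ?P (\<lambda>p. \<integral>t. norm (G p t) \<partial>lborel)"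
    proof (rule integrable_cong_AE_imp)
      show "(\<lambda>p. \<integral>t. norm (G p t) \<partial>lborel) \<in> borel_measurable ?P" by measurable
      show "AE p in ?P. ?\<Gamma> * (\<bar>?R (norm (fst p - snd p)) - ?R 1\<bar> * (\<bar>\<mu> (fst p)\<bar> * \<bar>\<mu> (snd p)\<bar>)) = (\<integral>t. norm (G p t) \<partial>lborel)"
        using AEd by eventually_elim (simp add: tint)
    qed
    then show "integrable ?P (\<lambda>p. \<integral>t. norm (case (p, t) of (p, t) \<Rightarrow> G p t) \<partial>lborel)" by simp
    show "AE p in ?P. integrable lborel (\<lambda>t. case (p, t) of (p, t) \<Rightarrow> G p t)"
      using AEd by eventually_elim (simp add: tint)
  qed
  have pint: "(\<integral>p. G p t \<partial>?P) = indicator {0<..} t * (t powr (\<alpha> / 2 - 1) * pairing (heat_kernel t) \<mu>)" for t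
  proof (cases "0 < t")
    case True
    let ?k1 = "riesz_density ?d \<alpha> 1 t"
    have "(\<integral>p. G p t \<partial>?P) = (\<integral>p. t powr (\<alpha> / 2 - 1) * (heat_kernel t (fst p - snd p) * (\<mu> (fst p) * \<mu> (snd p))) - ?k1 * (\<mu> (fst p) * \<mu> (snd p)) \<partial>?P)"
      using True by (intro Bochner_Integration.integral_cong) (auto simp: G_def k_def riesz_density_def heat_kernel_def algebra_simps)
    also have "\<dots> = t powr (\<alpha> / 2 - 1) * pairing (heat_kernel t) \<mu> - pairing (\<lambda>_. ?k1) \<mu>"
      unfolding pairing_def
      using pairing_integrable[OF locally_integrable_heat_kernel[OF True] \<mu>] integrable_lborel_pair_mult(1)[OF integrable_test_function[OF \<mu>] integrable_test_function[OF \<mu>]]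
      by (subst Bochner_Integration.integral_diff) auto
    finally show ?thesis using True pairing_const[OF \<mu> \<mu>0] by simp
  qed (simp add: G_def k_def)
  have "integrable lborel (\<lambda>t. \<integral>p. G p t \<partial>?P)" by (rule P3.integrable_snd[OF iG])
  then show "integrable lborel (\<lambda>t. indicator {0<..} t * (t powr (\<alpha> / 2 - 1) * pairing (heat_kernel t) \<mu>))" unfolding pint .
  have "?\<Gamma> * pairing (\<lambda>z. ?R (norm z)) \<mu> = ?\<Gamma> * (pairing (\<lambda>z. ?R (norm z)) \<mu> - pairing (\<lambda>_. ?R 1) \<mu>)"
    using pairing_const[OF \<mu> \<mu>0] by simp
  also have "\<dots> = (\<integral>p. ?\<Gamma> * ((?R (norm (fst p - snd p)) - ?R 1) * (\<mu> (fst p) * \<mu> (snd p))) \<partial>?P)"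
    unfolding pairing_def left_diff_distrib
    using pairing_integrable[OF loc \<mu>] integrable_lborel_pair_mult(1)[OF integrable_test_function[OF \<mu>] integrable_test_function[OF \<mu>]]
    by (subst integral_mult_right_zero, subst Bochner_Integration.integral_diff) auto
  also have "\<dots> = (\<integral>p. (\<integral>t. G p t \<partial>lborel) \<partial>?P)"
    by (rule integral_cong_AE) (use AEd in \<open>auto simp: tint elim: eventually_mono\<close>)
  also have "\<dots> = (\<integral>t. (\<integral>p. G p t \<partial>?P) \<partial>lborel)"
    using P3.Fubini_integral[OF iG] by simp
  finally show "?\<Gamma> * pairing (\<lambda>z. ?R (norm z)) \<mu> =
      (\<integral>t. indicator {0<..} t * (t powr (\<alpha> / 2 - 1) * pairing (heat_kernel t) \<mu>) \<partial>lborel)"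
    unfolding pint .
qed

section \<open>Wave packets of negative energy at every scale\<close>

lemma pairing_add:
  fixes K1 K2 :: "'a::euclidean_space \<Rightarrow> real"
  assumes "locally_integrable K1" "locally_integrable K2" "test_function \<mu>"
  shows "pairing (\<lambda>z. K1 z + K2 z) \<mu> = pairing K1 \<mu> + pairing K2 \<mu>"
  unfolding pairing_def distrib_right using assms
  by (intro Bochner_Integration.integral_add pairing_integrable)

lemma pairing_cmult: "pairing (\<lambda>z. a * K z) \<mu> = a * pairing K \<mu>"
  unfolding pairing_def by (simp add: mult.assoc)

lemma pairing_cong_off_origin:
  fixes K1 K2 :: "'a::euclidean_space \<Rightarrow> real"
  assumes [measurable]: "K1 \<in> borel_measurable borel" "K2 \<in> borel_measurable borel" "\<mu> \<in> borel_measurable borel"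
    and "\<And>z. z \<noteq> 0 \<Longrightarrow> K1 z = K2 z"
  shows "pairing K1 \<mu> = pairing K2 \<mu>"
  unfolding pairing_def
proof (rule integral_cong_AE)
  show "AE p in lborel \<Otimes>\<^sub>M lborel. K1 (fst p - snd p) * (\<mu> (fst p) * \<mu> (snd p)) = K2 (fst p - snd p) * (\<mu> (fst p) * \<mu> (snd p))"
    using AE_off_diagonal by eventually_elim (simp add: assms(4))
qed measurable

lemma locally_integrable_add:
  fixes K1 K2 :: "'a::euclidean_space \<Rightarrow> real"
  assumes "locally_integrable K1" "locally_integrable K2"
  shows "locally_integrable (\<lambda>z. K1 z + K2 z)"
  unfolding locally_integrable_def
proof (intro conjI allI)
  fix A
  have [measurable]: "K1 \<in> borel_measurable borel" "K2 \<in> borel_measurable borel" "ball (0::'a) A \<in> sets borel"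
    using assms by (auto simp: locally_integrable_def)
  show "(\<lambda>z. K1 z + K2 z) \<in> borel_measurable borel" by measurable
  have "(\<integral>\<^sup>+x\<in>ball (0::'a) A. ennreal \<bar>K1 x + K2 x\<bar> \<partial>lborel) \<le>
     (\<integral>\<^sup>+x. ennreal \<bar>K1 x\<bar> * indicator (ball (0::'a) A) x + ennreal \<bar>K2 x\<bar> * indicator (ball (0::'a) A) x \<partial>lborel)"
    by (intro nn_integral_mono) (auto split: split_indicator intro!: ennreal_leI abs_triangle_ineq simp flip: ennreal_plus)
  also have "\<dots> = (\<integral>\<^sup>+x\<in>ball (0::'a) A. ennreal \<bar>K1 x\<bar> \<partial>lborel) + (\<integral>\<^sup>+x\<in>ball (0::'a) A. ennreal \<bar>K2 x\<bar> \<partial>lborel)"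
    by (rule nn_integral_add) measurable
  also have "\<dots> < \<infinity>" using assms by (auto simp: locally_integrable_def)
  finally show "(\<integral>\<^sup>+x\<in>ball (0::'a) A. ennreal \<bar>K1 x + K2 x\<bar> \<partial>lborel) < \<infinity>" .
qed

lemma test_function_mult:
  fixes g :: "'a::euclidean_space \<Rightarrow> real"
  assumes \<mu>: "test_function \<mu>" and [measurable]: "g \<in> borel_measurable borel" and B: "\<And>x A. norm x < A \<Longrightarrow> \<bar>g x\<bar> \<le> B A"
  shows "test_function (\<lambda>x. g x * \<mu> x)"
proof -
  obtain C A where [measurable]: "\<mu> \<in> borel_measurable borel" and C: "0 < C" "0 < A" "\<And>x. \<bar>\<mu> x\<bar> \<le> C" "\<And>x. A \<le> norm x \<Longrightarrow> \<mu> x = 0"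
    using test_functionE[OF \<mu>] by metis
  have "\<bar>g x * \<mu> x\<bar> \<le> \<bar>B A\<bar> * C" for x
  proof (cases "norm x < A")
    case True
    have "\<bar>g x\<bar> * \<bar>\<mu> x\<bar> \<le> \<bar>B A\<bar> * C" using B[OF True] C by (intro mult_mono) auto
    then show ?thesis by (simp add: abs_mult)
  qed (use C in simp)
  then show ?thesis unfolding test_function_def using C(4) by (intro conjI exI[of _ "\<bar>B A\<bar> * C"] exI[of _ A]) auto
qed

text \<open>
  Only the mixed term of \<open>|x - y|\<^sup>2\<close> survives mean zero, and it gives minus twice the squared
  first moment.
\<close>

lemma pairing_norm_square_nonpos:
  fixes \<mu> :: "'a::euclidean_space \<Rightarrow> real"
  assumes \<mu>: "test_function \<mu>" and \<mu>0: "(\<integral>x. \<mu> x \<partial>lborel) = 0"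
  shows "pairing (\<lambda>z. (norm z)\<^sup>2) \<mu> \<le> 0"
proof -
  let ?P = "(lborel :: 'a measure) \<Otimes>\<^sub>M (lborel :: 'a measure)"
  have i0: "integrable lborel \<mu>" by (rule integrable_test_function[OF \<mu>])
  have i2: "integrable lborel (\<lambda>x. (norm x)\<^sup>2 * \<mu> x)"
    by (rule integrable_test_function[OF test_function_mult[OF \<mu>, of _ "\<lambda>A. A\<^sup>2"]]) (auto intro!: power_mono)
  have i1: "integrable lborel (\<lambda>x. (x \<bullet> b) * \<mu> x)" if "b \<in> Basis" for b :: 'a
  proof (rule integrable_test_function[OF test_function_mult[OF \<mu>, of _ "\<lambda>A. A"]])
    show "\<bar>x \<bullet> b\<bar> \<le> A" if "norm x < A" for x A using Basis_le_norm[OF \<open>b \<in> Basis\<close>, of x] that by simp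
  qed simp
  note p = integrable_lborel_pair_mult
  have "pairing (\<lambda>z. (norm z)\<^sup>2) \<mu> = (\<integral>q. ((norm (fst q))\<^sup>2 * \<mu> (fst q)) * \<mu> (snd q) + \<mu> (fst q) * ((norm (snd q))\<^sup>2 * \<mu> (snd q))
      - 2 * (\<Sum>b\<in>Basis. (fst q \<bullet> b * \<mu> (fst q)) * (snd q \<bullet> b * \<mu> (snd q))) \<partial>?P)"
    unfolding pairing_def
  proof (intro Bochner_Integration.integral_cong refl)
    fix q :: "'a \<times> 'a"
    have "(norm (fst q - snd q))\<^sup>2 = (norm (fst q))\<^sup>2 + (norm (snd q))\<^sup>2 - 2 * (fst q \<bullet> snd q)"
      unfolding power2_norm_eq_inner by (simp add: inner_diff_left inner_diff_right inner_commute)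
    also have "fst q \<bullet> snd q = (\<Sum>b\<in>Basis. (fst q \<bullet> b) * (snd q \<bullet> b))" by (rule euclidean_inner)
    finally have e: "(norm (fst q - snd q))\<^sup>2 = (norm (fst q))\<^sup>2 + (norm (snd q))\<^sup>2 - 2 * (\<Sum>b\<in>Basis. (fst q \<bullet> b) * (snd q \<bullet> b))" .
    have s: "(\<Sum>b\<in>Basis. (fst q \<bullet> b * \<mu> (fst q)) * (snd q \<bullet> b * \<mu> (snd q))) = (\<Sum>b\<in>Basis. (fst q \<bullet> b) * (snd q \<bullet> b)) * (\<mu> (fst q) * \<mu> (snd q))"
      by (simp add: sum_distrib_left sum_distrib_right mult_ac)
    show "(norm (fst q - snd q))\<^sup>2 * (\<mu> (fst q) * \<mu> (snd q)) = ((norm (fst q))\<^sup>2 * \<mu> (fst q)) * \<mu> (snd q) + \<mu> (fst q) * ((norm (snd q))\<^sup>2 * \<mu> (snd q))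
      - 2 * (\<Sum>b\<in>Basis. (fst q \<bullet> b * \<mu> (fst q)) * (snd q \<bullet> b * \<mu> (snd q)))"
      unfolding e s by (simp add: algebra_simps)
  qed
  also have "\<dots> = (\<integral>q. ((norm (fst q))\<^sup>2 * \<mu> (fst q)) * \<mu> (snd q) \<partial>?P) + (\<integral>q. \<mu> (fst q) * ((norm (snd q))\<^sup>2 * \<mu> (snd q)) \<partial>?P)
      - 2 * (\<Sum>b\<in>Basis. (\<integral>q. (fst q \<bullet> b * \<mu> (fst q)) * (snd q \<bullet> b * \<mu> (snd q)) \<partial>?P))"
    using p(1)[OF i2 i0] p(1)[OF i0 i2] p(1)[OF i1 i1] by simp
  also have "\<dots> = - 2 * (\<Sum>b\<in>Basis. (\<integral>x. (x \<bullet> b) * \<mu> x \<partial>lborel)\<^sup>2)"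
    using p(2)[OF i2 i0] p(2)[OF i0 i2] p(2)[OF i1 i1] \<mu>0 by (simp add: power2_eq_square)
  also have "\<dots> \<le> 0" by (simp add: sum_nonneg)
  finally show ?thesis .
qed

lemma pairing_affine:
  fixes \<mu> :: "'a::euclidean_space \<Rightarrow> real"
  assumes [measurable]: "K \<in> borel_measurable borel" "\<mu> \<in> borel_measurable borel" and s: "0 < s"
  shows "pairing K (\<lambda>x. \<mu> ((x - x0) /\<^sub>R s)) = s ^ DIM('a \<times> 'a) * pairing (\<lambda>z. K (s *\<^sub>R z)) \<mu>"
proof -
  let ?\<nu> = "\<lambda>x. \<mu> ((x - x0) /\<^sub>R s)"
  let ?g = "\<lambda>p :: 'a \<times> 'a. K (fst p - snd p) * (?\<nu> (fst p) * ?\<nu> (snd p))"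
  have [measurable]: "?g \<in> borel_measurable borel"
    unfolding borel_prod[symmetric] by measurable
  have [measurable]: "(\<lambda>p :: 'a \<times> 'a. (x0, x0) + s *\<^sub>R p) \<in> borel_measurable borel"
    by (intro borel_measurable_continuous_onI continuous_intros)
  have "pairing K ?\<nu> = (\<integral>p. ?g p \<partial>(lborel :: ('a \<times> 'a) measure))"
    unfolding pairing_def lborel_prod ..
  also have "\<dots> = (\<integral>p. ?g p \<partial>density (distr lborel borel (\<lambda>p :: 'a \<times> 'a. (x0, x0) + s *\<^sub>R p)) (\<lambda>_. ennreal (\<bar>s\<bar> ^ DIM('a \<times> 'a))))"
    by (subst lborel_affine[of s "(x0, x0)"]) (use s in auto)
  also have "\<dots> = (\<integral>p. (\<bar>s\<bar> ^ DIM('a \<times> 'a)) *\<^sub>R ?g ((x0, x0) + s *\<^sub>R p) \<partial>lborel)"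
    by (subst integral_density; (subst integral_distr)?) auto
  also have "\<dots> = s ^ DIM('a \<times> 'a) * (\<integral>p. K (s *\<^sub>R (fst p - snd p)) * (\<mu> (fst p) * \<mu> (snd p)) \<partial>(lborel :: ('a \<times> 'a) measure))"
    using s by (simp add: scaleR_diff_right)
  finally show ?thesis unfolding pairing_def lborel_prod .
qed

lemma prod_single_exception:
  fixes x y :: "'b::comm_monoid_mult"
  assumes "finite A" "e \<in> A"
  shows "(\<Prod>b\<in>A. if b = e then x else y) = x * y ^ (card A - 1)"
proof -
  have "(\<Prod>b\<in>A. if b = e then x else y) = x * (\<Prod>b\<in>A - {e}. if b = e then x else y)"
    using assms by (subst prod.remove[of A e]) auto
  also have "(\<Prod>b\<in>A - {e}. if b = e then x else y) = (\<Prod>b\<in>A - {e}. y)" by (rule prod.cong) auto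
  finally show ?thesis using assms by (simp add: prod_constant)
qed

text \<open>
  Integrating \<open>t powr (\<alpha> / 2 - 1) exp (- t \<eta>\<^sup>2)\<close> in time turns the heat multiplier into the
  Riesz multiplier \<open>\<bar>\<eta>\<bar> powr (- \<alpha>)\<close>.
\<close>

lemma heat_pairing_time_integral:
  assumes \<alpha>: "0 < \<alpha>" and f: "test_function f" and i: "integrable lborel (\<lambda>\<eta>. \<bar>\<eta>\<bar> powr (- \<alpha>) * spectrum f \<eta>)"
  shows "(\<integral>\<^sup>+t. ennreal (indicator {0<..} t * (t powr (\<alpha> / 2 - 1) * pairing (heat t) f)) \<partial>lborel)
    = ennreal (Gamma (\<alpha> / 2) / (2 * pi) * (\<integral>\<eta>. \<bar>\<eta>\<bar> powr (- \<alpha>) * spectrum f \<eta> \<partial>lborel))"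
proof -
  have \<Gamma>: "0 < Gamma (\<alpha> / 2)" using Gamma_real_pos[of "\<alpha> / 2"] \<alpha> by simp
  have [measurable]: "spectrum f \<in> borel_measurable borel"
    by (rule transform_measurable(3)[OF test_function_measurable[OF f]])
  define H where "H t \<eta> = indicator {0<..} t * (t powr (\<alpha> / 2 - 1) * exp (- (\<eta>\<^sup>2 * t))) * (spectrum f \<eta> / (2 * pi))" for t \<eta>
  have Hm[measurable]: "(\<lambda>(t, \<eta>). ennreal (H t \<eta>)) \<in> borel_measurable (lborel \<Otimes>\<^sub>M lborel)" unfolding H_def by measurable
  have H0: "0 \<le> H t \<eta>" for t \<eta> unfolding H_def by (intro mult_nonneg_nonneg divide_nonneg_nonneg spectrum_nonneg) auto
  have inner_eta: "ennreal (indicator {0<..} t * (t powr (\<alpha> / 2 - 1) * pairing (heat t) f)) = (\<integral>\<^sup>+\<eta>. ennreal (H t \<eta>) \<partial>lborel)" for t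
  proof (cases "0 < t")
    case True
    have e: "H t \<eta> = (t powr (\<alpha> / 2 - 1) / (2 * pi)) * (exp (- (t * \<eta>\<^sup>2)) * spectrum f \<eta>)" for \<eta>
      using True by (simp add: H_def mult_ac)
    have "integrable lborel (\<lambda>\<eta>. H t \<eta>)" unfolding e
      by (intro integrable_mult_right pairing_heat_eq_spectrum(2)[OF f True])
    then have "(\<integral>\<^sup>+\<eta>. ennreal (H t \<eta>) \<partial>lborel) = ennreal (\<integral>\<eta>. H t \<eta> \<partial>lborel)"
      using H0 by (intro nn_integral_eq_integral) auto
    also have "(\<integral>\<eta>. H t \<eta> \<partial>lborel) = t powr (\<alpha> / 2 - 1) * pairing (heat t) f"
      unfolding e pairing_heat_eq_spectrum(1)[OF f True] by simp
    finally show ?thesis using True by simp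
  qed (simp add: H_def)
  have inner_t: "(\<integral>\<^sup>+t. ennreal (H t \<eta>) \<partial>lborel) = ennreal (Gamma (\<alpha> / 2) / (2 * pi) * (\<bar>\<eta>\<bar> powr (- \<alpha>) * spectrum f \<eta>))" if "\<eta> \<noteq> 0" for \<eta>
  proof -
    have S: "0 \<le> spectrum f \<eta> / (2 * pi)" by (simp add: spectrum_nonneg)
    have "(\<integral>\<^sup>+t. ennreal (H t \<eta>) \<partial>lborel) = (\<integral>\<^sup>+t. ennreal (indicator {0<..} t * (t powr (\<alpha> / 2 - 1) * exp (- (\<eta>\<^sup>2 * t)))) * ennreal (spectrum f \<eta> / (2 * pi)) \<partial>lborel)"
      unfolding H_def using S by (intro nn_integral_cong ennreal_mult) auto
    also have "\<dots> = ennreal (Gamma (\<alpha> / 2) * (\<eta>\<^sup>2) powr (- (\<alpha> / 2))) * ennreal (spectrum f \<eta> / (2 * pi))"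
      using gamma_nn_integral_scaled[of "\<alpha> / 2" "\<eta>\<^sup>2"] \<alpha> that by (subst nn_integral_multc) auto
    also have "(\<eta>\<^sup>2) powr (- (\<alpha> / 2)) = \<bar>\<eta>\<bar> powr (- \<alpha>)"
    proof -
      have "\<eta>\<^sup>2 = \<bar>\<eta>\<bar> powr 2" using that by (simp add: powr_numeral)
      moreover have "2 * - (\<alpha> / 2) = - \<alpha>" by simp
      ultimately show ?thesis by (simp only: powr_powr)
    qed
    finally show ?thesis using S \<Gamma> by (simp add: mult_ac flip: ennreal_mult')
  qed
  have "(\<integral>\<^sup>+t. ennreal (indicator {0<..} t * (t powr (\<alpha> / 2 - 1) * pairing (heat t) f)) \<partial>lborel)
     = (\<integral>\<^sup>+t. (\<integral>\<^sup>+\<eta>. ennreal (H t \<eta>) \<partial>lborel) \<partial>lborel)" unfolding inner_eta ..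
  also have "\<dots> = (\<integral>\<^sup>+\<eta>. (\<integral>\<^sup>+t. ennreal (H t \<eta>) \<partial>lborel) \<partial>lborel)"
    using lborel_pair.Fubini'[OF Hm] by simp
  also have "\<dots> = (\<integral>\<^sup>+\<eta>. ennreal (Gamma (\<alpha> / 2) / (2 * pi) * (\<bar>\<eta>\<bar> powr (- \<alpha>) * spectrum f \<eta>)) \<partial>lborel)"
    by (rule nn_integral_cong_AE, use AE_lborel_singleton[of "0::real"] in eventually_elim) (simp add: inner_t)
  also have "\<dots> = ennreal (\<integral>\<eta>. Gamma (\<alpha> / 2) / (2 * pi) * (\<bar>\<eta>\<bar> powr (- \<alpha>) * spectrum f \<eta>) \<partial>lborel)"
    using i \<Gamma> by (intro nn_integral_eq_integral integrable_mult_right) (auto simp: spectrum_nonneg)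
  finally show ?thesis by simp
qed

context sparse_gaussians begin

lemma locally_integrable_riesz:
  assumes d: "d = DIM('a::euclidean_space)"
  shows "locally_integrable (\<lambda>z :: 'a. R (norm z))"
proof -
  obtain p K where p: "0 < p" "p < real d" "0 \<le> K" "\<And>r. 0 < r \<Longrightarrow> R r \<le> K * r powr (- p)"
    by (rule riesz_kernel_le_power) blast
  have "locally_integrable (\<lambda>z :: 'a. norm z powr (- p))"
    unfolding locally_integrable_def
  proof (intro conjI allI)
    fix A :: real
    show "(\<integral>\<^sup>+x\<in>ball (0::'a) A. ennreal \<bar>norm x powr (- p)\<bar> \<partial>lborel) < \<infinity>"
    proof (cases "0 < A")
      case True then show ?thesis using nn_integral_norm_powr_finite[of p A, where 'a='a] p d by simp
    next
      case False
      then have e: "ball (0::'a) A = {}" by simp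
      show ?thesis unfolding e by simp
    qed
  qed measurable
  then show ?thesis
  proof (rule locally_integrable_affine_bound[of _ _ K "\<lambda>A. \<bar>R A\<bar>"])
    show "(\<lambda>z :: 'a. R (norm z)) \<in> borel_measurable borel" unfolding riesz_kernel_def by measurable
    fix x :: 'a and A assume "norm x < A" "x \<noteq> 0"
    then have "R A \<le> R (norm x)" "R (norm x) \<le> K * norm x powr (- p)"
      using riesz_antimono[of "norm x" A] p(4)[of "norm x"] by auto
    moreover have "0 \<le> K * norm x powr (- p)" using p(3) by simp
    ultimately have "\<bar>R (norm x)\<bar> \<le> K * norm x powr (- p) + \<bar>R A\<bar>" by linarith
    then show "\<bar>R (norm x)\<bar> \<le> K * \<bar>norm x powr (- p)\<bar> + \<bar>R A\<bar>" by simp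
  qed (use p in auto)
qed

text \<open>
  Take the one-dimensional packet \<open>f\<close> in one coordinate and windows of length \<open>2 L\<close> in the
  remaining \<open>n = d - 1\<close>. For the Riesz kernel, bounding the heat pairing of each window by \<open>2 L\<close>
  at all times leaves \<open>(2 L) ^ n\<close> times the one-dimensional integral. For the Gaussian, which is a heat kernel
  at the fixed time one half, the windows lose only a factor \<open>(1 - \<epsilon>) ^ n\<close> if \<open>L\<close> is large. Nonnegativity
  on all heat kernels is recorded because the other Gaussians have to be discarded later.
\<close>

lemma base_test_function:
  assumes d: "d = DIM('a::euclidean_space)" and low: "c_lower d \<alpha> < c"
  obtains \<mu> :: "'a::euclidean_space \<Rightarrow> real" where "test_function \<mu>" "(\<integral>x. \<mu> x \<partial>lborel) = 0"
    "\<And>t. 0 < t \<Longrightarrow> 0 \<le> pairing (heat_kernel t) \<mu>"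
    "pairing (\<lambda>z. R (norm z)) \<mu> < c * pairing (\<lambda>z. exp (- ((norm z)\<^sup>2 / 2))) \<mu>"
proof -
  define c' where "c' = c * (2 * pi) powr (real d / 2)"
  have c'0: "0 < c'" using c by (simp add: c'_def)
  have "\<alpha> powr (- (\<alpha> / 2)) < c' * exp (- (\<alpha> / 2))"
  proof -
    have pp: "(2 * pi) powr (real d / 2) * exp (- (\<alpha> / 2)) > 0" by simp
    have F1: "c_lower d \<alpha> * ((2 * pi) powr (real d / 2) * exp (- (\<alpha> / 2))) < c * ((2 * pi) powr (real d / 2) * exp (- (\<alpha> / 2)))"
      using low pp by (rule mult_strict_right_mono)
    have F2: "c_lower d \<alpha> * ((2 * pi) powr (real d / 2) * exp (- (\<alpha> / 2))) = \<alpha> powr (- (\<alpha> / 2))"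
    proof -
      have "exp (\<alpha> / 2) * exp (- (\<alpha> / 2)) = 1" by (simp flip: exp_add)
      moreover have "(2 * pi) powr (- real d / 2) * (2 * pi) powr (real d / 2) = 1" by (simp flip: powr_add)
      moreover have "c_lower d \<alpha> * ((2 * pi) powr (real d / 2) * exp (- (\<alpha> / 2)))
          = \<alpha> powr (- \<alpha> / 2) * (exp (\<alpha> / 2) * exp (- (\<alpha> / 2))) * ((2 * pi) powr (- real d / 2) * (2 * pi) powr (real d / 2))"
        by (simp only: c_lower_def mult_ac)
      ultimately show ?thesis by (simp only: mult_1_right minus_divide_left)
    qed
    show ?thesis using F1 unfolding F2 c'_def mult.assoc .
  qed
  then obtain f where f: "test_function f" "(\<integral>x. f x \<partial>lborel) = 0"
    "integrable lborel (\<lambda>\<eta>. \<bar>\<eta>\<bar> powr (- \<alpha>) * spectrum f \<eta>)"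
    "(\<integral>\<eta>. \<bar>\<eta>\<bar> powr (- \<alpha>) * spectrum f \<eta> \<partial>lborel) < c' * (\<integral>\<eta>. exp (- (\<eta>\<^sup>2 / 2)) * spectrum f \<eta> \<partial>lborel)"
    by (rule one_dimensional_test_function[OF \<alpha>(1)])
  define J where "J = (\<integral>\<eta>. \<bar>\<eta>\<bar> powr (- \<alpha>) * spectrum f \<eta> \<partial>lborel)"
  define I where "I = (\<integral>\<eta>. exp (- (\<eta>\<^sup>2 / 2)) * spectrum f \<eta> \<partial>lborel)"
  have J0: "0 \<le> J" unfolding J_def by (intro Bochner_Integration.integral_nonneg) (simp add: spectrum_nonneg)
  have JI: "J < c' * I" using f(4) by (simp add: J_def I_def)
  define q where "q = J / (c' * I)"
  have q: "0 \<le> q" "q < 1" using J0 JI by (auto simp: q_def)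
  have Jq: "J = q * (c' * I)"
  proof -
    have "c' * I \<noteq> 0" using J0 JI by linarith
    from nonzero_eq_divide_eq[OF this, of q J] show ?thesis using q_def by metis
  qed
  define n where "n = d - 1"
  \<comment> \<open>by Bernoulli this small a loss per window keeps \<open>(1 - \<epsilon>) ^ n\<close> above the ratio \<open>q\<close>\<close>
  define \<epsilon> where "\<epsilon> = (1 - q) / (2 * real d)"
  have d1: "1 \<le> real d" using sparse_gaussians_axioms by (simp add: sparse_gaussians_def)
  have \<epsilon>: "0 < \<epsilon>" "\<epsilon> < 1" using q d1 by (auto simp: \<epsilon>_def field_simps)
  have "q < (1 - \<epsilon>) ^ n"
  proof -
    have "real n * \<epsilon> \<le> real d * \<epsilon>" using \<epsilon> by (intro mult_right_mono) (auto simp: n_def)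
    also have "\<dots> = (1 - q) / 2" using d1 by (simp add: \<epsilon>_def)
    finally have "real n * \<epsilon> \<le> (1 - q) / 2" .
    moreover have "1 + real n * (- \<epsilon>) \<le> (1 + - \<epsilon>) ^ n" using \<epsilon> by (intro Bernoulli_inequality) auto
    ultimately show ?thesis using q by simp
  qed
  then have qI: "J < (1 - \<epsilon>) ^ n * (c' * I)" unfolding Jq using J0 JI by (intro mult_strict_right_mono) auto
  obtain L where L: "0 < L" "(1 - \<epsilon>) * (2 * L) \<le> pairing (heat (1/2)) (window L)"
    using pairing_heat_window_asymptotic[of "1/2" \<epsilon>] \<epsilon> by auto
  obtain e :: 'a where e: "e \<in> Basis" using nonempty_Basis by blast
  define F where "F b = (if b = e then f else window L)" for b :: 'a
  have F: "test_function (F b)" for b by (simp add: F_def f(1) test_function_window)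
  define \<mu> where "\<mu> = tensor F"
  have \<mu>: "test_function \<mu>" unfolding \<mu>_def by (rule test_function_tensor[OF F])
  have n: "card (Basis :: 'a set) - 1 = n" by (simp add: n_def d)
  have hk: "pairing (heat_kernel t) \<mu> = pairing (heat t) f * pairing (heat t) (window L) ^ n" if "0 < t" for t
  proof -
    have "pairing (heat_kernel t) \<mu> = (\<Prod>b\<in>Basis. pairing (heat t) (F b))"
      unfolding \<mu>_def by (rule pairing_heat_kernel_tensor[OF that F])
    also have "\<dots> = (\<Prod>b\<in>Basis. if b = e then pairing (heat t) f else pairing (heat t) (window L))"
      by (rule prod.cong) (auto simp: F_def)
    also have "\<dots> = pairing (heat t) f * pairing (heat t) (window L) ^ n"
      using prod_single_exception[OF finite_Basis e] n by metis
    finally show ?thesis .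
  qed
  have nn: "0 \<le> pairing (heat_kernel t) \<mu>" if "0 < t" for t
    unfolding hk[OF that] using that f(1) by (intro mult_nonneg_nonneg zero_le_power pairing_heat_nonneg test_function_window) auto
  have \<mu>0: "(\<integral>x. \<mu> x \<partial>lborel) = 0"
  proof -
    have "(\<integral>x. \<mu> x \<partial>lborel) = (\<Prod>b\<in>Basis. \<integral>u. F b u \<partial>lborel)"
      unfolding \<mu>_def by (rule integral_tensor[OF integrable_test_function[OF F]])
    also have "\<dots> = 0" using e f(2) by (intro prod_zero) (auto intro!: bexI[of _ e] simp: F_def)
    finally show ?thesis .
  qed
  have \<Gamma>: "0 < Gamma (\<alpha> / 2)" using Gamma_real_pos[of "\<alpha> / 2"] \<alpha> by simp
  let ?h = "\<lambda>t. indicator {0<..} t * (t powr (\<alpha> / 2 - 1) * pairing (heat_kernel t) \<mu>)"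
  have sub: "integrable lborel ?h" "Gamma (\<alpha> / 2) * pairing (\<lambda>z. R (norm z)) \<mu> = (\<integral>t. ?h t \<partial>lborel)"
    using riesz_pairing_subordination[of \<alpha> \<mu>] \<alpha> locally_integrable_riesz[OF d] \<mu> \<mu>0 unfolding d by auto
  have h0: "0 \<le> ?h t" for t using nn[of t] by (auto split: split_indicator)
  have upper: "Gamma (\<alpha> / 2) * pairing (\<lambda>z. R (norm z)) \<mu> \<le> (2 * L) ^ n * (Gamma (\<alpha> / 2) / (2 * pi) * J)"
  proof -
    have "ennreal (\<integral>t. ?h t \<partial>lborel) = (\<integral>\<^sup>+t. ennreal (?h t) \<partial>lborel)"
      using nn_integral_eq_integral[OF sub(1)] h0 by simp
    also have "\<dots> \<le> (\<integral>\<^sup>+t. ennreal ((2 * L) ^ n) * ennreal (indicator {0<..} t * (t powr (\<alpha> / 2 - 1) * pairing (heat t) f)) \<partial>lborel)"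
    proof (rule nn_integral_mono)
      fix t :: real
      show "ennreal (?h t) \<le> ennreal ((2 * L) ^ n) * ennreal (indicator {0<..} t * (t powr (\<alpha> / 2 - 1) * pairing (heat t) f))"
      proof (cases "0 < t")
        case True
        have "pairing (heat t) (window L) ^ n \<le> (2 * L) ^ n"
          using pairing_heat_window_le[OF True L(1)] pairing_heat_nonneg[OF test_function_window True] by (intro power_mono) auto
        then have "t powr (\<alpha> / 2 - 1) * (pairing (heat t) f * pairing (heat t) (window L) ^ n) \<le> t powr (\<alpha> / 2 - 1) * (pairing (heat t) f * (2 * L) ^ n)"
          using pairing_heat_nonneg[OF f(1) True] by (intro mult_left_mono) auto
        then have "?h t \<le> (2 * L) ^ n * (indicator {0<..} t * (t powr (\<alpha> / 2 - 1) * pairing (heat t) f))"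
          using True by (simp add: hk mult_ac)
        then show ?thesis using L(1) by (simp add: ennreal_leI flip: ennreal_mult')
      qed simp
    qed
    also have "\<dots> = ennreal ((2 * L) ^ n) * ennreal (Gamma (\<alpha> / 2) / (2 * pi) * J)"
      unfolding J_def heat_pairing_time_integral[OF \<alpha>(1) f(1) f(3), symmetric]
    proof (rule nn_integral_cmult)
      have [measurable]: "spectrum f \<in> borel_measurable borel"
        by (rule transform_measurable(3)[OF test_function_measurable[OF f(1)]])
      have "(\<lambda>t. indicator {0<..} t * (t powr (\<alpha> / 2 - 1) * pairing (heat t) f))
        = (\<lambda>t. indicator {0<..} t * (t powr (\<alpha> / 2 - 1) * (1 / (2 * pi) * (\<integral>\<eta>. exp (- (t * \<eta>\<^sup>2)) * spectrum f \<eta> \<partial>lborel))))"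
        by (auto simp: fun_eq_iff pairing_heat_eq_spectrum(1)[OF f(1)] split: split_indicator)
      also have "\<dots> \<in> borel_measurable lborel" by measurable
      finally show "(\<lambda>t. ennreal (indicator {0<..} t * (t powr (\<alpha> / 2 - 1) * pairing (heat t) f))) \<in> borel_measurable lborel" by measurable
    qed
    also have "\<dots> = ennreal ((2 * L) ^ n * (Gamma (\<alpha> / 2) / (2 * pi) * J))"
      by (rule ennreal_mult'[symmetric]) (use L(1) in simp)
    finally have "ennreal (\<integral>t. ?h t \<partial>lborel) \<le> ennreal ((2 * L) ^ n * (Gamma (\<alpha> / 2) / (2 * pi) * J))" .
    then have "(\<integral>t. ?h t \<partial>lborel) \<le> (2 * L) ^ n * (Gamma (\<alpha> / 2) / (2 * pi) * J)"
      using L(1) J0 \<Gamma> by (subst (asm) ennreal_le_iff) auto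
    then show ?thesis using sub(2) by simp
  qed
  then have up: "pairing (\<lambda>z. R (norm z)) \<mu> \<le> (2 * L) ^ n * J / (2 * pi)"
  proof -
    have "Gamma (\<alpha> / 2) * pairing (\<lambda>z. R (norm z)) \<mu> \<le> Gamma (\<alpha> / 2) * ((2 * L) ^ n * J / (2 * pi))" using upper by (simp add: mult_ac)
    then show ?thesis using \<Gamma> by (simp only: mult_le_cancel_left_pos)
  qed
  have gauss: "c * pairing (\<lambda>z. exp (- ((norm z)\<^sup>2 / 2))) \<mu> = c' * pairing (heat_kernel (1/2)) \<mu>"
  proof -
    have "(\<lambda>z :: 'a. exp (- ((norm z)\<^sup>2 / 2))) = (\<lambda>z. (2 * pi) powr (real d / 2) * heat_kernel (1/2) z)"
    proof
      fix z :: 'a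
      have "(2 * pi) powr (real d / 2) * (2 * pi) powr (- real d / 2) = 1" by (simp flip: powr_add)
      then show "exp (- ((norm z)\<^sup>2 / 2)) = (2 * pi) powr (real d / 2) * heat_kernel (1/2) z"
        by (simp add: heat_kernel_def d mult.left_commute)
    qed
    then show ?thesis by (simp add: c'_def pairing_cmult)
  qed
  have heatf: "pairing (heat (1/2)) f = I / (2 * pi)"
    using pairing_heat_eq_spectrum(1)[OF f(1), of "1/2"] by (simp add: I_def)
  have I0: "0 \<le> I" unfolding I_def by (intro Bochner_Integration.integral_nonneg) (simp add: spectrum_nonneg)
  have "(2 * L) ^ n * J / (2 * pi) < (2 * L) ^ n * ((1 - \<epsilon>) ^ n * (c' * I)) / (2 * pi)"
    using qI L(1) by (intro divide_strict_right_mono mult_strict_left_mono) auto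
  also have "\<dots> = c' * (I / (2 * pi) * ((1 - \<epsilon>) * (2 * L)) ^ n)"
    unfolding power_mult_distrib[of "1 - \<epsilon>" "2 * L"] by (simp add: mult_ac)
  also have "\<dots> \<le> c' * (I / (2 * pi) * pairing (heat (1/2)) (window L) ^ n)"
    using L \<epsilon> c'0 I0 by (intro mult_left_mono power_mono) auto
  also have "\<dots> = c * pairing (\<lambda>z. exp (- ((norm z)\<^sup>2 / 2))) \<mu>" unfolding gauss hk[of "1/2", simplified] heatf ..
  finally have "pairing (\<lambda>z. R (norm z)) \<mu> < c * pairing (\<lambda>z. exp (- ((norm z)\<^sup>2 / 2))) \<mu>" using up by linarith
  then show ?thesis using that \<mu> \<mu>0 nn by blast
qed

end

lemma pairing_sum_heat_kernels:
  fixes \<mu> :: "'a::euclidean_space \<Rightarrow> real"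
  assumes \<mu>: "test_function \<mu>" and t: "\<And>j. 0 < t j"
  shows "pairing (\<lambda>z. \<Sum>j<N. a j * heat_kernel (t j) z) \<mu> = (\<Sum>j<(N::nat). a j * pairing (heat_kernel (t j)) \<mu>)"
proof -
  have "pairing (\<lambda>z. \<Sum>j<N. a j * heat_kernel (t j) z) \<mu>
     = (\<integral>p. (\<Sum>j<N. a j * (heat_kernel (t j) (fst p - snd p) * (\<mu> (fst p) * \<mu> (snd p)))) \<partial>(lborel \<Otimes>\<^sub>M lborel))"
    unfolding pairing_def by (simp add: sum_distrib_right mult.assoc)
  also have "\<dots> = (\<Sum>j<N. \<integral>p. a j * (heat_kernel (t j) (fst p - snd p) * (\<mu> (fst p) * \<mu> (snd p))) \<partial>(lborel \<Otimes>\<^sub>M lborel))"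
    by (intro Bochner_Integration.integral_sum integrable_mult_right pairing_integrable locally_integrable_heat_kernel t \<mu>)
  finally show ?thesis unfolding pairing_def by simp
qed

context sparse_gaussians begin

lemma riesz_scaling:
  assumes "0 < s" "0 < r"
  shows "R (s * r) = s powr (\<alpha> - real d) * R r + (if \<alpha> = real d then R s else 0)"
  using assms by (auto simp: riesz_kernel_def powr_mult ln_mult algebra_simps add_divide_distrib)

lemma gauss_term_heat:
  assumes "d = DIM('a::euclidean_space)" "0 < s"
  shows "gauss_term q lam j (norm (s *\<^sub>R (z :: 'a))) =
    (lam powr (q * real (Suc j)) * (4 * pi * (lam ^ (2 * Suc j) / (2 * s\<^sup>2))) powr (real d / 2)) * heat_kernel (lam ^ (2 * Suc j) / (2 * s\<^sup>2)) z"
proof -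
  define t where "t = lam ^ (2 * Suc j) / (2 * s\<^sup>2)"
  have t: "0 < t" using lam assms by (simp add: t_def)
  have "(norm (s *\<^sub>R z))\<^sup>2 / (2 * lam ^ (2 * Suc j)) = (norm z)\<^sup>2 / (4 * t)"
    using assms lam by (simp add: t_def power_mult_distrib field_simps)
  moreover have "(4 * pi * t) powr (real d / 2) * (4 * pi * t) powr (- real d / 2) = 1"
    using t by (simp flip: powr_add)
  ultimately show ?thesis unfolding gauss_term_def heat_kernel_def t_def[symmetric] assms(1)[symmetric]
    by (simp only: mult.assoc mult.left_commute[of "exp _"]) (simp add: mult.assoc[symmetric])
qed

lemma S_measurable [measurable]: "(\<lambda>z :: 'a::euclidean_space. S (norm (s *\<^sub>R z))) \<in> borel_measurable borel"
  unfolding gauss_series_def gauss_term_def by measurable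

lemma R_measurable [measurable]: "(\<lambda>z :: 'a::euclidean_space. R (norm (s *\<^sub>R z))) \<in> borel_measurable borel"
  unfolding riesz_kernel_def by measurable

text \<open>
  Under the dilation by \<open>s = lam ^ Suc n\<close> the Riesz kernel reproduces itself up to the factor
  \<open>s powr (\<alpha> - d)\<close> and a constant, which mean zero ignores, and the Gaussian with index \<open>n\<close> becomes the
  unit Gaussian with the same factor. All other Gaussians have nonnegative pairings and enter the
  potential with a minus sign, so they only help.
\<close>

lemma rescaled_pairing_negative:
  fixes \<mu> :: "'a::euclidean_space \<Rightarrow> real"
  assumes d: "d = DIM('a)" and \<mu>: "test_function \<mu>" and \<mu>0: "(\<integral>x. \<mu> x \<partial>lborel) = 0"
    and nn: "\<And>t. 0 < t \<Longrightarrow> 0 \<le> pairing (heat_kernel t) \<mu>"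
    and neg: "pairing (\<lambda>z. R (norm z)) \<mu> < c * pairing (\<lambda>z. exp (- ((norm z)\<^sup>2 / 2))) \<mu>"
    and s: "s = lam ^ Suc n"
  shows "pairing (\<lambda>z. radial_potential (norm (s *\<^sub>R z))) \<mu> < 0"
proof -
  let ?P = "(lborel :: 'a measure) \<Otimes>\<^sub>M (lborel :: 'a measure)"
  define q where "q = \<alpha> - real d"
  have s0: "0 < s" using lam s by simp
  let ?Kr = "\<lambda>z :: 'a. R (norm (s *\<^sub>R z))" and ?KS = "\<lambda>z :: 'a. S (norm (s *\<^sub>R z))"
  let ?k = "if \<alpha> = real d then R s else 0"
  have [measurable]: "\<mu> \<in> borel_measurable borel" using \<mu> by (rule test_function_measurable)
  have Rn: "locally_integrable (\<lambda>z :: 'a. R (norm z))" by (rule locally_integrable_riesz[OF d])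
  have Rm[measurable]: "(\<lambda>z :: 'a. R (norm z)) \<in> borel_measurable borel" using Rn by (simp add: locally_integrable_def)
  have Rs: "?Kr z = s powr q * R (norm z) + ?k" if "z \<noteq> 0" for z
    using riesz_scaling[OF s0, of "norm z"] that s0 by (simp add: q_def)
  have lKr: "locally_integrable ?Kr"
  proof (rule locally_integrable_affine_bound[OF Rn, of _ "s powr q" "\<lambda>_. \<bar>?k\<bar>"])
    fix x :: 'a and A :: real assume "norm x < A" "x \<noteq> 0"
    have "\<bar>?Kr x\<bar> \<le> \<bar>s powr q * R (norm x)\<bar> + \<bar>?k\<bar>" unfolding Rs[OF \<open>x \<noteq> 0\<close>] by (rule abs_triangle_ineq)
    then show "\<bar>?Kr x\<bar> \<le> s powr q * \<bar>R (norm x)\<bar> + \<bar>?k\<bar>" by (simp add: abs_mult)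
  qed (rule R_measurable, rule powr_ge_zero)
  have lKq: "locally_integrable (\<lambda>z :: 'a. (norm z)\<^sup>2)"
    by (rule locally_integrable_bounded[of _ "\<lambda>A. A\<^sup>2"]) (auto intro!: power_mono)
  have lKS: "locally_integrable ?KS"
  proof (rule locally_integrable_affine_bound[OF lKr, of _ "(1 - \<theta>) / c" "\<lambda>A. \<bar>profile (s * A)\<bar> / c"])
    fix x :: 'a and A assume x: "norm x < A" "x \<noteq> 0"
    then have pos: "0 < norm (s *\<^sub>R x)" using s0 by simp
    have "norm (s *\<^sub>R x) \<le> s * A" using x s0 by simp
    then have "profile (s * A) \<le> profile (norm (s *\<^sub>R x))" using pos by (intro profile_antimono) auto
    then have "c * ?KS x \<le> (1 - \<theta>) * ?Kr x - profile (s * A)" by (simp add: profile_def)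
    also have "\<dots> \<le> (1 - \<theta>) * \<bar>?Kr x\<bar> + \<bar>profile (s * A)\<bar>"
    proof -
      have "(1 - \<theta>) * ?Kr x \<le> (1 - \<theta>) * \<bar>?Kr x\<bar>" by (intro mult_left_mono abs_ge_self) (use \<theta> in simp)
      then show ?thesis using abs_ge_minus_self[of "profile (s * A)"] by linarith
    qed
    finally have "?KS x \<le> ((1 - \<theta>) * \<bar>?Kr x\<bar> + \<bar>profile (s * A)\<bar>) / c" using c by (simp add: pos_le_divide_eq mult.commute)
    moreover have "0 \<le> ?KS x" using pos by (intro S_nonneg) auto
    ultimately show "\<bar>?KS x\<bar> \<le> (1 - \<theta>) / c * \<bar>?Kr x\<bar> + \<bar>profile (s * A)\<bar> / c" by (simp add: add_divide_distrib)
  qed (rule S_measurable, use \<theta> c in simp)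
  have pKr: "pairing ?Kr \<mu> = s powr q * pairing (\<lambda>z. R (norm z)) \<mu>"
  proof -
    have "pairing ?Kr \<mu> = pairing (\<lambda>z. s powr q * R (norm z) + ?k) \<mu>"
      by (rule pairing_cong_off_origin[OF R_measurable _ _ Rs]; measurable)
    also have "\<dots> = pairing (\<lambda>z. s powr q * R (norm z)) \<mu> + pairing (\<lambda>_. ?k) \<mu>"
    proof (rule pairing_add[OF _ _ \<mu>])
      show "locally_integrable (\<lambda>z :: 'a. s powr q * R (norm z))"
        by (rule locally_integrable_affine_bound[OF Rn, of _ "s powr q" "\<lambda>_. 0"]) (auto simp: abs_mult)
      show "locally_integrable (\<lambda>_ :: 'a. ?k)" by (rule locally_integrable_bounded[of _ "\<lambda>_. \<bar>?k\<bar>"]) auto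
    qed
    finally show ?thesis using pairing_const[OF \<mu> \<mu>0] by (simp add: pairing_cmult)
  qed
  have pKS: "s powr q * pairing (\<lambda>z. exp (- ((norm z)\<^sup>2 / 2))) \<mu> \<le> pairing ?KS \<mu>"
  proof -
    define t where "t j = lam ^ (2 * Suc j) / (2 * s\<^sup>2)" for j
    define a where "a j = lam powr (q * real (Suc j)) * (4 * pi * t j) powr (real d / 2)" for j
    have t: "0 < t j" for j using lam s0 by (simp add: t_def)
    have a: "0 \<le> a j" for j by (simp add: a_def)
    have gauss_heat: "gauss_term q lam j (norm (s *\<^sub>R z)) = a j * heat_kernel (t j) z" for j and z :: 'a
      unfolding a_def t_def by (rule gauss_term_heat[OF d s0])
    let ?X = "\<lambda>N z. \<Sum>j<N. gauss_term q lam j (norm (s *\<^sub>R z))"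
    have lim: "(\<lambda>N. pairing (?X N) \<mu>) \<longlonglongrightarrow> pairing ?KS \<mu>"
      unfolding pairing_def
    proof (rule integral_dominated_convergence)
      have "integrable ?P (\<lambda>p. ?KS (fst p - snd p) * (\<mu> (fst p) * \<mu> (snd p)))" by (rule pairing_integrable[OF lKS \<mu>])
      then show "integrable ?P (\<lambda>p. \<bar>?KS (fst p - snd p) * (\<mu> (fst p) * \<mu> (snd p))\<bar>)" by (rule integrable_abs)
      show "AE p in ?P. (\<lambda>N. ?X N (fst p - snd p) * (\<mu> (fst p) * \<mu> (snd p))) \<longlonglongrightarrow> ?KS (fst p - snd p) * (\<mu> (fst p) * \<mu> (snd p))"
        using AE_off_diagonal
      proof eventually_elim
        case (elim p)
        then have "0 < norm (s *\<^sub>R (fst p - snd p))" using s0 by simp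
        then show ?case unfolding gauss_series_def q_def by (intro tendsto_mult_right summable_LIMSEQ summable) auto
      qed
      fix N
      show "AE p in ?P. norm (?X N (fst p - snd p) * (\<mu> (fst p) * \<mu> (snd p))) \<le> \<bar>?KS (fst p - snd p) * (\<mu> (fst p) * \<mu> (snd p))\<bar>"
        using AE_off_diagonal
      proof eventually_elim
        case (elim p)
        then have "0 < norm (s *\<^sub>R (fst p - snd p))" using s0 by simp
        then have "?X N (fst p - snd p) \<le> ?KS (fst p - snd p)"
          unfolding gauss_series_def q_def by (intro sum_le_suminf summable) (auto simp: gauss_term_nonneg)
        moreover have "0 \<le> ?X N (fst p - snd p)" by (intro sum_nonneg gauss_term_nonneg)
        ultimately show ?case unfolding real_norm_def abs_mult[of _ "\<mu> _ * \<mu> _"] by (intro mult_right_mono) auto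
      qed
      show "(\<lambda>p. ?X N (fst p - snd p) * (\<mu> (fst p) * \<mu> (snd p))) \<in> borel_measurable ?P"
        unfolding gauss_term_def by measurable
    next
      show "(\<lambda>p. ?KS (fst p - snd p) * (\<mu> (fst p) * \<mu> (snd p))) \<in> borel_measurable ?P"
        using pairing_integrable[OF lKS \<mu>] by (rule borel_measurable_integrable)
    qed
    have "s powr q * pairing (\<lambda>z. exp (- ((norm z)\<^sup>2 / 2))) \<mu> \<le> pairing (?X N) \<mu>" if "n < N" for N
    proof -
      have "pairing (?X N) \<mu> = (\<Sum>j<N. a j * pairing (heat_kernel (t j)) \<mu>)"
        unfolding gauss_heat by (rule pairing_sum_heat_kernels[OF \<mu> t])
      moreover have "(\<Sum>j\<in>{n}. a j * pairing (heat_kernel (t j)) \<mu>) \<le> (\<Sum>j<N. a j * pairing (heat_kernel (t j)) \<mu>)"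
        using that a nn t by (intro sum_mono2) auto
      moreover have "s powr q * pairing (\<lambda>z. exp (- ((norm z)\<^sup>2 / 2))) \<mu> = a n * pairing (heat_kernel (t n)) \<mu>"
      proof -
        have ls: "lam ^ (2 * Suc n) = s\<^sup>2" unfolding s by (simp only: power_mult[symmetric] mult.commute)
        have "lam powr (q * real (Suc n)) = (lam powr real (Suc n)) powr q" by (simp only: powr_powr mult.commute)
        also have "lam powr real (Suc n) = s" unfolding s using lam by (intro powr_realpow) auto
        finally have "s powr q * exp (- ((norm z)\<^sup>2 / 2)) = gauss_term q lam n (norm (s *\<^sub>R z))" for z :: 'a
          unfolding gauss_term_def ls using s0 by (simp add: power_mult_distrib)
        then show ?thesis by (simp only: gauss_heat pairing_cmult[symmetric])
      qed
      ultimately show ?thesis by simp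
    qed
    then show ?thesis using lim by (intro LIMSEQ_le_const[OF lim] exI[of _ "Suc n"]) auto
  qed
  have "pairing (\<lambda>z. radial_potential (norm (s *\<^sub>R z))) \<mu> = pairing (\<lambda>z. ?Kr z + (s\<^sup>2 / 2 * (norm z)\<^sup>2 + (- c) * ?KS z)) \<mu>"
    unfolding radial_potential_def by (rule arg_cong2[where f = pairing]) (auto simp: power_mult_distrib fun_eq_iff)
  also have "\<dots> = pairing ?Kr \<mu> + (s\<^sup>2 / 2 * pairing (\<lambda>z. (norm z)\<^sup>2) \<mu> + (- c) * pairing ?KS \<mu>)"
  proof -
    have l1: "locally_integrable (\<lambda>z :: 'a. s\<^sup>2 / 2 * (norm z)\<^sup>2)"
      by (rule locally_integrable_affine_bound[OF lKq, of _ "s\<^sup>2 / 2" "\<lambda>_. 0"]) (auto simp: abs_mult)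
    have l2: "locally_integrable (\<lambda>z. (- c) * ?KS z)"
    proof (rule locally_integrable_affine_bound[OF lKS, of _ c "\<lambda>_. 0"])
      show "\<bar>(- c) * ?KS x\<bar> \<le> c * \<bar>?KS x\<bar> + 0" for x using c by (simp add: abs_mult)
    qed (measurable, use c in simp)
    show ?thesis
      unfolding pairing_add[OF lKr locally_integrable_add[OF l1 l2] \<mu>] pairing_add[OF l1 l2 \<mu>] pairing_cmult ..
  qed
  also have "\<dots> \<le> s powr q * pairing (\<lambda>z. R (norm z)) \<mu> + (0 + (- c) * (s powr q * pairing (\<lambda>z. exp (- ((norm z)\<^sup>2 / 2))) \<mu>))"
    unfolding pKr using pairing_norm_square_nonpos[OF \<mu> \<mu>0] pKS c
    by (intro add_mono mult_left_mono_neg order_refl) (auto simp: mult_nonneg_nonpos)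
  also have "\<dots> = s powr q * (pairing (\<lambda>z. R (norm z)) \<mu> - c * pairing (\<lambda>z. exp (- ((norm z)\<^sup>2 / 2))) \<mu>)"
    by (simp add: algebra_simps)
  also have "\<dots> < 0" using neg s0 by (intro mult_pos_neg) auto
  finally show ?thesis .
qed

text \<open>
  Dilating and translating the packet leaves its supremum unchanged, so one bound \<open>C\<close> serves all
  radii.
\<close>

lemma concentrated_negative_pairing:
  assumes d: "d = DIM('a::euclidean_space)" and low: "c_lower d \<alpha> < c"
  shows "\<exists>C. \<forall>r>0. \<forall>x0 :: 'a. \<exists>\<mu>. \<mu> \<in> borel_measurable borel \<and> (\<forall>x. \<bar>\<mu> x\<bar> \<le> C \<and> (x \<notin> ball x0 r \<longrightarrow> \<mu> x = 0)) \<and>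
      (\<integral>x. \<mu> x \<partial>lborel) = 0 \<and> (\<integral>p. radial_potential (norm (fst p - snd p)) * (\<mu> (fst p) * \<mu> (snd p)) \<partial>(lborel \<Otimes>\<^sub>M lborel)) < 0"
proof -
  obtain \<mu> :: "'a \<Rightarrow> real" where \<mu>: "test_function \<mu>" "(\<integral>x. \<mu> x \<partial>lborel) = 0"
    "\<And>t. 0 < t \<Longrightarrow> 0 \<le> pairing (heat_kernel t) \<mu>"
    "pairing (\<lambda>z. R (norm z)) \<mu> < c * pairing (\<lambda>z. exp (- ((norm z)\<^sup>2 / 2))) \<mu>"
    by (rule base_test_function[OF d low]) blast
  obtain C A where [measurable]: "\<mu> \<in> borel_measurable borel" and C: "0 < C" "0 < A" "\<And>x. \<bar>\<mu> x\<bar> \<le> C" "\<And>x. A \<le> norm x \<Longrightarrow> \<mu> x = 0"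
    using test_functionE[OF \<mu>(1)] by metis
  have Zm: "(\<lambda>z :: 'a. radial_potential (norm z)) \<in> borel_measurable borel"
    unfolding radial_potential_def riesz_kernel_def gauss_series_def gauss_term_def by measurable
  show ?thesis
  proof (intro exI[of _ C] allI impI)
    fix r :: real and x0 :: 'a assume r: "0 < r"
    have "(\<lambda>n. lam ^ n * A) \<longlonglongrightarrow> 0 * A" using lam by (intro tendsto_mult_right LIMSEQ_realpow_zero) auto
    then have "\<forall>\<^sub>F n in sequentially. lam ^ n * A < r" using r by (intro order_tendstoD(2)[of _ "0 * A"]) auto
    then have "\<forall>\<^sub>F n in sequentially. lam ^ n * A < r \<and> 0 < n" using eventually_gt_at_top[of 0] by (rule eventually_conj)
    then obtain m where m: "lam ^ m * A < r" "0 < m" by (auto dest: eventually_happens)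
    then obtain n where n: "m = Suc n" by (cases m) auto
    define s where "s = lam ^ Suc n"
    have s: "0 < s" "s * A < r" using lam m n by (auto simp: s_def)
    let ?\<nu> = "\<lambda>x. \<mu> ((x - x0) /\<^sub>R s)"
    show "\<exists>\<mu>. \<mu> \<in> borel_measurable borel \<and> (\<forall>x. \<bar>\<mu> x\<bar> \<le> C \<and> (x \<notin> ball x0 r \<longrightarrow> \<mu> x = 0)) \<and>
      (\<integral>x. \<mu> x \<partial>lborel) = 0 \<and> (\<integral>p. radial_potential (norm (fst p - snd p)) * (\<mu> (fst p) * \<mu> (snd p)) \<partial>(lborel \<Otimes>\<^sub>M lborel)) < 0"
    proof (intro exI[of _ ?\<nu>] conjI allI impI)
      show "?\<nu> \<in> borel_measurable borel" by measurable
      show "\<bar>?\<nu> x\<bar> \<le> C" for x by (rule C(3))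
      fix x assume "x \<notin> ball x0 r"
      then have "r \<le> norm (x - x0)" by (simp add: dist_norm norm_minus_commute)
      then have "s * A \<le> norm (x - x0)" using s by simp
      then have "A \<le> norm (x - x0) / s" using s by (simp add: pos_le_divide_eq mult.commute)
      also have "\<dots> = norm ((x - x0) /\<^sub>R s)"
        unfolding norm_scaleR using s(1) by (simp add: divide_inverse mult.commute)
      finally show "?\<nu> x = 0" by (rule C(4))
    next
      have "(\<integral>x. ?\<nu> x \<partial>(lborel :: 'a measure)) = (\<integral>x. ?\<nu> x \<partial>density (distr lborel borel (\<lambda>x. x0 + s *\<^sub>R x)) (\<lambda>_. ennreal (\<bar>s\<bar> ^ DIM('a))))"
        by (subst lborel_affine[of s x0]) (use s in auto)
      also have "\<dots> = (\<integral>x. (\<bar>s\<bar> ^ DIM('a)) *\<^sub>R \<mu> x \<partial>lborel)"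
        using s by (subst integral_density; (subst integral_distr)?) auto
      finally show "(\<integral>x. ?\<nu> x \<partial>lborel) = 0" using \<mu>(2) by simp
    next
      have "pairing (\<lambda>z. radial_potential (norm z)) ?\<nu> = s ^ DIM('a \<times> 'a) * pairing (\<lambda>z. radial_potential (norm (s *\<^sub>R z))) \<mu>"
        by (rule pairing_affine[OF Zm _ s(1)]) measurable
      also have "\<dots> < 0"
        using rescaled_pairing_negative[OF d \<mu>(1,2,3,4) s_def] s by (intro mult_pos_neg) auto
      finally show "(\<integral>p. radial_potential (norm (fst p - snd p)) * (?\<nu> (fst p) * ?\<nu> (snd p)) \<partial>(lborel \<Otimes>\<^sub>M lborel)) < 0"
        by (simp add: pairing_def)
    qed
  qed
qed

end

theorem corollary8p4:
  fixes \<alpha> c\<^sub>W :: real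
  assumes "DIM('a::euclidean_space) \<ge> 2 \<longrightarrow>
      (real DIM('a) + 2) / 2 < \<alpha> \<and> \<alpha> < real DIM('a) + 2"
    and "DIM('a) = 1 \<longrightarrow> 2 \<le> \<alpha> \<and> \<alpha> < 3"
    and "c_lower DIM('a) \<alpha> < c\<^sub>W" and "c\<^sub>W < c_upper DIM('a) \<alpha>"
  shows "\<exists>lam0. 0 < lam0 \<and> lam0 < 1 \<and>
    (\<forall>lam. 0 < lam \<longrightarrow> lam < lam0 \<longrightarrow>
      (\<forall>\<rho> :: 'a measure. compact_prob \<rho> \<longrightarrow> d_infinity_local_minimizer (W_pot \<alpha> c\<^sub>W lam) \<rho> \<longrightarrow>
        almost_fractal \<rho>))"
proof -
  have d: "0 < DIM('a)" by simp
  have \<alpha>: "0 < \<alpha>" "\<alpha> < real DIM('a) + 2"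
  proof -
    consider "DIM('a) = 1" | "2 \<le> DIM('a)" using d by linarith
    then have "0 < \<alpha> \<and> \<alpha> < real DIM('a) + 2"
    proof cases
      case 1 then show ?thesis using assms(2) by simp
    next
      case 2
      then have "0 < (real DIM('a) + 2) / 2" by simp
      then show ?thesis using assms(1) 2 by linarith
    qed
    then show "0 < \<alpha>" "\<alpha> < real DIM('a) + 2" by auto
  qed
  have "0 \<le> c_lower DIM('a) \<alpha>" by (simp add: c_lower_def)
  then have c: "0 < c\<^sub>W" using assms(3) by linarith
  obtain \<theta> lam0 where lam0: "0 < lam0" "lam0 < 1"
    "\<And>lam. 0 < lam \<Longrightarrow> lam < lam0 \<Longrightarrow> sparse_gaussians DIM('a) \<alpha> c\<^sub>W lam \<theta>"
    using sparse_gaussians_eventually[OF d \<alpha> c assms(4)] by metis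
  show ?thesis
  proof (intro exI[of _ lam0] conjI allI impI lam0(1,2))
    fix lam and \<rho> :: "'a measure"
    assume lam: "0 < lam" "lam < lam0" and \<rho>: "compact_prob \<rho>" and min: "d_infinity_local_minimizer (W_pot \<alpha> c\<^sub>W lam) \<rho>"
    interpret sparse_gaussians "DIM('a)" \<alpha> c\<^sub>W lam \<theta> by (rule lam0(3)[OF lam])
    obtain C where C: "\<And>r x0 :: 'a. 0 < r \<Longrightarrow> \<exists>\<mu>. \<mu> \<in> borel_measurable borel \<and> (\<forall>x. \<bar>\<mu> x\<bar> \<le> C \<and> (x \<notin> ball x0 r \<longrightarrow> \<mu> x = 0)) \<and>
      (\<integral>x. \<mu> x \<partial>lborel) = 0 \<and> (\<integral>p. radial_potential (norm (fst p - snd p)) * (\<mu> (fst p) * \<mu> (snd p)) \<partial>(lborel \<Otimes>\<^sub>M lborel)) < 0"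
      using concentrated_negative_pairing[OF refl assms(3)] by blast
    show "almost_fractal \<rho>"
      unfolding almost_fractal_def
    proof (intro conjI allI impI)
      show "\<not> x isolated_in msupport \<rho>" for x by (rule no_isolated_points[OF refl \<rho> min])
      fix f and \<epsilon>\<^sub>0 :: real assume "ac_part_representative \<rho> f" "0 < \<epsilon>\<^sub>0"
      then show "interior {x. \<epsilon>\<^sub>0 \<le> f x} = {}"
        by (rule superlevel_interior_empty[OF refl \<rho> min _ _ C])
    qed
  qed
qed

end
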